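(* Let $f(n,s)$ be as defined in the context. Then, as $n\to\infty$ (with $s=s(n)$), \[ f(n,s)=\begin{cases} O(n/s) & \text{for } n^{1/3}\le s\le n,\\ O\!\left(n^{5/6+o(1)}/\sqrt{s}\right) & \text{for } 3\le s\le n^{1/3}.\end{cases} \] In particular, $f(n,s)=\Theta(n/s)$ when $s=\Omega(\sqrt{n\log n})$.
   Context: For $n,s\in\mathbb{N}$ with $n\ge s\ge 2$, $f(n,s)$ denotes the largest integer such that every set $P\subseteq\mathbb{R}^2$ of $n$ points with at most $s$ points on any line (i.e., containing no $s+1$ collinear points) contains a subset of size $f(n,s)$ in general position, i.e., containing no three collinear points. Here $s=s(n)$ may depend on $n$, and asymptotic notation refers to $n\to\infty$. *)

theory Defs
  imports "HOL-Analysis.Analysis" "HOL-Library.Landau_Symbols"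
begin

definition no_collinear :: "nat \<Rightarrow> (real ^ 2) set \<Rightarrow> bool" where
  "no_collinear k P \<longleftrightarrow> (\<forall>T. T \<subseteq> P \<and> card T = k \<longrightarrow> \<not> collinear T)"

definition general_position :: "(real ^ 2) set \<Rightarrow> bool" where
  "general_position P \<longleftrightarrow> no_collinear 3 P"

definition forces_general_position :: "nat \<Rightarrow> nat \<Rightarrow> nat \<Rightarrow> bool" where
  "forces_general_position n s k \<longleftrightarrow>
     (\<forall>P :: (real ^ 2) set. finite P \<and> card P = n \<and> no_collinear (s + 1) P \<longrightarrow>
        (\<exists>Q. Q \<subseteq> P \<and> card Q = k \<and> general_position Q))"

definition f :: "nat \<Rightarrow> nat \<Rightarrow> nat" where
  "f n s = (GREATEST k. forces_general_position n s k)"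

text \<open>For \<open>s \<ge> 2\<close> the maximum defining \<open>f n s\<close> exists: \<open>k = 0\<close> always qualifies,
  and \<open>n\<close> points on a parabola show that every qualifying \<open>k\<close> is at most \<open>n\<close>.\<close>

lemma no_collinear_mono:
  assumes "no_collinear k P" "k \<le> m" "0 < m"
  shows "no_collinear m P"
  unfolding no_collinear_def
proof (intro allI impI notI)
  fix T assume T: "T \<subseteq> P \<and> card T = m" and c: "collinear T"
  obtain U where "U \<subseteq> T" "card U = k"
    using T assms(2) by (metis obtain_subset_with_card_n)
  then show False
    using assms(1) T c collinear_subset unfolding no_collinear_def by blast
qed

lemma ex_general_position:
  "\<exists>P :: (real ^ 2) set. finite P \<and> card P = n \<and> general_position P"
proof -
  define g :: "nat \<Rightarrow> real ^ 2" where "g i = vector [real i, (real i)\<^sup>2]" for i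
  have g: "g i $ 1 = real i" "g i $ 2 = (real i)\<^sup>2" for i
    by (simp_all add: g_def)
  have "inj g"
    by (rule injI) (metis g(1) of_nat_eq_iff)
  moreover have "general_position (g ` {..<n})"
    unfolding general_position_def no_collinear_def
  proof (intro allI impI notI)
    fix T assume T: "T \<subseteq> g ` {..<n} \<and> card T = 3" and c: "collinear T"
    obtain x y z where xyz: "T = {x, y, z}" "x \<noteq> y" "y \<noteq> z" "x \<noteq> z"
      using T by (metis card_3_iff)
    obtain i j k where ijk: "x = g i" "y = g j" "z = g k"
      using T xyz(1) by auto
    have ne: "real i \<noteq> real j" "real j \<noteq> real k" "real i \<noteq> real k"
      using xyz ijk by auto
    obtain u where u: "\<forall>x\<in>T. \<forall>y\<in>T. \<exists>c. x - y = c *\<^sub>R u"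
      using c unfolding collinear_def by blast
    obtain a where a: "x - y = a *\<^sub>R u" using u xyz(1) by blast
    obtain b where b: "x - z = b *\<^sub>R u" using u xyz(1) by blast
    have 1: "real i - real j = a * u $ 1" "(real i)\<^sup>2 - (real j)\<^sup>2 = a * u $ 2"
      using arg_cong[OF a, of "\<lambda>v. v $ 1"] arg_cong[OF a, of "\<lambda>v. v $ 2"]
      by (simp_all add: ijk g)
    have 2: "real i - real k = b * u $ 1" "(real i)\<^sup>2 - (real k)\<^sup>2 = b * u $ 2"
      using arg_cong[OF b, of "\<lambda>v. v $ 1"] arg_cong[OF b, of "\<lambda>v. v $ 2"]
      by (simp_all add: ijk g)
    have "(real i - real j) * ((real i)\<^sup>2 - (real k)\<^sup>2) =
          (real i - real k) * ((real i)\<^sup>2 - (real j)\<^sup>2)"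
      unfolding 1 2 by (simp add: algebra_simps)
    moreover have "(real i - real j) * ((real i)\<^sup>2 - (real k)\<^sup>2) -
          (real i - real k) * ((real i)\<^sup>2 - (real j)\<^sup>2) =
          (real i - real j) * (real i - real k) * (real k - real j)"
      by (simp add: algebra_simps power2_eq_square)
    ultimately have "(real i - real j) * (real i - real k) * (real k - real j) = 0"
      by linarith
    then show False using ne by simp
  qed
  ultimately show ?thesis
    by (intro exI[of _ "g ` {..<n}"]) (simp add: card_image inj_on_subset)
qed

lemma f_is_greatest:
  assumes "2 \<le> s"
  shows "forces_general_position n s (f n s)"
    and "\<And>k. forces_general_position n s k \<Longrightarrow> k \<le> f n s"
proof -
  have 0: "forces_general_position n s 0"
    unfolding forces_general_position_def general_position_def no_collinear_def
    by (intro allI impI exI[of _ "{}"]) auto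
  obtain P :: "(real ^ 2) set" where P: "finite P" "card P = n" "general_position P"
    using ex_general_position by blast
  have "no_collinear (s + 1) P"
    using no_collinear_mono[OF P(3)[unfolded general_position_def]] assms by simp
  then have P': "finite P \<and> card P = n \<and> no_collinear (s + 1) P"
    using P by simp
  have le: "k \<le> n" if k: "forces_general_position n s k" for k
  proof -
    obtain Q where "Q \<subseteq> P" "card Q = k"
      using k[unfolded forces_general_position_def, rule_format, OF P'] by blast
    then show ?thesis using card_mono[OF P(1), of Q] P(2) by simp
  qed
  show "forces_general_position n s (f n s)"
    unfolding f_def using 0 le by (rule GreatestI_nat)
  show "k \<le> f n s" if k: "forces_general_position n s k" for k
    unfolding f_def using k le by (rule Greatest_le_nat)
qed

end

theory Submission
  imports Defs "HOL-Real_Asymp.Real_Asymp"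
begin

text \<open>
  Upper bounds come from subsets of the lattice cube \<open>{0..<m}\<^sup>3\<close>, projected to the plane by an
  injective map that creates no new collinear triples. If \<open>n \<le> s\<^sup>3\<close>, the first \<open>n\<close> points of
  \<open>{0..<s}\<^sup>3\<close> lie on about \<open>n/s\<close> parallel lines, each of which contains at most two points of a set in
  general position. For smaller \<open>s\<close> one keeps each point of the cube with probability about \<open>s/m\<close>
  (up to logarithms) and deletes a point from every remaining \<open>s + 1\<close> collinear ones. Subsets
  without collinear triples are controlled by hypergraph containers: a set \<open>A\<close> of size \<open>t m\<^sup>2\<close> carries,
  in each of the roughly \<open>t\<^sup>3\<close> primitive directions of size at most \<open>t\<close>, about \<open>|A|\<close> disjoint collinear
  triples, and all of these together form a linear 3-graph that is almost regular.

  The lower bound colours the points at random and deletes: by the Szemeredi-Trotter theorem, \<open>n\<close>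
  points with at most \<open>s\<close> on a line span \<open>O(n\<^sup>2 ln s + n s\<^sup>2)\<close> collinear triples. That theorem follows from the
  crossing lemma, and the linear bound on the number of edges of a plane straight-line graph from a
  charging argument along vertical lines.
\<close>

section \<open>Random colourings\<close>

text \<open>The range splits at \<open>n^(1/3)\<close> because for \<open>n \<le> s^3\<close> the
  cube of side \<open>s\<close> has enough points, and no line meets it in more than
  \<open>s\<close> of them. For smaller \<open>s\<close> the cube has side \<open>m\<close>,
  thinning by \<open>s/m\<close> leaves about \<open>m^2 * s\<close> points, and so \<open>m\<close>
  is about \<open>sqrt (n/s)\<close>. There are too many sets in general position for a union bound;
  containers replace them by few sets of size about \<open>\<tau>^2 * m^2\<close>. In a linear
  3-graph one chosen vertex forbids only a matching of pairs, so fingerprints have two stages: links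
  of chosen vertices are accumulated into a graph, and then neighbourhoods in that graph are
  excluded. With degree \<open>D\<close> of order \<open>\<tau>^6\<close> and cap
  \<open>\<theta> = \<tau>^3\<close>, both stages have length about \<open>m^2/\<tau>\<close>.
  Equating this with the thinned container size gives \<open>\<tau>^3 = m/s\<close>, hence sets of
  size \<open>m^(5/3) * s^(1/3)\<close>, which is \<open>n^(5/6) / sqrt s\<close>. The lower bound
  is sharp once \<open>s^2\<close> dominates \<open>n ln n\<close>: both terms of the triple count
  are then \<open>O(n s^2)\<close>, and \<open>O(s)\<close> colours suffice. A colour class serves
  as a random subset of density \<open>1/r\<close>, so every expectation is a finite count of
  colourings.\<close>

lemma card_colourings_const:
  assumes "finite P" "B \<subseteq> P" "i < r"
  shows "card {\<kappa> \<in> P \<rightarrow>\<^sub>E {..<r::nat}. \<forall>b\<in>B. \<kappa> b = i} = r ^ (card P - card B)"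
proof -
  have "{\<kappa> \<in> P \<rightarrow>\<^sub>E {..<r}. \<forall>b\<in>B. \<kappa> b = i} = (\<Pi>\<^sub>E x\<in>P. if x \<in> B then {i} else {..<r})"
    using assms by (fastforce simp: PiE_iff extensional_def split: if_splits)
  then have "card {\<kappa> \<in> P \<rightarrow>\<^sub>E {..<r}. \<forall>b\<in>B. \<kappa> b = i} = (\<Prod>x\<in>P. if x \<in> B then 1 else r)"
    using assms by (simp add: card_PiE if_distrib cong: if_cong)
  also have "\<dots> = (\<Prod>x\<in>P - B. r)"
    using assms by (intro prod.mono_neutral_cong_right) auto
  also have "\<dots> = r ^ (card P - card B)"
    using assms by (simp add: card_Diff_subset finite_subset)
  finally show ?thesis .
qed

text \<open>A union bound over the \<open>r\<close> possible common colours: the probability is at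
  most \<open>r\<close> to the power \<open>1 - card B\<close>, cleared of denominators to stay in
  the naturals.\<close>

lemma card_monochromatic_colourings:
  assumes "finite P" "B \<subseteq> P"
  shows "r ^ card B * card {\<kappa> \<in> P \<rightarrow>\<^sub>E {..<r::nat}. \<exists>i<r. \<forall>b\<in>B. \<kappa> b = i} \<le> r * r ^ card P"
proof -
  have le: "card B \<le> card P" using assms card_mono by blast
  have "{\<kappa> \<in> P \<rightarrow>\<^sub>E {..<r}. \<exists>i<r. \<forall>b\<in>B. \<kappa> b = i}
      = (\<Union>i<r. {\<kappa> \<in> P \<rightarrow>\<^sub>E {..<r}. \<forall>b\<in>B. \<kappa> b = i})" by auto
  then have "card {\<kappa> \<in> P \<rightarrow>\<^sub>E {..<r}. \<exists>i<r. \<forall>b\<in>B. \<kappa> b = i}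
      \<le> (\<Sum>i<r. card {\<kappa> \<in> P \<rightarrow>\<^sub>E {..<r}. \<forall>b\<in>B. \<kappa> b = i})"
    by (simp add: card_UN_le)
  also have "\<dots> = (\<Sum>i<r. r ^ (card P - card B))"
    using card_colourings_const[OF assms] by (intro sum.cong) auto
  finally have "r ^ card B * card {\<kappa> \<in> P \<rightarrow>\<^sub>E {..<r}. \<exists>i<r. \<forall>b\<in>B. \<kappa> b = i}
      \<le> r ^ card B * (r * r ^ (card P - card B))" by simp
  also have "\<dots> = r * (r ^ card B * r ^ (card P - card B))" by simp
  also have "\<dots> = r * r ^ card P" using le by (simp flip: power_add)
  finally show ?thesis .
qed

lemma sum_card_swap:
  assumes "finite S" "finite X"
  shows "(\<Sum>a\<in>S. card {x\<in>X. Q a x}) = (\<Sum>x\<in>X. card {a\<in>S. Q a x})"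
proof -
  have "(\<Sum>a\<in>S. card {x\<in>X. Q a x}) = (\<Sum>a\<in>S. \<Sum>x\<in>X. if Q a x then 1 else 0)"
    using assms by (simp add: sum.inter_filter[symmetric])
  also have "\<dots> = (\<Sum>x\<in>X. \<Sum>a\<in>S. if Q a x then 1 else 0)" by (rule sum.swap)
  also have "\<dots> = (\<Sum>x\<in>X. card {a\<in>S. Q a x})"
    using assms by (simp add: sum.inter_filter[symmetric])
  finally show ?thesis .
qed

lemma sum_card_colour_classes:
  assumes "finite P" "\<kappa> \<in> P \<rightarrow> {..<r::nat}"
  shows "(\<Sum>i<r. card {x\<in>P. \<kappa> x = i}) = card P"
proof -
  have "card P = card (\<Union>i<r. {x\<in>P. \<kappa> x = i})"
    using assms by (intro arg_cong[where f=card]) auto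
  also have "\<dots> = (\<Sum>i<r. card {x\<in>P. \<kappa> x = i})"
    using assms by (intro card_UN_disjoint) auto
  finally show ?thesis by simp
qed

text \<open>One chosen point is removed from every member of \<open>T\<close>.\<close>

lemma deletion_avoids:
  assumes "finite P" "finite T" and ne: "\<And>t. t \<in> T \<Longrightarrow> t \<noteq> {} \<and> t \<subseteq> P"
  shows "\<exists>Q\<subseteq>P. card P \<le> card Q + card T \<and> (\<forall>t\<in>T. \<not> t \<subseteq> Q)"
proof -
  define c where "c t = (SOME x. x \<in> t)" for t :: "'a set"
  have c: "c t \<in> t" if "t \<in> T" for t
    using ne[OF that] unfolding c_def by (simp add: some_in_eq)
  have "card P \<le> card (P - c ` T) + card (c ` T)"
    using diff_card_le_card_Diff[of "c ` T" P] assms(2) by simp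
  then have "card P \<le> card (P - c ` T) + card T"
    using card_image_le[OF assms(2), of c] by linarith
  then show ?thesis using c by (intro exI[of _ "P - c ` T"]) blast
qed

text \<open>Colour with \<open>r\<close> colours at random. On average few members of \<open>T\<close> and of \<open>\<K>\<close> are
  monochromatic; members of \<open>T\<close> are destroyed by deleting a point, and one colour class does at
  least as well as the average.\<close>

lemma colour_and_delete:
  assumes fin: "finite P" "finite T" "finite \<K>" and P: "P \<noteq> {}" and r: "0 < r"
    and T: "\<And>t. t \<in> T \<Longrightarrow> t \<subseteq> P \<and> card t = h + 1" and \<K>: "\<And>K. K \<in> \<K> \<Longrightarrow> K \<subseteq> P \<and> card K = k"
    and fewT: "4 * card T \<le> r ^ h * card P" and few\<K>: "4 * r * card \<K> \<le> r ^ k"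
  shows "\<exists>Q\<subseteq>P. card P \<le> 2 * r * card Q \<and> (\<forall>t\<in>T. \<not> t \<subseteq> Q) \<and> (\<forall>K\<in>\<K>. \<not> K \<subseteq> Q)"
proof -
  let ?S = "P \<rightarrow>\<^sub>E {..<r}"
  define mono where "mono \<kappa> t \<longleftrightarrow> (\<exists>i<r. \<forall>b\<in>t. \<kappa> b = i)" for \<kappa> :: "'a \<Rightarrow> nat" and t
  define N where "N = card P"
  have N: "0 < N" using P fin by (simp add: N_def card_gt_0_iff)
  have finS: "finite ?S" using fin by (simp add: finite_PiE)
  have cS: "card ?S = r ^ N" using fin by (simp add: card_PiE N_def)
  have "r ^ h * (\<Sum>\<kappa>\<in>?S. card {t\<in>T. mono \<kappa> t}) = (\<Sum>t\<in>T. r ^ h * card {\<kappa>\<in>?S. mono \<kappa> t})"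
    using sum_card_swap[OF finS fin(2), of mono] by (simp add: sum_distrib_left)
  also have "\<dots> \<le> (\<Sum>t\<in>T. r ^ N)"
  proof (rule sum_mono)
    fix t assume t: "t \<in> T"
    have "r * (r ^ h * card {\<kappa>\<in>?S. mono \<kappa> t}) \<le> r * r ^ N"
      using card_monochromatic_colourings[of P t r] fin T[OF t] by (simp add: mono_def N_def mult.assoc)
    then show "r ^ h * card {\<kappa>\<in>?S. mono \<kappa> t} \<le> r ^ N" using r by simp
  qed
  finally have "r ^ h * (4 * (\<Sum>\<kappa>\<in>?S. card {t\<in>T. mono \<kappa> t})) \<le> 4 * card T * r ^ N" by simp
  also have "\<dots> \<le> r ^ h * N * r ^ N" using fewT unfolding N_def by (rule mult_right_mono) simp
  also have "\<dots> = r ^ h * (N * r ^ N)" by simp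
  finally have 1: "4 * (\<Sum>\<kappa>\<in>?S. card {t\<in>T. mono \<kappa> t}) \<le> N * r ^ N" using r by simp
  let ?E = "{\<kappa>\<in>?S. \<exists>K\<in>\<K>. mono \<kappa> K}"
  have "?E = (\<Union>K\<in>\<K>. {\<kappa>\<in>?S. mono \<kappa> K})" by blast
  then have "card ?E \<le> (\<Sum>K\<in>\<K>. card {\<kappa>\<in>?S. mono \<kappa> K})" using fin(3) by (simp add: card_UN_le)
  then have "r ^ k * card ?E \<le> (\<Sum>K\<in>\<K>. r ^ k * card {\<kappa>\<in>?S. mono \<kappa> K})"
    by (simp flip: sum_distrib_left)
  also have "\<dots> \<le> (\<Sum>K\<in>\<K>. r * r ^ N)"
  proof (rule sum_mono)
    fix K assume "K \<in> \<K>"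
    then show "r ^ k * card {\<kappa>\<in>?S. mono \<kappa> K} \<le> r * r ^ N"
      using card_monochromatic_colourings[of P K r] fin \<K> by (simp add: mono_def N_def)
  qed
  finally have "r ^ k * (4 * card ?E) \<le> 4 * r * card \<K> * r ^ N" by (simp add: ac_simps)
  also have "\<dots> \<le> r ^ k * r ^ N" using few\<K> by (rule mult_right_mono) simp
  finally have 2: "4 * card ?E \<le> r ^ N" using r by simp
  \<comment> \<open>By the two estimates above, each summand has average at most \<open>N/2\<close>.
    The weight \<open>2 * N\<close> on the bad event \<open>?E\<close> makes any colouring below the
    average avoid it outright.\<close>
  have "\<exists>\<kappa>\<in>?S. 2 * card {t\<in>T. mono \<kappa> t} + 2 * N * (if \<kappa> \<in> ?E then 1 else 0) \<le> N"
  proof (rule ccontr)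
    assume "\<not> ?thesis"
    then have "(\<Sum>\<kappa>\<in>?S. N) < (\<Sum>\<kappa>\<in>?S. 2 * card {t\<in>T. mono \<kappa> t} + 2 * N * (if \<kappa> \<in> ?E then 1 else 0))"
      using finS cS r by (intro sum_strict_mono) (auto simp: not_le card_gt_0_iff)
    also have "\<dots> = 2 * (\<Sum>\<kappa>\<in>?S. card {t\<in>T. mono \<kappa> t}) + 2 * N * (\<Sum>\<kappa>\<in>?S. if \<kappa> \<in> ?E then 1 else 0)"
      by (simp only: sum.distrib sum_distrib_left)
    also have "(\<Sum>\<kappa>\<in>?S. if \<kappa> \<in> ?E then 1 else 0) = (\<Sum>\<kappa>\<in>{\<kappa>\<in>?S. \<kappa> \<in> ?E}. 1::nat)"
      by (rule sum.inter_filter[OF finS, symmetric])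
    also have "\<dots> = card ?E" by (simp add: conj_ac cong: conj_cong)
    finally have "N * r ^ N < 2 * (\<Sum>\<kappa>\<in>?S. card {t\<in>T. mono \<kappa> t}) + 2 * N * card ?E"
      by (simp add: cS mult.commute)
    moreover have "N * (4 * card ?E) \<le> N * r ^ N" using 2 by (rule mult_left_mono) simp
    then have "4 * (N * card ?E) \<le> N * r ^ N" by (simp only: mult.left_commute)
    moreover have "2 * N * card ?E = 2 * (N * card ?E)" by simp
    ultimately show False using 1 by linarith
  qed
  then obtain \<kappa> where \<kappa>: "\<kappa> \<in> ?S" and \<kappa>': "2 * card {t\<in>T. mono \<kappa> t} + 2 * N * (if \<kappa> \<in> ?E then 1 else 0) \<le> N"
    by blast
  have noE: "\<kappa> \<notin> ?E" using \<kappa>' N by (auto split: if_splits)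
  have few: "2 * card {t\<in>T. mono \<kappa> t} \<le> N" using \<kappa>' by linarith
  let ?P = "\<lambda>i. {x\<in>P. \<kappa> x = i}" and ?T = "\<lambda>i. {t\<in>T. t \<subseteq> {x\<in>P. \<kappa> x = i}}"
  have neT: "t \<noteq> {}" if "t \<in> T" for t using T[OF that] by auto
  \<comment> \<open>Summed over the colours, points minus monochromatic members of \<open>T\<close>
    is at least \<open>N - N/2\<close>, so some colour has at least \<open>N/(2r)\<close>.\<close>
  have "\<exists>i<r. N \<le> 2 * r * (card (?P i) - card (?T i))"
  proof (rule ccontr)
    assume "\<not> ?thesis"
    then have "2 * r * card (?P i) < N + 2 * r * card (?T i)" if "i < r" for i
      using that by (auto simp: not_le diff_mult_distrib2)
    then have "(\<Sum>i<r. 2 * r * card (?P i)) < (\<Sum>i<r. N + 2 * r * card (?T i))"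
      using r by (intro sum_strict_mono) auto
    then have 1: "2 * r * (\<Sum>i<r. card (?P i)) < r * N + 2 * r * (\<Sum>i<r. card (?T i))"
      by (simp add: sum.distrib sum_distrib_left)
    have "(\<Sum>i<r. card (?T i)) = card (\<Union>i<r. ?T i)"
    proof (intro card_UN_disjoint[symmetric] ballI impI)
      fix i j :: nat assume "i \<noteq> j"
      then show "?T i \<inter> ?T j = {}" using neT by blast
    qed (use fin in auto)
    also have "\<dots> \<le> card {t\<in>T. mono \<kappa> t}"
      using fin by (intro card_mono) (auto simp: mono_def)
    finally have "2 * (\<Sum>i<r. card (?T i)) \<le> N" using few by linarith
    then have "r * (2 * (\<Sum>i<r. card (?T i))) \<le> r * N" by (rule mult_left_mono) simp
    with 1 sum_card_colour_classes[OF fin(1), of \<kappa> r] \<kappa> show False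
      by (simp add: PiE_def Pi_iff N_def algebra_simps)
  qed
  then obtain i where i: "i < r" "N \<le> 2 * r * (card (?P i) - card (?T i))" by blast
  have ne: "t \<noteq> {} \<and> t \<subseteq> ?P i" if "t \<in> ?T i" for t using that neT[of t] by auto
  have "finite (?P i)" "finite (?T i)" using fin by auto
  from deletion_avoids[OF this ne]
  obtain Q where Q: "Q \<subseteq> ?P i" "card (?P i) \<le> card Q + card (?T i)" "\<forall>t\<in>?T i. \<not> t \<subseteq> Q"
    by blast
  have "N \<le> 2 * r * card Q"
    using i(2) Q(2) by (meson le_diff_conv le_trans mult_le_mono2)
  moreover have "\<forall>t\<in>T. \<not> t \<subseteq> Q" using Q(1,3) by blast
  moreover have "\<forall>K\<in>\<K>. \<not> K \<subseteq> Q"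
  proof (intro ballI notI)
    fix K assume "K \<in> \<K>" "K \<subseteq> Q"
    then have "mono \<kappa> K" using i(1) Q(1) by (auto simp: mono_def)
    then show False using noE \<kappa> \<open>K \<in> \<K>\<close> by blast
  qed
  moreover have "Q \<subseteq> P" using Q(1) by blast
  ultimately show ?thesis unfolding N_def by blast
qed

section \<open>Straight-line drawings\<close>

lemma affine_zero_between:
  fixes p q :: real
  assumes "l < b" "p + q * l < 0" "0 < p + q * b"
  shows "\<exists>a. l < a \<and> a < b \<and> p + q * a = 0"
proof -
  have "0 < q * (b - l)" using assms by (simp add: algebra_simps)
  then have q: "0 < q" using assms(1) by (simp add: zero_less_mult_iff)
  have "p + q * (- p / q) = 0" using q by simp
  moreover have "l < - p / q" "- p / q < b"
    using q assms by (auto simp: field_simps)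
  ultimately show ?thesis by blast
qed

text \<open>Distinct abscissae exclude vertical edges, so every edge is the graph of an affine
  function over an interval and crossings are zeros of affine functions.\<close>

locale drawing =
  fixes x y :: "'a \<Rightarrow> real" and P :: "'a set"
  assumes finP: "finite P" and inj: "inj_on x P"
begin

definition slope :: "'a \<times> 'a \<Rightarrow> real" where
  "slope e = (y (snd e) - y (fst e)) / (x (snd e) - x (fst e))"

definition height :: "'a \<times> 'a \<Rightarrow> real \<Rightarrow> real" where
  "height e a = y (fst e) + (a - x (fst e)) * slope e"

text \<open>The interval is open, so that meeting in a common endpoint is not a crossing.\<close>

definition spans :: "'a \<times> 'a \<Rightarrow> real \<Rightarrow> bool" where
  "spans e a \<longleftrightarrow> x (fst e) < a \<and> a < x (snd e)"

definition crosses :: "'a \<times> 'a \<Rightarrow> 'a \<times> 'a \<Rightarrow> bool" where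
  "crosses e g \<longleftrightarrow> (\<exists>a. spans e a \<and> spans g a \<and> height e a = height g a)"

definition drawn :: "('a \<times> 'a) set \<Rightarrow> bool" where
  "drawn E \<longleftrightarrow> E \<subseteq> {(u, v). u \<in> P \<and> v \<in> P \<and> x u < x v} \<and>
     (\<forall>e\<in>E. \<forall>w\<in>P. spans e (x w) \<longrightarrow> height e (x w) \<noteq> y w)"

lemma height_left [simp]: "height (u, v) (x u) = y u"
  by (simp add: height_def)

lemma height_right [simp]: "x u < x v \<Longrightarrow> height (u, v) (x v) = y v"
  by (simp add: height_def slope_def)

lemma height_snd: "x (fst e) < x (snd e) \<Longrightarrow> height e (x (snd e)) = y (snd e)"
  by (simp add: height_def slope_def)

lemma height_affine: "height e a - height g a
    = (height e 0 - height g 0) + (slope e - slope g) * a"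
  by (simp add: height_def algebra_simps)

lemma height_minus: "height e a - height e b = (a - b) * slope e"
  by (simp add: height_def algebra_simps)

lemma drawn_finite: "drawn E \<Longrightarrow> finite E"
  by (rule finite_subset[of _ "P \<times> P"]) (use finP in \<open>auto simp: drawn_def\<close>)

text \<open>Edges that do not cross keep their vertical order as long as both exist: a change of
  order would force a zero of the affine difference strictly between \<open>l\<close> and
  \<open>b\<close>.\<close>

lemma above_leftwards:
  assumes nc: "\<not> crosses e g" and b: "height e b < height g b" and l: "l < b"
    and sp: "x (fst e) \<le> l" "x (fst g) \<le> l" "b < x (snd e)" "b \<le> x (snd g)"
  shows "height e l \<le> height g l"
proof (rule ccontr)
  assume "\<not> ?thesis"
  then obtain a where "l < a" "a < b" "(height g 0 - height e 0) + (slope g - slope e) * a = 0"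
    using affine_zero_between[OF l, of "height g 0 - height e 0" "slope g - slope e"] b
    by (auto simp flip: height_affine)
  then have "crosses e g"
    unfolding crosses_def spans_def using sp
    by (intro exI[of _ a]) (auto simp flip: height_affine)
  with nc show False ..
qed

text \<open>The vertex is the leftmost one between \<open>e\<close> and the edge that follows \<open>e\<close> counterclockwise
  around the left endpoint of \<open>e\<close>.\<close>

lemma vertex_directly_above:
  assumes E: "drawn E" and nc: "\<And>e g. e \<in> E \<Longrightarrow> g \<in> E \<Longrightarrow> e \<noteq> g \<Longrightarrow> \<not> crosses e g"
    and e: "(u, v) \<in> E"
    and left: "\<exists>g\<in>E. fst g = u \<and> slope (u, v) < slope g"
    and right: "\<exists>g\<in>E. snd g = v \<and> slope g < slope (u, v)"
  shows "\<exists>w\<in>P. spans (u, v) (x w) \<and> height (u, v) (x w) < y w \<and>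
     (\<forall>k\<in>E. spans k (x w) \<longrightarrow> height k (x w) < y w \<longrightarrow> height k (x w) \<le> height (u, v) (x w))"
proof -
  have finE: "finite E" using E by (rule drawn_finite)
  have EP: "\<And>a b. (a, b) \<in> E \<Longrightarrow> a \<in> P \<and> b \<in> P \<and> x a < x b"
    and off: "\<And>e w. e \<in> E \<Longrightarrow> w \<in> P \<Longrightarrow> spans e (x w) \<Longrightarrow> height e (x w) \<noteq> y w"
    using E by (auto simp: drawn_def)
  have uv: "u \<in> P" "v \<in> P" "x u < x v" using EP[OF e] by auto
  let ?e = "(u, v)"
  let ?U = "{g\<in>E. fst g = u \<and> slope ?e < slope g}"
  have "finite ?U" "?U \<noteq> {}" using finE left by auto
  then obtain g where g: "g \<in> ?U" and gmin: "\<And>k. k \<in> ?U \<Longrightarrow> slope g \<le> slope k"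
    using arg_min_if_finite[of ?U slope] by (metis (no_types, lifting) not_le)
  obtain w' where gw: "g = (u, w')" using g by (cases g) auto
  have w': "w' \<in> P" "x u < x w'" using g EP gw by auto
  have eg: "height ?e a < height g a" if "x u < a" for a
  proof -
    have "0 < (a - x u) * (slope g - slope ?e)" using that g by simp
    then show ?thesis by (simp add: height_def gw algebra_simps)
  qed
  \<comment> \<open>\<open>g\<close> is the next edge counterclockwise after \<open>(u, v)\<close>
    at \<open>u\<close>; \<open>?R\<close> is the set of vertices in the wedge above
    \<open>(u, v)\<close> and not above \<open>g\<close>.\<close>
  let ?R = "{w\<in>P. spans ?e (x w) \<and> x w \<le> x w' \<and> height ?e (x w) < y w \<and> y w \<le> height g (x w)}"
  have "?R \<noteq> {}"
  proof (cases "x w' < x v")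
    case True
    then have "w' \<in> ?R"
      using w' eg[of "x w'"] by (auto simp: spans_def gw)
    then show ?thesis by blast
  next
    case False
    \<comment> \<open>Here \<open>g\<close> reaches at least as far as \<open>v\<close>. The edge
      \<open>k\<close> enters \<open>v\<close> from above \<open>(u, v)\<close> and cannot cross
      \<open>g\<close>, so it is trapped in the wedge. It cannot reach back to the abscissa of
      \<open>u\<close>, where the wedge closes, so its left endpoint lies in
      \<open>?R\<close>.\<close>
    obtain k where k: "k \<in> E" "snd k = v" "slope k < slope ?e" using right by blast
    obtain v' where kv: "k = (v', v)" using k by (cases k) auto
    have v': "v' \<in> P" "x v' < x v" using EP k kv by auto
    have kg: "k \<noteq> g" using k g by auto
    have ek: "height ?e a < height k a" if "a < x v" for a
    proof -
      have "height k a = y v + (a - x v) * slope k" "height ?e a = y v + (a - x v) * slope ?e"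
        using height_minus[of k a "x v"] height_minus[of ?e a "x v"] uv v' by (auto simp: kv)
      moreover have "(a - x v) * slope ?e < (a - x v) * slope k"
        using that k(3) by (simp add: mult_strict_left_mono_neg)
      ultimately show ?thesis by linarith
    qed
    have kv_g: "height k (x v) < height g (x v)"
      using eg[OF uv(3)] uv v' by (simp add: kv)
    have lw: "height k l \<le> height g l" if l: "l < x v" "x u \<le> l" "x v' \<le> l" for l
    proof (rule ccontr)
      assume "\<not> ?thesis"
      then obtain a where a: "l < a" "a < x v"
          "(height g 0 - height k 0) + (slope g - slope k) * a = 0"
        using affine_zero_between[of l "x v" "height g 0 - height k 0" "slope g - slope k"] kv_g l(1)
        by (auto simp flip: height_affine)
      then have "crosses k g"
        unfolding crosses_def spans_def using l False
        by (intro exI[of _ a]) (auto simp: kv gw simp flip: height_affine)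
      with nc[of k g] kg k g show False by auto
    qed
    have "x u < x v'"
    proof (rule ccontr)
      assume "\<not> ?thesis"
      then have "height k (x u) \<le> height g (x u)" using lw[of "x u"] uv by auto
      then show False using ek[of "x u"] uv by (simp add: gw)
    qed
    then have "v' \<in> ?R"
      using v' ek[of "x v'"] lw[of "x v'"] False by (auto simp: spans_def kv)
    then show ?thesis by blast
  qed
  moreover have "finite ?R" using finP by simp
  ultimately obtain w where w: "w \<in> ?R" and wmin: "\<And>z. z \<in> ?R \<Longrightarrow> x w \<le> x z"
    using arg_min_if_finite[of ?R x] by (metis (no_types, lifting) not_le)
  \<comment> \<open>An edge \<open>k\<close> separating \<open>w\<close> from \<open>(u, v)\<close>
    would stay in the wedge when followed leftwards. Its left endpoint would then be a vertex of
    \<open>?R\<close> left of \<open>w\<close>, or \<open>k\<close> would pass through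
    \<open>u\<close>, or start at \<open>u\<close> with a slope between those of
    \<open>(u, v)\<close> and \<open>g\<close>; all three are impossible.\<close>
  have "height k (x w) \<le> height ?e (x w)"
    if k: "k \<in> E" "spans k (x w)" "height k (x w) < y w" for k
  proof (rule ccontr)
    assume c: "\<not> ?thesis"
    then have ke: "k \<noteq> ?e" by auto
    have kg: "k \<noteq> g" using k w by auto
    obtain z z' where kz: "k = (z, z')" by (cases k)
    have z: "z \<in> P" "x z < x w" "x w < x z'" using EP k kz by (auto simp: spans_def)
    have sw: "x u < x w" "x w < x v" "x w \<le> x w'" "y w \<le> height g (x w)"
      using w by (auto simp: spans_def)
    let ?l = "max (x u) (x z)"
    have l: "?l < x w" using z sw by simp
    have 1: "height ?e ?l \<le> height k ?l"
      by (rule above_leftwards[OF nc[OF e k(1) ke[symmetric]], of "x w"]) (use c z sw l in \<open>auto simp: kz\<close>)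
    have 2: "height k ?l \<le> height g ?l"
      by (rule above_leftwards[OF nc[OF k(1) _ kg], of "x w"]) (use g k(3) z sw l in \<open>auto simp: kz gw\<close>)
    show False
    proof (cases "x u < x z")
      case True
      then have "spans ?e (x z)" using z sw by (auto simp: spans_def)
      then have "z \<in> ?R"
        using True 1 2 z sw off[OF e z(1)] by (auto simp: kz)
      with wmin z show False by fastforce
    next
      case False
      then have *: "height k (x u) = y u" using 1 2 by (simp add: gw)
      show False
      proof (cases "x z < x u")
        case True
        then have "spans k (x u)" using z sw by (auto simp: spans_def kz)
        then show False using off[OF k(1) uv(1)] * by blast
      next
        case F2: False
        then have zu: "z = u" using False inj z uv by (auto dest: inj_onD)
        have "(x w - x u) * slope ?e < (x w - x u) * slope k"
          "(x w - x u) * slope k < (x w - x u) * slope g"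
          using c k(3) sw unfolding height_def kz zu gw fst_conv by linarith+
        then have "slope ?e < slope k" "slope k < slope g" using sw by auto
        then show False using gmin[of k] k(1) by (auto simp: kz zu)
      qed
    qed
  qed
  then show ?thesis using w by auto
qed

text \<open>Three injections into \<open>P\<close>: an edge of greatest slope at its left endpoint
  is charged to that endpoint, one of least slope at its right endpoint to that endpoint, and by
  \<open>vertex_directly_above\<close> every other edge to a vertex for which it is the first edge
  met downwards. This takes the place of Euler's formula.\<close>

lemma noncrossing_card_le:
  assumes E: "drawn E" and nc: "\<And>e g. e \<in> E \<Longrightarrow> g \<in> E \<Longrightarrow> e \<noteq> g \<Longrightarrow> \<not> crosses e g"
  shows "card E \<le> 3 * card P"
proof -
  have EP: "\<And>e. e \<in> E \<Longrightarrow> fst e \<in> P \<and> snd e \<in> P \<and> x (fst e) < x (snd e)"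
    using E by (auto simp: drawn_def)
  define A where "A = {e\<in>E. \<forall>g\<in>E. fst g = fst e \<longrightarrow> slope g \<le> slope e}"
  define B where "B = {e\<in>E. \<forall>g\<in>E. snd g = snd e \<longrightarrow> slope e \<le> slope g}"
  define below where "below w e \<longleftrightarrow> spans e (x w) \<and> height e (x w) < y w \<and>
     (\<forall>k\<in>E. spans k (x w) \<longrightarrow> height k (x w) < y w \<longrightarrow> height k (x w) \<le> height e (x w))" for w e
  define C where "C = {e\<in>E. \<exists>w\<in>P. below w e}"
  have same: "e = g" if "e \<in> E" "g \<in> E" "spans e a" "spans g a" "height e a = height g a" for e g a
    using nc[OF that(1,2)] that by (auto simp: crosses_def)
  have "inj_on fst A"
  proof (rule inj_onI)
    fix e g assume eg: "e \<in> A" "g \<in> A" "fst e = fst g"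
    then have s: "slope e = slope g" unfolding A_def by (metis (mono_tags, lifting) mem_Collect_eq order_antisym)
    obtain a where "x (fst e) < a" "a < min (x (snd e)) (x (snd g))"
      using dense[of "x (fst e)" "min (x (snd e)) (x (snd g))"] EP[of e] EP[of g] eg by (auto simp: A_def)
    then show "e = g" using eg s by (intro same[of e g a]) (auto simp: A_def spans_def height_def)
  qed
  moreover have "fst ` A \<subseteq> P" using EP by (auto simp: A_def)
  ultimately have cA: "card A \<le> card P" using finP by (metis card_inj_on_le)
  have "inj_on snd B"
  proof (rule inj_onI)
    fix e g assume eg: "e \<in> B" "g \<in> B" "snd e = snd g"
    then have s: "slope e = slope g" unfolding B_def by (metis (mono_tags, lifting) mem_Collect_eq order_antisym)
    obtain a where a: "max (x (fst e)) (x (fst g)) < a" "a < x (snd e)"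
      using dense[of "max (x (fst e)) (x (fst g))" "x (snd e)"] EP[of e] EP[of g] eg by (auto simp: B_def)
    have "height e (x (snd e)) = y (snd e)" "height g (x (snd e)) = y (snd e)"
      using height_snd[of e] height_snd[of g] EP[of e] EP[of g] eg
      unfolding B_def by auto
    then have "height e a = height g a"
      using height_minus[of e a "x (snd e)"] height_minus[of g a "x (snd e)"] s by simp
    then show "e = g" using eg a by (intro same[of e g a]) (auto simp: B_def spans_def)
  qed
  moreover have "snd ` B \<subseteq> P" using EP by (auto simp: B_def)
  ultimately have cB: "card B \<le> card P" using finP by (metis card_inj_on_le)
  define c where "c e = (SOME w. w \<in> P \<and> below w e)" for e
  have c: "c e \<in> P \<and> below (c e) e" if "e \<in> C" for e
    unfolding c_def by (rule someI_ex) (use that in \<open>auto simp: C_def\<close>)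
  have "inj_on c C"
  proof (rule inj_onI)
    fix e g assume eg: "e \<in> C" "g \<in> C" "c e = c g"
    then have "below (c e) e" "below (c e) g" "e \<in> E" "g \<in> E" using c[of e] c[of g] by (auto simp: C_def)
    then show "e = g"
      by (intro same[of e g "x (c e)"]) (auto simp: below_def intro: order_antisym)
  qed
  moreover have "c ` C \<subseteq> P" using c by auto
  ultimately have cC: "card C \<le> card P" using finP by (metis card_inj_on_le)
  have "E \<subseteq> A \<union> B \<union> C"
  proof
    fix e assume e: "e \<in> E"
    obtain u v where uv: "e = (u, v)" by (cases e)
    show "e \<in> A \<union> B \<union> C"
    proof (rule ccontr)
      assume n: "e \<notin> A \<union> B \<union> C"
      have "\<exists>w\<in>P. below w e"
        unfolding below_def uv
        by (rule vertex_directly_above[OF E nc]) (use e n in \<open>auto simp: A_def B_def uv not_le\<close>)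
      then show False using n e by (auto simp: C_def)
    qed
  qed
  then have "card E \<le> card (A \<union> B \<union> C)"
    using drawn_finite[OF E] by (intro card_mono) (auto simp: A_def B_def C_def)
  also have "\<dots> \<le> card A + card B + card C"
    by (meson add_le_mono1 card_Un_le le_trans)
  finally show ?thesis using cA cB cC by linarith
qed

section \<open>The crossing lemma\<close>

definition crossings :: "('a \<times> 'a) set \<Rightarrow> (('a \<times> 'a) \<times> ('a \<times> 'a)) set" where
  "crossings E = {(e, g). e \<in> E \<and> g \<in> E \<and> e \<noteq> g \<and> crosses e g}"

text \<open>Deleting the first edge of every crossing pair leaves a drawing without
  crossings.\<close>

lemma card_le_crossings:
  assumes E: "drawn E"
  shows "card E \<le> 3 * card P + card (crossings E)"
proof -
  have finE: "finite E" using E by (rule drawn_finite)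
  then have finX: "finite (crossings E)"
    by (intro finite_subset[of "crossings E" "E \<times> E"]) (auto simp: crossings_def)
  let ?F = "E - fst ` crossings E"
  have "drawn ?F" using E by (auto simp: drawn_def)
  then have "card ?F \<le> 3 * card P"
  proof (rule noncrossing_card_le)
    fix e g assume "e \<in> ?F" "g \<in> ?F" "e \<noteq> g"
    then have "(e, g) \<notin> crossings E" by (auto simp: image_iff)
    then show "\<not> crosses e g" using \<open>e \<in> ?F\<close> \<open>g \<in> ?F\<close> \<open>e \<noteq> g\<close> by (simp add: crossings_def)
  qed
  moreover have "card E - card (fst ` crossings E) \<le> card ?F"
    using finX by (intro diff_card_le_card_Diff) simp
  ultimately show ?thesis using card_image_le[OF finX, of fst] by linarith
qed

text \<open>This is what makes a crossing monochromatic with probability as small as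
  \<open>1/r^3\<close>.\<close>

lemma crossing_vertices:
  assumes E: "drawn E" and X: "((a, b), (c, d)) \<in> crossings E"
  shows "card {a, b, c, d} = 4"
proof -
  from X obtain t where t: "(a, b) \<in> E" "(c, d) \<in> E" "(a, b) \<noteq> (c, d)" "x a < t" "t < x b" "x c < t" "t < x d"
    "height (a, b) t = height (c, d) t" by (auto simp: crossings_def crosses_def spans_def)
  have P: "a \<in> P" "b \<in> P" "c \<in> P" "d \<in> P" "x a < x b" "x c < x d"
    and off: "\<And>e w. e \<in> E \<Longrightarrow> w \<in> P \<Longrightarrow> spans e (x w) \<Longrightarrow> height e (x w) \<noteq> y w"
    using E t by (auto simp: drawn_def)
  \<comment> \<open>Edges that agree at two abscissae lie on one line. If they also share a left or
    a right endpoint, the longer one would contain an endpoint of the other in its interior, which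
    \<open>drawn\<close> forbids, so they coincide.\<close>
  have same: False if h: "height (a, b) z = height (c, d) z" and z: "z \<noteq> t"
    and eq: "a = c \<or> b = d" for z
  proof -
    have "(t - z) * slope (a, b) = (t - z) * slope (c, d)"
      using height_minus[of "(a, b)" t z] height_minus[of "(c, d)" t z] h t(8) by metis
    then have s: "slope (a, b) = slope (c, d)" using z by simp
    have H: "height (a, b) r = height (c, d) r" for r
      using height_minus[of "(a, b)" r z] height_minus[of "(c, d)" r z] h s by simp
    have "height (a, b) (x c) = y c" "height (a, b) (x d) = y d"
      "height (c, d) (x a) = y a" "height (c, d) (x b) = y b"
      using H P by (simp_all flip: H) (simp_all add: H)
    then have "\<not> spans (a, b) (x c)" "\<not> spans (a, b) (x d)" "\<not> spans (c, d) (x a)" "\<not> spans (c, d) (x b)"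
      using off[OF t(1)] off[OF t(2)] P by blast+
    then have "x a = x c \<and> x b = x d" using t eq unfolding spans_def by auto
    then have "a = c \<and> b = d" using inj P by (auto dest: inj_onD)
    then show False using t by simp
  qed
  have "a \<noteq> c" using same[of "x a"] t by auto
  moreover have "b \<noteq> d" using same[of "x b"] t P by auto
  moreover have "a \<noteq> b" "c \<noteq> d" "a \<noteq> d" "b \<noteq> c" using t P by auto
  ultimately show ?thesis by simp
qed

text \<open>Colour the vertices with \<open>r\<close> colours at random and apply the previous bound to the
  monochromatic part of each colour: an edge survives with probability \<open>1/r\<close>, a crossing with
  probability \<open>1/r\<^sup>3\<close>.\<close>

lemma crossing_lemma_colours:
  assumes E: "drawn E" and r: "0 < r"
  shows "r\<^sup>2 * card E \<le> 3 * r^3 * card P + card (crossings E)"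
proof -
  let ?S = "P \<rightarrow>\<^sub>E {..<r}"
  have finS: "finite ?S" using finP by (simp add: finite_PiE)
  have cS: "card ?S = r ^ card P" using finP by (simp add: card_PiE)
  have finE: "finite E" using E by (rule drawn_finite)
  have finX: "finite (crossings E)"
    using finE by (intro finite_subset[of "crossings E" "E \<times> E"]) (auto simp: crossings_def)
  have EP: "E \<subseteq> {(u, v). u \<in> P \<and> v \<in> P \<and> x u < x v}" using E by (simp add: drawn_def)
  define mono where "mono \<kappa> B \<longleftrightarrow> (\<exists>i<r. \<forall>b\<in>B. \<kappa> b = i)" for \<kappa> :: "'a \<Rightarrow> nat" and B
  define sup where "sup q = (case q of ((a, b), (c, d)) \<Rightarrow> {a, b, c, d})" for q :: "('a \<times> 'a) \<times> ('a \<times> 'a)"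
  have col: "card {e\<in>E. \<kappa> (fst e) = \<kappa> (snd e)} \<le> 3 * card P + card {q\<in>crossings E. mono \<kappa> (sup q)}"
    if \<kappa>: "\<kappa> \<in> ?S" for \<kappa>
  proof -
    let ?P = "\<lambda>i. {u\<in>P. \<kappa> u = i}" and ?E = "\<lambda>i. {e\<in>E. \<kappa> (fst e) = i \<and> \<kappa> (snd e) = i}"
    let ?X = "\<lambda>i. {q\<in>crossings E. \<forall>b\<in>sup q. \<kappa> b = i}"
    have one: "card (?E i) \<le> 3 * card (?P i) + card (?X i)" for i
    proof -
      interpret Q: drawing x y "?P i"
        using finP inj by unfold_locales (auto intro: inj_on_subset)
      have "Q.drawn (?E i)" using E by (auto simp: drawn_def Q.drawn_def)
      then have "card (?E i) \<le> 3 * card (?P i) + card (Q.crossings (?E i))"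
        by (rule Q.card_le_crossings)
      also have "Q.crossings (?E i) \<subseteq> ?X i" by (auto simp: Q.crossings_def crossings_def sup_def)
      then have "card (Q.crossings (?E i)) \<le> card (?X i)" using finX by (intro card_mono) auto
      finally show ?thesis by simp
    qed
    have lt: "\<kappa> u < r" if "u \<in> P" for u using \<kappa> that by (auto simp: PiE_iff)
    have "card {e\<in>E. \<kappa> (fst e) = \<kappa> (snd e)} = card (\<Union>i<r. ?E i)"
      using EP lt by (intro arg_cong[where f=card]) auto
    also have "\<dots> = (\<Sum>i<r. card (?E i))"
      using finE by (intro card_UN_disjoint) auto
    also have "\<dots> \<le> (\<Sum>i<r. 3 * card (?P i) + card (?X i))" by (intro sum_mono one)
    also have "\<dots> = 3 * (\<Sum>i<r. card (?P i)) + (\<Sum>i<r. card (?X i))"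
      by (simp add: sum.distrib sum_distrib_left)
    also have "(\<Sum>i<r. card (?P i)) = card P"
      using finP lt by (intro sum_card_colour_classes) auto
    also have "(\<Sum>i<r. card (?X i)) = card (\<Union>i<r. ?X i)"
      using finX by (intro card_UN_disjoint[symmetric]) (auto simp: sup_def)
    also have "\<dots> \<le> card {q\<in>crossings E. mono \<kappa> (sup q)}"
      using finX by (intro card_mono) (auto simp: mono_def)
    finally show ?thesis by simp
  qed
  have "(\<Sum>\<kappa>\<in>?S. card {e\<in>E. \<kappa> (fst e) = \<kappa> (snd e)})
      \<le> (\<Sum>\<kappa>\<in>?S. 3 * card P + card {q\<in>crossings E. mono \<kappa> (sup q)})"
    by (intro sum_mono col)
  then have main: "(\<Sum>e\<in>E. card {\<kappa>\<in>?S. \<kappa> (fst e) = \<kappa> (snd e)})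
      \<le> 3 * card P * r ^ card P + (\<Sum>q\<in>crossings E. card {\<kappa>\<in>?S. mono \<kappa> (sup q)})"
    using sum_card_swap[OF finS finE] sum_card_swap[OF finS finX] cS
    by (simp add: sum.distrib mult.commute)
  have e: "r * card {\<kappa>\<in>?S. \<kappa> (fst e) = \<kappa> (snd e)} = r ^ card P" if e: "e \<in> E" for e
  proof -
    obtain u v where uv: "e = (u, v)" "u \<in> P" "v \<in> P" "u \<noteq> v" using EP e by force
    have "2 \<le> card P" using uv finP by (metis card_2_iff card_mono empty_subsetI insert_subset)
    have "{\<kappa>\<in>?S. \<kappa> u = \<kappa> v} = (\<Union>i<r. {\<kappa>\<in>?S. \<forall>b\<in>{u, v}. \<kappa> b = i})"
      using uv by (auto simp: PiE_iff)
    then have "card {\<kappa>\<in>?S. \<kappa> u = \<kappa> v} = card (\<Union>i<r. {\<kappa>\<in>?S. \<forall>b\<in>{u, v}. \<kappa> b = i})" by simp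
    also have "\<dots> = (\<Sum>i<r. card {\<kappa>\<in>?S. \<forall>b\<in>{u, v}. \<kappa> b = i})"
      using finS by (intro card_UN_disjoint) auto
    also have "\<dots> = (\<Sum>i<r. r ^ (card P - card {u, v}))"
      using uv finP by (intro sum.cong card_colourings_const) auto
    also have "\<dots> = r * r ^ (card P - 2)" using uv by (simp add: numeral_2_eq_2)
    finally have "r * card {\<kappa>\<in>?S. \<kappa> u = \<kappa> v} = r ^ (Suc (Suc (card P - 2)))" by simp
    also have "Suc (Suc (card P - 2)) = card P" using \<open>2 \<le> card P\<close> by simp
    finally show ?thesis by (simp add: uv)
  qed
  have q: "r^3 * card {\<kappa>\<in>?S. mono \<kappa> (sup q)} \<le> r ^ card P" if q: "q \<in> crossings E" for q
  proof -
    obtain a b c d where abcd: "q = ((a, b), (c, d))" by (metis surj_pair)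
    have "card (sup q) = 4" "sup q \<subseteq> P"
      using crossing_vertices[OF E] q EP unfolding abcd by (auto simp: sup_def crossings_def)
    then have "r * (r^3 * card {\<kappa>\<in>?S. mono \<kappa> (sup q)}) \<le> r * r ^ card P"
      using card_monochromatic_colourings[of P "sup q" r] finP
      by (simp add: mono_def eval_nat_numeral mult.assoc)
    then show ?thesis using r by simp
  qed
  have "r\<^sup>2 * card E * r ^ card P = r\<^sup>2 * (\<Sum>e\<in>E. r * card {\<kappa>\<in>?S. \<kappa> (fst e) = \<kappa> (snd e)})"
    using e by simp
  also have "\<dots> = r^3 * (\<Sum>e\<in>E. card {\<kappa>\<in>?S. \<kappa> (fst e) = \<kappa> (snd e)})"
    by (simp add: eval_nat_numeral mult.assoc flip: sum_distrib_left)
  also have "\<dots> \<le> r^3 * (3 * card P * r ^ card P + (\<Sum>q\<in>crossings E. card {\<kappa>\<in>?S. mono \<kappa> (sup q)}))"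
    using main by (rule mult_left_mono) simp
  also have "\<dots> = 3 * r^3 * card P * r ^ card P + (\<Sum>q\<in>crossings E. r^3 * card {\<kappa>\<in>?S. mono \<kappa> (sup q)})"
    by (simp add: algebra_simps sum_distrib_left)
  also have "\<dots> \<le> 3 * r^3 * card P * r ^ card P + (\<Sum>q\<in>crossings E. r ^ card P)"
    by (intro add_left_mono sum_mono q)
  also have "\<dots> = (3 * r^3 * card P + card (crossings E)) * r ^ card P" by (simp add: algebra_simps)
  finally show ?thesis using r by simp
qed

lemma crossing_lemma:
  assumes E: "drawn E" and big: "6 * card P \<le> card E"
  shows "real (card E)^3 \<le> 288 * real (card P)^2 * card (crossings E)"
proof (cases "card P = 0")
  case True
  then have "P = {}" using finP by simp
  moreover have "E \<subseteq> P \<times> P" using E by (auto simp: drawn_def)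
  ultimately have "E = {}" by simp
  then show ?thesis by simp
next
  case False
  define n where "n = card P"
  define m where "m = card E"
  \<comment> \<open>With this \<open>r\<close> the term \<open>3 * r^3 * n\<close> is at most half
    of \<open>r^2 * m\<close>. Rounding down costs at most a factor 2, whence
    \<open>m \<le> 12 * n * r\<close> and the constant \<open>288 = 2 * 12^2\<close>.\<close>
  define r where "r = m div (6 * n)"
  have n: "0 < n" using False by (simp add: n_def)
  have r: "0 < r" using big n by (simp add: r_def n_def m_def div_greater_zero_iff)
  have "6 * n * r \<le> m" by (simp add: r_def)
  then have rm: "6 * real n * real r \<le> real m" by (metis of_nat_le_iff of_nat_mult of_nat_numeral)
  have "m < 6 * n * (r + 1)"
    using n by (simp add: r_def) (metis add.commute dividend_less_times_div mult_pos_pos zero_less_numeral)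
  then have "m \<le> 12 * n * r" using r by (cases r) auto
  then have mr: "real m \<le> 12 * real n * real r" by (metis of_nat_le_iff of_nat_mult of_nat_numeral)
  have "real (r\<^sup>2 * m) \<le> real (3 * r^3 * n + card (crossings E))"
    using crossing_lemma_colours[OF E r] by (simp only: of_nat_le_iff n_def m_def)
  then have "real r ^ 2 * real m \<le> 3 * real r^3 * real n + card (crossings E)" by simp
  moreover have "real r^2 * (6 * real n * real r) \<le> real r^2 * real m"
    using rm by (rule mult_left_mono) simp
  then have "6 * real r^3 * real n \<le> real r^2 * real m" by (simp add: eval_nat_numeral algebra_simps)
  ultimately have 1: "real r^2 * real m \<le> 2 * card (crossings E)" by linarith
  have "real m ^ 2 \<le> (12 * real n * real r)^2" using mr by (rule power_mono) simp
  then have "real m ^ 2 * real m \<le> (12 * real n * real r)^2 * real m" by (rule mult_right_mono) simp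
  also have "\<dots> = 144 * real n^2 * (real r^2 * real m)" by (simp add: power_mult_distrib)
  also have "\<dots> \<le> 144 * real n^2 * (2 * card (crossings E))" using 1 by (rule mult_left_mono) simp
  finally show ?thesis by (simp add: n_def m_def eval_nat_numeral algebra_simps)
qed

section \<open>Rich lines\<close>

text \<open>The pair \<open>(a, b)\<close> stands for the line of equation \<open>y = a + b x\<close>.\<close>

definition on_line :: "real \<times> real \<Rightarrow> 'a set" where
  "on_line l = {w\<in>P. y w = fst l + snd l * x w}"

definition consec :: "real \<times> real \<Rightarrow> ('a \<times> 'a) set" where
  "consec l = {(u, v). u \<in> on_line l \<and> v \<in> on_line l \<and> x u < x v \<and>
     (\<forall>w\<in>on_line l. \<not> (x u < x w \<and> x w < x v))}"

lemma finite_on_line [simp]: "finite (on_line l)"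
  using finP by (simp add: on_line_def)

lemma finite_consec [simp]: "finite (consec l)"
  by (rule finite_subset[of _ "on_line l \<times> on_line l"]) (auto simp: consec_def)

text \<open>Every point of the line except the rightmost one is the left end of a consecutive
  pair.\<close>

lemma card_consec: "card (on_line l) \<le> card (consec l) + 1"
proof (cases "on_line l = {}")
  case False
  obtain t where t: "t \<in> on_line l" and tmax: "\<And>z. z \<in> on_line l \<Longrightarrow> x z \<le> x t"
    using arg_min_if_finite[OF finite_on_line False, of "\<lambda>z. - x z"] by (metis neg_less_iff_less not_le)
  have "u \<in> fst ` consec l" if u: "u \<in> on_line l" "u \<noteq> t" for u
  proof -
    let ?N = "{w\<in>on_line l. x u < x w}"
    have "x u \<noteq> x t" using u t inj by (auto simp: on_line_def dest: inj_onD)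
    then have "t \<in> ?N" using tmax[OF u(1)] t by auto
    then have ne: "?N \<noteq> {}" by blast
    have "finite ?N" by simp
    then obtain v where v: "v \<in> ?N" and vmin: "\<And>z. z \<in> ?N \<Longrightarrow> x v \<le> x z"
      using arg_min_if_finite[OF _ ne, of x] by (metis (no_types, lifting) not_le)
    have "(u, v) \<in> consec l" using u v vmin by (fastforce simp: consec_def)
    then show ?thesis by force
  qed
  then have "on_line l - {t} \<subseteq> fst ` consec l" by blast
  then have "card (on_line l - {t}) \<le> card (consec l)"
    by (meson card_image_le card_mono finite_consec finite_imageI le_trans)
  then show ?thesis using t by simp
qed simp

lemma on_line_inter:
  assumes "u \<in> on_line l" "v \<in> on_line l" "u \<in> on_line l'" "v \<in> on_line l'" "u \<noteq> v"
  shows "l = l'"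
proof -
  have "x u \<noteq> x v" using assms inj by (auto simp: on_line_def dest: inj_onD)
  moreover have 1: "fst l + snd l * x u = fst l' + snd l' * x u" "fst l + snd l * x v = fst l' + snd l' * x v"
    using assms by (auto simp: on_line_def)
  then have "(snd l - snd l') * (x u - x v) = 0" by (simp add: algebra_simps)
  ultimately have "snd l = snd l'" by simp
  with 1 show ?thesis by (simp add: prod_eq_iff)
qed

lemma height_consec:
  assumes "e \<in> consec l" shows "height e a = fst l + snd l * a"
proof -
  obtain u v where e: "e = (u, v)" "x u < x v" "y u = fst l + snd l * x u" "y v = fst l + snd l * x v"
    using assms by (auto simp: consec_def on_line_def)
  have "slope e = (snd l * (x v - x u)) / (x v - x u)" using e by (simp add: slope_def algebra_simps)
  then have "slope e = snd l" using e by simp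
  then show ?thesis using e by (simp add: height_def algebra_simps)
qed

lemma consec_spans_unique:
  assumes "e \<in> consec l" "g \<in> consec l" "spans e a" "spans g a"
  shows "e = g"
proof -
  obtain u v u' v' where e: "e = (u, v)" and g: "g = (u', v')" by (metis surj_pair)
  have "\<not> (x u < x u' \<and> x u' < x v)" "\<not> (x u < x v' \<and> x v' < x v)"
    "\<not> (x u' < x u \<and> x u < x v')" "\<not> (x u' < x v \<and> x v < x v')"
    using assms(1,2) unfolding e g consec_def by blast+
  then have "x u = x u'" "x v = x v'" using assms(3,4) by (auto simp: e g spans_def)
  then show ?thesis using inj assms by (auto simp: e g consec_def on_line_def dest: inj_onD)
qed

text \<open>Szemeredi-Trotter by Szekely's argument: joining consecutive points on each line gives a
  drawing with at least \<open>card L * (k - 1)\<close> edges and at most one crossing per ordered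
  pair of lines. The first term comes from the crossing lemma, the second from the case where there
  are too few edges to apply it.\<close>

lemma rich_lines_le:
  assumes fin: "finite L" and rich: "\<And>l. l \<in> L \<Longrightarrow> k \<le> card (on_line l)" and k: "2 \<le> k"
  shows "card L \<le> 288 * real (card P)^2 / (real k - 1)^3 + 6 * real (card P) / (real k - 1)"
proof -
  define E where "E = (\<Union>l\<in>L. consec l)"
  have "card E = (\<Sum>l\<in>L. card (consec l))"
    unfolding E_def
  proof (intro card_UN_disjoint ballI impI)
    fix l l' :: "real \<times> real" assume "l \<noteq> l'"
    then show "consec l \<inter> consec l' = {}" using on_line_inter[of _ l _ l'] by (fastforce simp: consec_def)
  qed (use fin in auto)
  moreover have "card (consec l) \<ge> k - 1" if "l \<in> L" for l
    using rich[OF that] card_consec[of l] by linarith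
  then have "card L * (k - 1) \<le> (\<Sum>l\<in>L. card (consec l))" using sum_bounded_below[of L "k - 1"] by simp
  ultimately have "card L * (k - 1) \<le> card E" by simp
  then have "real (card L * (k - 1)) \<le> real (card E)" by (simp only: of_nat_le_iff)
  then have LE: "real (card L) * (real k - 1) \<le> card E" using k by (simp add: of_nat_diff)
  have "drawn E"
    unfolding drawn_def
  proof (intro conjI ballI impI)
    show "E \<subseteq> {(u, v). u \<in> P \<and> v \<in> P \<and> x u < x v}" by (auto simp: E_def consec_def on_line_def)
    fix e w assume e: "e \<in> E" and w: "w \<in> P" "spans e (x w)"
    then obtain l where l: "e \<in> consec l" by (auto simp: E_def)
    show "height e (x w) \<noteq> y w"
    proof
      assume "height e (x w) = y w"
      then have "w \<in> on_line l" using w height_consec[OF l] by (auto simp: on_line_def)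
      then show False using l w by (auto simp: consec_def spans_def)
    qed
  qed
  have "\<exists>l\<in>L. e \<in> consec l" if "e \<in> E" for e using that by (auto simp: E_def)
  then obtain lin where lin: "\<And>e. e \<in> E \<Longrightarrow> lin e \<in> L \<and> e \<in> consec (lin e)" by metis
  \<comment> \<open>Two different lines meet at one abscissa, and on each line only one consecutive
    pair spans it, so the lines determine the crossing.\<close>
  have "inj_on (map_prod lin lin) (crossings E)"
  proof (rule inj_onI, clarify)
    fix e g e' g' assume X: "(e, g) \<in> crossings E" "(e', g') \<in> crossings E"
      and "map_prod lin lin (e, g) = map_prod lin lin (e', g')"
    then have eq: "lin e = lin e'" "lin g = lin g'" by auto
    obtain a where a: "spans e a" "spans g a" "height e a = height g a" "e \<in> E" "g \<in> E" "e \<noteq> g"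
      using X(1) by (auto simp: crossings_def crosses_def)
    obtain b where b: "spans e' b" "spans g' b" "height e' b = height g' b" "e' \<in> E" "g' \<in> E" "e' \<noteq> g'"
      using X(2) by (auto simp: crossings_def crosses_def)
    have "lin e \<noteq> lin g"
      using consec_spans_unique[of e "lin e" g a] lin[OF a(4)] lin[OF a(5)] a by auto
    moreover have 1: "fst (lin e) + snd (lin e) * a = fst (lin g) + snd (lin g) * a"
      "fst (lin e) + snd (lin e) * b = fst (lin g) + snd (lin g) * b"
      using a b height_consec lin eq by metis+
    then have "(snd (lin e) - snd (lin g)) * (a - b) = 0" by (simp add: algebra_simps)
    ultimately have "a = b" using 1 by (auto simp: prod_eq_iff)
    then show "e = e' \<and> g = g'"
      using consec_spans_unique[of e "lin e" e' a] consec_spans_unique[of g "lin g" g' a]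
        lin[OF a(4)] lin[OF a(5)] lin[OF b(4)] lin[OF b(5)] a b eq by auto
  qed
  moreover have "map_prod lin lin ` crossings E \<subseteq> L \<times> L" using lin by (auto simp: crossings_def)
  ultimately have "card (crossings E) \<le> card (L \<times> L)" using fin by (intro card_inj_on_le) auto
  then have "card (crossings E) \<le> card L ^ 2" by (simp add: card_cartesian_product power2_eq_square)
  then have X: "real (card (crossings E)) \<le> real (card L) ^ 2" by (metis of_nat_le_iff of_nat_power)
  have k': "0 < real k - 1" using k by simp
  show ?thesis
  proof (cases "6 * card P \<le> card E \<and> L \<noteq> {}")
    case True
    then have L: "0 < real (card L)" using fin by (simp add: card_gt_0_iff)
    have "(real (card L) * (real k - 1))^3 \<le> real (card E)^3"
      using LE k' by (intro power_mono) auto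
    also have "\<dots> \<le> 288 * real (card P)^2 * card (crossings E)"
      using crossing_lemma[OF \<open>drawn E\<close>] True by simp
    also have "\<dots> \<le> 288 * real (card P)^2 * real (card L) ^ 2" using X by (rule mult_left_mono) simp
    finally have "(real (card L) * (real k - 1)^3) * real (card L)^2 \<le> (288 * real (card P)^2) * real (card L)^2"
      by (simp add: power_mult_distrib eval_nat_numeral algebra_simps)
    then have "real (card L) * (real k - 1)^3 \<le> 288 * real (card P)^2" using L by simp
    then have "real (card L) \<le> 288 * real (card P)^2 / (real k - 1)^3" using k' by (simp add: pos_le_divide_eq)
    moreover have "0 \<le> 6 * real (card P) / (real k - 1)" using k' by simp
    ultimately show ?thesis by linarith
  next
    case False
    have "real (card L) * (real k - 1) \<le> 6 * real (card P)"
    proof (cases "L = {}")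
      case F: False
      then have "real (card E) \<le> 6 * real (card P)" using False by linarith
      then show ?thesis using LE by linarith
    qed simp
    then have "real (card L) \<le> 6 * real (card P) / (real k - 1)" using k' by (simp add: pos_le_divide_eq)
    moreover have "0 \<le> 288 * real (card P)^2 / (real k - 1)^3" using k' by simp
    ultimately show ?thesis by linarith
  qed
qed

text \<open>Going from \<open>n\<close> to \<open>n + 1\<close> adds \<open>n choose 2\<close>
  triples. In this form the triples on a line are spread over the thresholds \<open>j\<close> up to
  its number of points, ready for exchanging the sums over lines and thresholds.\<close>

lemma choose3_le: "n choose 3 \<le> (\<Sum>j=3..n. j\<^sup>2)"
proof (induction n)
  case (Suc n)
  have "Suc n choose 3 = (n choose 2) + (n choose 3)" by (simp add: numeral_3_eq_3 numeral_2_eq_2)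
  moreover have "n choose 2 \<le> (Suc n)\<^sup>2" if "2 \<le> n"
    using binomial_le_pow[OF that] power_mono[of n "Suc n" 2] by linarith
  moreover have "n choose 2 = 0" if "n < 2" using that by (simp add: binomial_eq_0)
  ultimately show ?case using Suc by (cases "2 \<le> n") (auto simp: not_le)
qed simp

text \<open>Summation by layers: \<open>j^2\<close> times the number of lines with at least
  \<open>j\<close> points is, by \<open>rich_lines_le\<close>, of order
  \<open>n^2/j + n * j\<close>. Summing over \<open>j \<le> s\<close> produces the logarithm and the
  square.\<close>

lemma collinear_triples_le:
  assumes s: "\<And>l. card (on_line l) \<le> s" and "2 \<le> s"
  shows "card {t. t \<subseteq> P \<and> card t = 3 \<and> (\<exists>l. t \<subseteq> on_line l)}
     \<le> 864 * real (card P)^2 * (1 + ln s) + 18 * real (card P) * real s^2"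
proof -
  define n where "n = real (card P)"
  let ?T = "{t. t \<subseteq> P \<and> card t = 3 \<and> (\<exists>l. t \<subseteq> on_line l)}"
  define L where "L = {l. 2 \<le> card (on_line l)}"
  have finL: "finite L"
  proof -
    have "on_line ` L \<subseteq> Pow P" by (auto simp: on_line_def)
    then have "finite (on_line ` L)" using finP by (meson finite_Pow_iff finite_subset)
    moreover have "inj_on on_line L"
    proof (rule inj_onI)
      fix l l' assume l: "l \<in> L" "l' \<in> L" "on_line l = on_line l'"
      then have "2 \<le> card (on_line l)" by (simp add: L_def)
      then obtain S where "S \<subseteq> on_line l" "card S = 2" by (metis obtain_subset_with_card_n)
      then obtain u v where "u \<in> on_line l" "v \<in> on_line l" "u \<noteq> v" by (auto simp: card_2_iff)
      then show "l = l'" using on_line_inter l by metis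
    qed
    ultimately show ?thesis by (rule finite_imageD)
  qed
  have "?T \<subseteq> (\<Union>l\<in>L. {t. t \<subseteq> on_line l \<and> card t = 3})"
  proof
    fix t assume "t \<in> ?T"
    then obtain l where l: "t \<subseteq> on_line l" "card t = 3" by auto
    then have "3 \<le> card (on_line l)" by (metis card_mono finite_on_line)
    then have "l \<in> L" by (simp add: L_def)
    then show "t \<in> (\<Union>l\<in>L. {t. t \<subseteq> on_line l \<and> card t = 3})" using l by blast
  qed
  then have "card ?T \<le> card (\<Union>l\<in>L. {t. t \<subseteq> on_line l \<and> card t = 3})"
    using finL by (intro card_mono) auto
  also have "\<dots> \<le> (\<Sum>l\<in>L. card {t. t \<subseteq> on_line l \<and> card t = 3})" using finL by (rule card_UN_le)
  also have "\<dots> = (\<Sum>l\<in>L. card (on_line l) choose 3)" by (simp add: n_subsets)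
  also have "\<dots> \<le> (\<Sum>l\<in>L. \<Sum>j=3..card (on_line l). j\<^sup>2)" by (intro sum_mono choose3_le)
  also have "\<dots> = (\<Sum>l\<in>L. \<Sum>j=3..s. if j \<le> card (on_line l) then j\<^sup>2 else 0)"
  proof (rule sum.cong[OF refl])
    fix l
    have eq: "{3..card (on_line l)} = {j\<in>{3..s}. j \<le> card (on_line l)}" using s[of l] by auto
    show "(\<Sum>j=3..card (on_line l). j\<^sup>2) = (\<Sum>j=3..s. if j \<le> card (on_line l) then j\<^sup>2 else 0)"
      unfolding eq by (rule sum.inter_filter) simp
  qed
  also have "\<dots> = (\<Sum>j=3..s. \<Sum>l\<in>L. if j \<le> card (on_line l) then j\<^sup>2 else 0)" by (rule sum.swap)
  also have "\<dots> = (\<Sum>j=3..s. card {l\<in>L. j \<le> card (on_line l)} * j\<^sup>2)"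
    using finL by (simp flip: sum.inter_filter)
  finally have "real (card ?T) \<le> real (\<Sum>j=3..s. card {l\<in>L. j \<le> card (on_line l)} * j\<^sup>2)"
    by (simp only: of_nat_le_iff)
  also have "\<dots> = (\<Sum>j=3..s. real (card {l\<in>L. j \<le> card (on_line l)}) * real j ^ 2)" by simp
  also have "\<dots> \<le> (\<Sum>j=3..s. 864 * n\<^sup>2 * (1 / (real j - 1)) + 18 * n * real s)"
  proof (rule sum_mono)
    fix j assume j: "j \<in> {3..s}"
    then have j1: "2 \<le> real j - 1" by auto
    \<comment> \<open>This factor 3 turns the constants 288 and 6 into 864 and 18.\<close>
    have "real j^2 \<le> 3 * (real j - 1)^2"
    proof -
      have "0 \<le> (real j - 1 - 2) * (real j - 1)" using j1 by (intro mult_nonneg_nonneg) auto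
      then show ?thesis using j1 by (simp add: power2_eq_square algebra_simps)
    qed
    have "real (card {l\<in>L. j \<le> card (on_line l)}) \<le> 288 * n^2 / (real j - 1)^3 + 6 * n / (real j - 1)"
      unfolding n_def using j finL by (intro rich_lines_le) auto
    then have "real (card {l\<in>L. j \<le> card (on_line l)}) * real j ^ 2
        \<le> (288 * n^2 / (real j - 1)^3 + 6 * n / (real j - 1)) * (3 * (real j - 1)^2)"
      using j1 \<open>real j^2 \<le> _\<close> by (intro mult_mono) (auto simp: n_def)
    also have "\<dots> = 864 * n^2 * (1 / (real j - 1)) + 18 * n * (real j - 1)"
    proof -
      have "(288 * n^2 / z^3 + 6 * n / z) * (3 * z^2) = 864 * n^2 * (1 / z) + 18 * n * z"
        if "2 \<le> z" for z :: real
        using that by (simp add: field_simps eval_nat_numeral)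
      then show ?thesis using j1 by blast
    qed
    also have "\<dots> \<le> 864 * n^2 * (1 / (real j - 1)) + 18 * n * real s"
      using j by (intro add_left_mono mult_left_mono) (auto simp: n_def)
    finally show "real (card {l\<in>L. j \<le> card (on_line l)}) * real j ^ 2
        \<le> 864 * n\<^sup>2 * (1 / (real j - 1)) + 18 * n * real s" .
  qed
  also have "\<dots> = 864 * n\<^sup>2 * (\<Sum>j=3..s. 1 / (real j - 1)) + real (card {3..s}) * (18 * n * real s)"
    by (simp add: sum.distrib sum_distrib_left)
  finally have *: "real (card ?T) \<le> 864 * n\<^sup>2 * (\<Sum>j=3..s. 1 / (real j - 1)) + real (card {3..s}) * (18 * n * real s)" .
  have harm: "(\<Sum>j=3..s. 1 / (real j - 1)) \<le> 1 + ln s"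
  proof -
    have "(\<Sum>j=3..s. 1 / (real j - 1)) \<le> (\<Sum>j=3..s. ln (real j - 1) - ln (real j - 2))"
    proof (rule sum_mono)
      fix j assume j: "j \<in> {3..s}"
      have "ln ((real j - 2) / (real j - 1)) \<le> (real j - 2) / (real j - 1) - 1"
        using j by (intro ln_le_minus_one) auto
      also have "\<dots> = - 1 / (real j - 1)" using j by (simp add: field_simps)
      finally show "1 / (real j - 1) \<le> ln (real j - 1) - ln (real j - 2)"
        using j by (simp add: ln_div)
    qed
    also have "\<dots> = ln (real s - 1)"
    proof -
      have "(\<Sum>j=3..s. ln (real j - 1) - ln (real j - 2)) = ln (real s - 1)" if "2 \<le> s" for s
        using that by (induction s rule: dec_induct) auto
      then show ?thesis using assms(2) .
    qed
    also have "\<dots> \<le> ln s" using assms(2) by simp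
    finally show ?thesis by simp
  qed
  have "864 * n\<^sup>2 * (\<Sum>j=3..s. 1 / (real j - 1)) \<le> 864 * n\<^sup>2 * (1 + ln s)"
    using harm by (rule mult_left_mono) simp
  moreover have "real (card {3..s}) * (18 * n * real s) \<le> real s * (18 * n * real s)"
    by (intro mult_right_mono) (auto simp: n_def)
  moreover have "real s * (18 * n * real s) = 18 * n * real s^2" by (simp add: power2_eq_square)
  ultimately show ?thesis using * unfolding n_def by linarith
qed

end

section \<open>Large subsets in general position\<close>

lemma collinear_3_det:
  fixes p q r :: "real ^ 2"
  shows "collinear {p, q, r} \<longleftrightarrow>
    (q $ 1 - p $ 1) * (r $ 2 - p $ 2) = (r $ 1 - p $ 1) * (q $ 2 - p $ 2)"
proof
  assume "collinear {p, q, r}"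
  then obtain u a b where "q - p = a *\<^sub>R u" "r - p = b *\<^sub>R u"
    unfolding collinear_def by blast
  then have "q $ i - p $ i = a * u $ i" "r $ i - p $ i = b * u $ i" for i
    by (metis vector_minus_component vector_scaleR_component real_scaleR_def)+
  then show "(q $ 1 - p $ 1) * (r $ 2 - p $ 2) = (r $ 1 - p $ 1) * (q $ 2 - p $ 2)" by simp
next
  assume d: "(q $ 1 - p $ 1) * (r $ 2 - p $ 2) = (r $ 1 - p $ 1) * (q $ 2 - p $ 2)"
  show "collinear {p, q, r}"
  proof (cases "p = q")
    case False
    have "\<exists>c. r - p = c *\<^sub>R (q - p)"
    proof (cases "q $ 1 = p $ 1")
      case True
      then have ne: "q $ 2 - p $ 2 \<noteq> 0" using False by (auto simp: vec_eq_iff forall_2)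
      have "r - p = ((r $ 2 - p $ 2) / (q $ 2 - p $ 2)) *\<^sub>R (q - p)"
        using d True ne by (simp add: vec_eq_iff forall_2)
      then show ?thesis ..
    next
      case F: False
      have "r $ 2 - p $ 2 = (r $ 1 - p $ 1) / (q $ 1 - p $ 1) * (q $ 2 - p $ 2)"
        using d F by (simp add: eq_divide_eq mult.commute)
      then have "r - p = ((r $ 1 - p $ 1) / (q $ 1 - p $ 1)) *\<^sub>R (q - p)"
        using F by (simp add: vec_eq_iff forall_2)
      then show ?thesis ..
    qed
    then obtain c where c: "r = p + c *\<^sub>R (q - p)" by (metis add.commute diff_add_cancel)
    show ?thesis
      unfolding collinear_def
    proof (intro exI[of _ "q - p"] ballI)
      fix v w assume "v \<in> {p, q, r}" "w \<in> {p, q, r}"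
      then obtain a b where "v = p + a *\<^sub>R (q - p)" "w = p + b *\<^sub>R (q - p)"
        using c by (metis insert_iff singletonD scaleR_zero_left scaleR_one add_0_right add.commute diff_add_cancel)
      then have "v - w = (a - b) *\<^sub>R (q - p)" by (simp only: scaleR_left_diff_distrib) simp
      then show "\<exists>c. v - w = c *\<^sub>R (q - p)" ..
    qed
  qed (simp add: insert_absorb2)
qed

text \<open>Only finitely many shears align two points of \<open>P\<close> vertically. After a good
  shear \<open>drawing\<close> applies, and its non-vertical lines account for all collinear
  triples, since shears preserve collinearity.\<close>

lemma generic_coordinate:
  fixes P :: "(real ^ 2) set"
  assumes "finite P" shows "\<exists>t. inj_on (\<lambda>p. p $ 1 + t * p $ 2) P"
proof -
  let ?B = "(\<lambda>(p, q). (q $ 1 - p $ 1) / (p $ 2 - q $ 2)) ` (P \<times> P)"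
  have "finite ?B" using assms by simp
  then obtain t where t: "t \<notin> ?B" using ex_new_if_finite[OF infinite_UNIV_char_0] by blast
  have "inj_on (\<lambda>p. p $ 1 + t * p $ 2) P"
  proof (rule inj_onI, rule ccontr)
    fix p q assume pq: "p \<in> P" "q \<in> P" "p $ 1 + t * p $ 2 = q $ 1 + t * q $ 2" "p \<noteq> q"
    then have "t * (p $ 2 - q $ 2) = q $ 1 - p $ 1" by (simp add: algebra_simps)
    moreover have "p $ 2 \<noteq> q $ 2" using pq by (auto simp: vec_eq_iff forall_2)
    ultimately have "t = (q $ 1 - p $ 1) / (p $ 2 - q $ 2)" by (simp add: field_simps)
    with pq t show False by force
  qed
  then show ?thesis ..
qed

lemma general_position_subset:
  fixes P :: "(real ^ 2) set"
  assumes fin: "finite P" and nc: "no_collinear (s + 1) P" and s: "2 \<le> s" and r: "0 < r"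
    and ne: "P \<noteq> {}" and big: "4 * (864 * real (card P) * (1 + ln s) + 18 * real s^2) \<le> real r ^ 2"
  shows "\<exists>Q\<subseteq>P. card P \<le> 2 * r * card Q \<and> general_position Q"
proof -
  obtain t where t: "inj_on (\<lambda>p. p $ 1 + t * p $ 2) P" using generic_coordinate[OF fin] by blast
  define x y :: "real ^ 2 \<Rightarrow> real" where "x p = p $ 1 + t * p $ 2" and "y p = p $ 2" for p
  interpret drawing x y P
    by unfold_locales (use fin t in \<open>auto simp: x_def[abs_def]\<close>)
  let ?T = "{t. t \<subseteq> P \<and> card t = 3 \<and> (\<exists>l. t \<subseteq> on_line l)}"
  have col: "collinear {p, q, r} \<longleftrightarrow> (x q - x p) * (y r - y p) = (x r - x p) * (y q - y p)" for p q r
    unfolding collinear_3_det x_def y_def by (simp add: algebra_simps)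
  have "card (on_line l) \<le> s" for l
  proof (rule ccontr)
    assume "\<not> ?thesis"
    then obtain S where S: "S \<subseteq> on_line l" "card S = s + 1"
      by (metis Suc_eq_plus1 not_less_eq_eq obtain_subset_with_card_n)
    then have "S \<subseteq> P" by (auto simp: on_line_def)
    have "collinear S"
    proof (cases "S = {}")
      case False
      then obtain p where p: "p \<in> S" by blast
      have "S \<noteq> {p}" using S s by auto
      then obtain q where q: "q \<in> S" "q \<noteq> p" using p by blast
      have "collinear {p, q, r}" if "r \<in> S" for r
      proof -
        have "y p = fst l + snd l * x p" "y q = fst l + snd l * x q" "y r = fst l + snd l * x r"
          using p q that S by (auto simp: on_line_def)
        then show ?thesis unfolding col by (simp add: algebra_simps)
      qed
      then show ?thesis using q(2) by (metis collinear_triples insert_absorb p q(1))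
    qed simp
    then show False using nc S(2) \<open>S \<subseteq> P\<close> by (auto simp: no_collinear_def)
  qed
  then have "real (card ?T) \<le> 864 * real (card P)^2 * (1 + ln s) + 18 * real (card P) * real s^2"
    using s by (rule collinear_triples_le)
  also have "4 * \<dots> = 4 * (864 * real (card P) * (1 + ln s) + 18 * real s^2) * real (card P)"
    by (simp add: algebra_simps power2_eq_square)
  also have "\<dots> \<le> real r ^ 2 * real (card P)" using big by (rule mult_right_mono) simp
  finally have "real (4 * card ?T) \<le> real (r^2 * card P)" by simp
  then have few: "4 * card ?T \<le> r^2 * card P" by (simp only: of_nat_le_iff)
  have "finite ?T" by (rule finite_subset[of _ "Pow P"]) (use fin in auto)
  \<comment> \<open>\<open>colour_and_delete\<close> for collinear triples (\<open>h = 2\<close>),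
    with an empty second family.\<close>
  then have "\<exists>Q\<subseteq>P. card P \<le> 2 * r * card Q \<and> (\<forall>t\<in>?T. \<not> t \<subseteq> Q) \<and> (\<forall>K\<in>{}. \<not> K \<subseteq> Q)"
    by (intro colour_and_delete[OF fin _ finite.emptyI ne r, of _ 2 0]) (use few in simp_all)
  then obtain Q where Q: "Q \<subseteq> P" "card P \<le> 2 * r * card Q" "\<forall>t\<in>?T. \<not> t \<subseteq> Q" by blast
  have "general_position Q"
    unfolding general_position_def no_collinear_def
  proof (intro allI impI notI)
    fix S assume S: "S \<subseteq> Q \<and> card S = 3" and c: "collinear S"
    obtain p q r where pqr: "S = {p, q, r}" "p \<noteq> q" using S by (metis card_3_iff)
    have PP: "p \<in> P" "q \<in> P" "r \<in> P" using S Q pqr by auto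
    then have "x p \<noteq> x q" using inj pqr(2) by (auto dest: inj_onD)
    define b where "b = (y q - y p) / (x q - x p)"
    define a where "a = y p - b * x p"
    have "b * (x q - x p) = y q - y p" using \<open>x p \<noteq> x q\<close> by (simp add: b_def)
    then have "y q = a + b * x q" by (simp add: a_def algebra_simps)
    moreover have "y r - y p = b * (x r - x p)"
      using c \<open>x p \<noteq> x q\<close> unfolding pqr col by (simp add: b_def eq_divide_eq mult.commute)
    then have "y r = a + b * x r" by (simp add: a_def algebra_simps)
    ultimately have "S \<subseteq> on_line (a, b)" using PP by (auto simp: pqr on_line_def a_def)
    then have "S \<in> ?T" using S Q(1) by blast
    then show False using Q(3) S by blast
  qed
  then show ?thesis using Q by blast
qed

section \<open>Containers for linear 3-graphs\<close>

text \<open>The head of the list is the latest choice, and \<open>Q us u\<close> judges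
  \<open>u\<close> against the earlier choices \<open>us\<close>.\<close>

fun greedy :: "('a list \<Rightarrow> 'a \<Rightarrow> bool) \<Rightarrow> 'a list \<Rightarrow> bool" where
  "greedy Q [] \<longleftrightarrow> True"
| "greedy Q (u # us) \<longleftrightarrow> greedy Q us \<and> u \<notin> set us \<and> Q us u"

lemma greedy_distinct: "greedy Q us \<Longrightarrow> distinct us"
  by (induction us) auto

text \<open>Take a longest greedy list inside \<open>I\<close>; any acceptable further vertex would
  extend it.\<close>

lemma greedy_maximal:
  assumes "finite I"
  shows "\<exists>us. greedy Q us \<and> set us \<subseteq> I \<and> (\<forall>u\<in>I - set us. \<not> Q us u)"
proof -
  let ?V = "\<lambda>us. greedy Q us \<and> set us \<subseteq> I"
  have "length us < Suc (card I)" if "?V us" for us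
    using that assms by (metis card_mono distinct_card greedy_distinct less_Suc_eq_le)
  moreover have "?V []" by simp
  ultimately obtain us where us: "?V us" and max: "\<And>zs. ?V zs \<Longrightarrow> length zs \<le> length us"
    using ex_has_greatest_nat[of ?V "[]" length "Suc (card I)"] by (auto simp: less_Suc_eq_le)
  have "\<not> Q us u" if "u \<in> I - set us" for u
    using max[of "u # us"] us that by auto
  then show ?thesis using us by blast
qed

lemma card_lists_le:
  assumes "finite A"
  shows "card {us. set us \<subseteq> A \<and> length us \<le> q} \<le> (card A + 1) ^ q"
proof -
  have "(\<Sum>i\<le>q. card A ^ i) \<le> (card A + 1) ^ q"
  proof (induction q)
    case (Suc q)
    have "card A * card A ^ q \<le> card A * (card A + 1) ^ q"
      by (intro mult_left_mono power_mono) auto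
    moreover have "(\<Sum>i\<le>Suc q. card A ^ i) = (\<Sum>i\<le>q. card A ^ i) + card A * card A ^ q" by simp
    moreover have "(card A + 1) ^ Suc q = (card A + 1) ^ q + card A * (card A + 1) ^ q" by simp
    ultimately show ?case using Suc by linarith
  qed simp
  then show ?thesis using assms by (simp add: card_lists_length_le)
qed

definition degr :: "'a set set \<Rightarrow> 'a \<Rightarrow> nat" where
  "degr G x = card {p\<in>G. x \<in> p}"

lemma sum_degr:
  assumes "finite A" "finite G" "\<And>p. p \<in> G \<Longrightarrow> p \<subseteq> A \<and> card p = k"
  shows "(\<Sum>x\<in>A. degr G x) = k * card G"
proof -
  have "(\<Sum>x\<in>A. degr G x) = (\<Sum>p\<in>G. card {x\<in>A. x \<in> p})"
    unfolding degr_def using assms by (intro sum_card_swap)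
  also have "\<dots> = (\<Sum>p\<in>G. k)"
  proof (rule sum.cong[OF refl])
    fix p assume "p \<in> G"
    then have "{x\<in>A. x \<in> p} = p" using assms(3) by blast
    then show "card {x\<in>A. x \<in> p} = k" using assms(3)[OF \<open>p \<in> G\<close>] by simp
  qed
  finally show ?thesis by simp
qed

text \<open>\<open>D\<close> bounds all degrees, and \<open>dense\<close> makes the average degree
  at least \<open>D/3\<close>. \<open>\<theta>\<close> is the degree cap of the auxiliary graph. The
  factor 288 keeps the first fingerprint below \<open>card A / 24\<close>, and
  \<open>18432 = 48 * 384\<close> keeps the second below \<open>card A / 384\<close>.\<close>

locale linear_3graph =
  fixes A :: "'a set" and H :: "'a set set" and D \<theta> :: nat
  assumes finA: "finite A"
    and H: "\<And>e. e \<in> H \<Longrightarrow> e \<subseteq> A \<and> card e = 3"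
    and linear: "\<And>e g a b. e \<in> H \<Longrightarrow> g \<in> H \<Longrightarrow> a \<noteq> b \<Longrightarrow> {a, b} \<subseteq> e \<Longrightarrow> {a, b} \<subseteq> g \<Longrightarrow> e = g"
    and degree: "\<And>u. u \<in> A \<Longrightarrow> degr H u \<le> D"
    and dense: "D * card A \<le> 9 * card H"
    and D: "288 * \<theta> \<le> D" and \<theta>: "18432 \<le> \<theta>"
begin

lemma finH: "finite H"
  by (rule finite_subset[of _ "Pow A"]) (use H finA in auto)

definition link :: "'a \<Rightarrow> 'a set set" where
  "link u = (\<lambda>e. e - {u}) ` {e\<in>H. u \<in> e}"

lemma link_iff: "p \<in> link u \<longleftrightarrow> u \<notin> p \<and> insert u p \<in> H"
proof
  assume "p \<in> link u"
  then show "u \<notin> p \<and> insert u p \<in> H" unfolding link_def by (auto simp: insert_absorb)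
next
  assume "u \<notin> p \<and> insert u p \<in> H"
  then show "p \<in> link u" unfolding link_def by (intro image_eqI[of _ _ "insert u p"]) auto
qed

lemma finite_link [simp]: "finite (link u)"
  using finH by (simp add: link_def)

lemma card_link: "card (link u) = degr H u"
  unfolding link_def degr_def by (rule card_image) (auto simp: inj_on_def)

lemma link_card: "p \<in> link u \<Longrightarrow> card p = 2 \<and> p \<subseteq> A"
proof -
  assume p: "p \<in> link u"
  then have i: "insert u p \<subseteq> A" "card (insert u p) = 3" "u \<notin> p" using H by (auto simp: link_iff)
  then have "finite p" using finA by (meson finite_subset subset_insertI subset_trans)
  then show ?thesis using i by auto
qed

text \<open>A pair lies in at most one edge of \<open>H\<close>, so different vertices contribute
  disjoint sets of pairs.\<close>

lemma link_disjoint: "p \<in> link u \<Longrightarrow> p \<in> link u' \<Longrightarrow> u = u'"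
proof -
  assume p: "p \<in> link u" "p \<in> link u'"
  then obtain a b where ab: "p = {a, b}" "a \<noteq> b" using link_card by (metis card_2_iff)
  have "insert u p = insert u' p"
    by (rule linear[of _ _ a b]) (use p ab in \<open>auto simp: link_iff\<close>)
  then show "u = u'" using p by (auto simp: link_iff)
qed

text \<open>Links are matchings, again by linearity.\<close>

lemma degr_link_le: "degr (link u) x \<le> 1"
proof -
  have "p = q" if "p \<in> {p\<in>link u. x \<in> p}" "q \<in> {p\<in>link u. x \<in> p}" for p q
  proof -
    have "insert u p = insert u q"
      by (rule linear[of _ _ u x]) (use that in \<open>auto simp: link_iff\<close>)
    then show ?thesis using that by (auto simp: link_iff)
  qed
  then show ?thesis unfolding degr_def using card_le_Suc0_iff_eq[of "{p\<in>link u. x \<in> p}"] by simp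
qed

text \<open>A fingerprint is chosen greedily from an independent set: first vertices whose links still add
  many edges to a graph in which the independent set is independent too, then vertices with many
  new neighbours in that graph. Freezing the vertices of degree \<open>\<theta>\<close> keeps the graph of bounded degree.
  The fingerprint alone determines which vertices were rejected, hence the container.\<close>

definition saturated :: "'a set set \<Rightarrow> 'a set" where
  "saturated G = {x\<in>A. \<theta> \<le> degr G x}"

definition fresh :: "'a set set \<Rightarrow> 'a \<Rightarrow> 'a set set" where
  "fresh G u = {p\<in>link u. p \<inter> saturated G = {}}"

fun graph :: "'a list \<Rightarrow> 'a set set" where
  "graph [] = {}"
| "graph (u # us) = graph us \<union> fresh (graph us) u"

lemma fresh_link: "fresh G u \<subseteq> link u" by (auto simp: fresh_def)

lemma graph_link: "p \<in> graph us \<Longrightarrow> \<exists>u\<in>set us. p \<in> link u"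
  by (induction us) (auto simp: fresh_def)

lemma finite_graph [simp]: "finite (graph us)"
  by (induction us) (auto intro: finite_subset[OF fresh_link])

text \<open>A link is a matching, so it raises a degree by at most one, and pairs meeting a
  saturated vertex are never added.\<close>

lemma degr_graph_le: "x \<in> A \<Longrightarrow> degr (graph us) x \<le> \<theta>"
proof (induction us)
  case (Cons u us)
  show ?case
  proof (cases "x \<in> saturated (graph us)")
    case True
    then have "{p\<in>graph (u # us). x \<in> p} = {p\<in>graph us. x \<in> p}" by (auto simp: fresh_def)
    then show ?thesis using Cons by (simp add: degr_def)
  next
    case False
    have "{p\<in>graph (u # us). x \<in> p} \<subseteq> {p\<in>graph us. x \<in> p} \<union> {p\<in>link u. x \<in> p}"
      by (auto simp: fresh_def)
    then have "degr (graph (u # us)) x \<le> card ({p\<in>graph us. x \<in> p} \<union> {p\<in>link u. x \<in> p})"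
      unfolding degr_def by (intro card_mono) auto
    also have "\<dots> \<le> degr (graph us) x + degr (link u) x"
      unfolding degr_def by (rule card_Un_le)
    also have "\<dots> \<le> degr (graph us) x + 1" using degr_link_le by simp
    finally show ?thesis using False Cons.prems by (simp add: saturated_def)
  qed
qed (simp add: degr_def)

lemma sum_degr_graph: "(\<Sum>x\<in>A. degr (graph us) x) = 2 * card (graph us)"
  by (rule sum_degr[OF finA finite_graph]) (use graph_link link_card in blast)

section \<open>First stage of the fingerprint: few saturated vertices\<close>

abbreviation "rich1 \<equiv> \<lambda>us u. D \<le> 24 * card (fresh (graph us) u)"

text \<open>Each choice adds at least \<open>D/24\<close> pairs, new ones by
  \<open>link_disjoint\<close>, while the degree cap allows at most
  \<open>\<theta> * card A / 2\<close> pairs in total.\<close>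

lemma greedy1_length:
  assumes "greedy rich1 us"
  shows "D * length us \<le> 12 * \<theta> * card A"
proof -
  have "D * length us \<le> 24 * card (graph us)"
    using assms
  proof (induction us)
    case (Cons u us)
    have "graph us \<inter> fresh (graph us) u = {}"
    proof (rule ccontr)
      assume "\<not> ?thesis"
      then obtain p where "p \<in> graph us" "p \<in> link u" by (auto simp: fresh_def)
      then show False using graph_link link_disjoint Cons.prems by fastforce
    qed
    then have "card (graph (u # us)) = card (graph us) + card (fresh (graph us) u)"
      by (simp add: card_Un_disjoint finite_subset[OF fresh_link])
    then show ?case using Cons by simp
  qed simp
  also have "2 * card (graph us) \<le> card A * \<theta>"
    using sum_bounded_above[of A "degr (graph us)" \<theta>] degr_graph_le by (simp add: sum_degr_graph)
  then have "24 * card (graph us) \<le> 12 * \<theta> * card A" by (simp add: mult.commute)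
  finally show ?thesis .
qed

definition cont1 :: "'a list \<Rightarrow> 'a set" where
  "cont1 us = set us \<union> {u\<in>A. \<not> rich1 us u}"

text \<open>A rejected vertex has fewer than \<open>D/24\<close> fresh pairs, and few pairs meet the
  few saturated vertices. As the total degree is at least \<open>D * card A / 3\<close>, at least a
  sixth of \<open>A\<close> consists of accepted vertices outside the container.\<close>

lemma cont1_small:
  assumes g: "greedy rich1 us" "set us \<subseteq> A" and sat: "24 * card (saturated (graph us)) < card A"
  shows "384 * card (cont1 us) \<le> 383 * card A"
proof -
  let ?\<Gamma> = "saturated (graph us)"
  let ?hit = "\<lambda>u. {p\<in>link u. p \<inter> ?\<Gamma> \<noteq> {}}"
  let ?B = "A - cont1 us"
  have \<Gamma>A: "?\<Gamma> \<subseteq> A" by (auto simp: saturated_def)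
  have fin\<Gamma>: "finite ?\<Gamma>" using finA \<Gamma>A finite_subset by blast
  have Dpos: "0 < D" using D \<theta> by linarith
  have "D * (24 * length us) \<le> 288 * \<theta> * card A" using greedy1_length[OF g(1)] by simp
  also have "\<dots> \<le> D * card A" using D by (rule mult_right_mono) simp
  finally have len: "24 * length us \<le> card A" using Dpos by simp
  \<comment> \<open>Each saturated \<open>x\<close> lies in at most \<open>D\<close> edges, and each
    of these edges affects the links of its two other vertices.\<close>
  have hit: "(\<Sum>u\<in>A. card (?hit u)) \<le> 2 * D * card ?\<Gamma>"
  proof -
    have "(\<Sum>u\<in>A. card (?hit u)) \<le> (\<Sum>u\<in>A. \<Sum>x\<in>?\<Gamma>. card {e\<in>H. x \<in> e \<and> u \<in> e - {x}})"
    proof (rule sum_mono)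
      fix u
      have "card (?hit u) = card (insert u ` ?hit u)"
        by (rule card_image[symmetric]) (auto simp: inj_on_def link_iff)
      also have "insert u ` ?hit u \<subseteq> (\<Union>x\<in>?\<Gamma>. {e\<in>H. x \<in> e \<and> u \<in> e - {x}})"
        by (auto simp: link_iff)
      then have "card (insert u ` ?hit u) \<le> card (\<Union>x\<in>?\<Gamma>. {e\<in>H. x \<in> e \<and> u \<in> e - {x}})"
        using finH fin\<Gamma> by (intro card_mono) auto
      also have "\<dots> \<le> (\<Sum>x\<in>?\<Gamma>. card {e\<in>H. x \<in> e \<and> u \<in> e - {x}})" using fin\<Gamma> by (rule card_UN_le)
      finally show "card (?hit u) \<le> (\<Sum>x\<in>?\<Gamma>. card {e\<in>H. x \<in> e \<and> u \<in> e - {x}})" .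
    qed
    also have "\<dots> = (\<Sum>x\<in>?\<Gamma>. \<Sum>u\<in>A. card {e\<in>H. x \<in> e \<and> u \<in> e - {x}})" by (rule sum.swap)
    also have "\<dots> = (\<Sum>x\<in>?\<Gamma>. \<Sum>e\<in>H. card {u\<in>A. x \<in> e \<and> u \<in> e - {x}})"
      by (intro sum.cong refl sum_card_swap finA finH)
    also have "\<dots> = (\<Sum>x\<in>?\<Gamma>. \<Sum>e\<in>H. if x \<in> e then 2 else 0)"
    proof (intro sum.cong refl)
      fix x e assume "e \<in> H"
      then have "e \<subseteq> A" "card e = 3" using H by auto
      then have "{u\<in>A. x \<in> e \<and> u \<in> e - {x}} = (if x \<in> e then e - {x} else {})" by auto
      then show "card {u\<in>A. x \<in> e \<and> u \<in> e - {x}} = (if x \<in> e then 2 else 0)"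
        using \<open>card e = 3\<close> by simp
    qed
    also have "\<dots> = (\<Sum>x\<in>?\<Gamma>. degr H x * 2)"
      using finH by (simp add: degr_def flip: sum.inter_filter)
    also have "\<dots> \<le> (\<Sum>x\<in>?\<Gamma>. D * 2)" using degree \<Gamma>A by (intro sum_mono) auto
    finally show ?thesis by (simp add: mult.commute)
  qed
  have "24 * degr H u \<le> D + 24 * card (?hit u) + 24 * (if u \<in> set us \<union> ?B then D else 0)"
    if u: "u \<in> A" for u
  proof (cases "u \<in> set us \<union> ?B")
    case True
    then show ?thesis using degree[OF u] by simp
  next
    case False
    then have "24 * card (fresh (graph us) u) < D" using u by (auto simp: cont1_def)
    moreover have eq: "fresh (graph us) u \<union> ?hit u = link u" by (auto simp: fresh_def)
    have "card (link u) \<le> card (fresh (graph us) u) + card (?hit u)"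
      using card_Un_le[of "fresh (graph us) u" "?hit u"] unfolding eq .
    ultimately show ?thesis using card_link by simp
  qed
  then have "(\<Sum>u\<in>A. 24 * degr H u)
      \<le> (\<Sum>u\<in>A. D + 24 * card (?hit u) + 24 * (if u \<in> set us \<union> ?B then D else 0))"
    by (rule sum_mono)
  also have "\<dots> = D * card A + 24 * (\<Sum>u\<in>A. card (?hit u)) + 24 * (\<Sum>u\<in>A. if u \<in> set us \<union> ?B then D else 0)"
    by (simp add: sum.distrib sum_distrib_left)
  also have "(\<Sum>u\<in>A. if u \<in> set us \<union> ?B then D else 0) = D * card (set us \<union> ?B)"
  proof -
    have "{u\<in>A. u \<in> set us \<union> ?B} = set us \<union> ?B" using g by blast
    moreover have "(\<Sum>u\<in>A. if u \<in> set us \<union> ?B then D else 0) = (\<Sum>u\<in>{u\<in>A. u \<in> set us \<union> ?B}. D)"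
      by (rule sum.inter_filter[OF finA, symmetric])
    ultimately show ?thesis by (simp only: sum_constant) simp
  qed
  also have "card (set us \<union> ?B) \<le> length us + card ?B"
    by (meson add_mono card_Un_le card_length le_trans order_refl)
  finally have "24 * (\<Sum>u\<in>A. degr H u) \<le> D * card A + 24 * (2 * D * card ?\<Gamma>) + 24 * (D * (length us + card ?B))"
    using hit by (simp flip: sum_distrib_left)
  moreover have "(\<Sum>u\<in>A. degr H u) = 3 * card H"
    by (rule sum_degr[OF finA finH H])
  ultimately have "8 * (D * card A) \<le> D * (card A + 48 * card ?\<Gamma> + 24 * (length us + card ?B))"
    using dense by (simp add: algebra_simps)
  then have "8 * card A \<le> card A + 48 * card ?\<Gamma> + 24 * (length us + card ?B)"
    using Dpos by (metis mult.left_commute nat_mult_le_cancel1)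
  moreover have "a \<le> 6 * d" if "8 * a \<le> a + 48 * b + 24 * (c + d)" "24 * c \<le> a" "24 * b < a"
    for a b c d :: nat using that by simp
  ultimately have "card A \<le> 6 * card ?B" using len sat by blast
  moreover have "card ?B = card A - card (cont1 us)"
    using g finA by (intro card_Diff_subset) (auto simp: cont1_def)
  moreover have "card (cont1 us) \<le> card A" using g finA by (intro card_mono) (auto simp: cont1_def)
  ultimately show ?thesis by linarith
qed

section \<open>Second stage of the fingerprint: many saturated vertices\<close>

definition nbr :: "'a list \<Rightarrow> 'a \<Rightarrow> 'a set" where
  "nbr us x = {z\<in>A. z \<noteq> x \<and> {x, z} \<in> graph us}"

definition nbrs :: "'a list \<Rightarrow> 'a list \<Rightarrow> 'a set" where
  "nbrs us xs = (\<Union>x\<in>set xs. nbr us x)"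

abbreviation "rich2 us \<equiv> \<lambda>xs x. \<theta> \<le> 48 * card (nbr us x - nbrs us xs)"

text \<open>An independent set misses \<open>nbrs us xs\<close>. When that set is large, its
  complement is already a small container; otherwise the rejected vertices form one.\<close>

definition cont2 :: "'a list \<Rightarrow> 'a list \<Rightarrow> 'a set" where
  "cont2 us xs = (if card A \<le> 384 * card (nbrs us xs) then A - nbrs us xs
     else set xs \<union> {x\<in>A. \<not> rich2 us xs x})"

lemma nbrs_sub: "nbrs us xs \<subseteq> A" by (auto simp: nbrs_def nbr_def)

lemma finite_nbrs [simp]: "finite (nbrs us xs)" using nbrs_sub finA finite_subset by blast

lemma finite_nbr [simp]: "finite (nbr us x)" using finA by (simp add: nbr_def)

lemma card_nbr: "card (nbr us x) = degr (graph us) x"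
proof -
  have "bij_betw (\<lambda>z. {x, z}) (nbr us x) {p\<in>graph us. x \<in> p}"
    unfolding bij_betw_def
  proof
    show "inj_on (\<lambda>z. {x, z}) (nbr us x)" by (auto simp: inj_on_def nbr_def doubleton_eq_iff)
    show "(\<lambda>z. {x, z}) ` nbr us x = {p\<in>graph us. x \<in> p}"
    proof
      show "{p\<in>graph us. x \<in> p} \<subseteq> (\<lambda>z. {x, z}) ` nbr us x"
      proof
        fix p assume p: "p \<in> {p\<in>graph us. x \<in> p}"
        then have "card p = 2" "p \<subseteq> A" using graph_link link_card by blast+
        then obtain z where "p = {x, z}" "z \<noteq> x" using p by (auto simp: card_2_iff doubleton_eq_iff)
        then show "p \<in> (\<lambda>z. {x, z}) ` nbr us x" using p \<open>p \<subseteq> A\<close> by (auto simp: nbr_def)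
      qed
    qed (auto simp: nbr_def)
  qed
  then show ?thesis unfolding degr_def by (rule bij_betw_same_card)
qed

text \<open>Each choice adds at least \<open>\<theta>/48\<close> vertices to
  \<open>nbrs us xs\<close>, which stays inside \<open>A\<close>.\<close>

lemma greedy2_length:
  assumes "greedy (rich2 us) xs"
  shows "\<theta> * length xs \<le> 48 * card A"
proof -
  have "\<theta> * length xs \<le> 48 * card (nbrs us xs)"
    using assms
  proof (induction xs)
    case (Cons x xs)
    have "nbrs us (x # xs) = nbrs us xs \<union> (nbr us x - nbrs us xs)" by (auto simp: nbrs_def)
    moreover have "card (nbrs us xs \<union> (nbr us x - nbrs us xs)) = card (nbrs us xs) + card (nbr us x - nbrs us xs)"
      by (rule card_Un_disjoint) auto
    ultimately have "card (nbrs us (x # xs)) = card (nbrs us xs) + card (nbr us x - nbrs us xs)"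
      by (simp only:)
    then show ?case using Cons by simp
  qed simp
  also have "card (nbrs us xs) \<le> card A" using nbrs_sub finA by (rule card_mono[rotated])
  finally show ?thesis by simp
qed

text \<open>Many saturated vertices force a degree sum of at least
  \<open>\<theta> * card A / 24\<close>. If the excluded neighbourhood is small, the degree cap
  limits what it can absorb, so at least \<open>card A / 64\<close> vertices have
  \<open>\<theta>/48\<close> new neighbours and lie outside. The bound 383/384 comes from the other
  case, a large neighbourhood.\<close>

lemma cont2_small:
  assumes g: "greedy (rich2 us) xs" "set xs \<subseteq> A" and sat: "card A \<le> 24 * card (saturated (graph us))"
  shows "384 * card (cont2 us xs) \<le> 383 * card A"
proof (cases "card A \<le> 384 * card (nbrs us xs)")
  case True
  have "card (A - nbrs us xs) = card A - card (nbrs us xs)"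
    using nbrs_sub by (intro card_Diff_subset) auto
  then show ?thesis using True by (simp add: cont2_def)
next
  case False
  let ?W = "nbrs us xs"
  let ?C = "set xs \<union> {x\<in>A. \<not> rich2 us xs x}"
  let ?B = "A - ?C"
  have "18432 * length xs \<le> \<theta> * length xs" using \<theta> by (rule mult_right_mono) simp
  then have len: "384 * length xs \<le> card A" using greedy2_length[OF g(1)] by linarith
  have hit: "(\<Sum>x\<in>A. card (nbr us x \<inter> ?W)) \<le> \<theta> * card ?W"
  proof -
    have "(\<Sum>x\<in>A. card (nbr us x \<inter> ?W)) = (\<Sum>x\<in>A. card {w\<in>?W. w \<in> nbr us x})"
      by (intro sum.cong refl arg_cong[where f=card]) auto
    also have "\<dots> = (\<Sum>w\<in>?W. card {x\<in>A. w \<in> nbr us x})"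
      using finA by (intro sum_card_swap) auto
    also have "\<dots> = (\<Sum>w\<in>?W. card (nbr us w))"
      using nbrs_sub by (intro sum.cong refl arg_cong[where f=card]) (auto simp: nbr_def insert_commute)
    also have "\<dots> \<le> (\<Sum>w\<in>?W. \<theta>)"
      using degr_graph_le[OF subsetD[OF nbrs_sub]] by (intro sum_mono) (simp add: card_nbr)
    finally show ?thesis by (simp add: mult.commute)
  qed
  have "48 * degr (graph us) x \<le> \<theta> + 48 * card (nbr us x \<inter> ?W) + 48 * (if x \<in> set xs \<union> ?B then \<theta> else 0)"
    if x: "x \<in> A" for x
  proof (cases "x \<in> set xs \<union> ?B")
    case True
    then show ?thesis using degr_graph_le[OF x, of us] by simp
  next
    case F: False
    then have "48 * card (nbr us x - ?W) < \<theta>" using x by auto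
    moreover have "card (nbr us x) = card (nbr us x \<inter> ?W) + card (nbr us x - ?W)"
      by (rule card_Int_Diff) simp
    ultimately show ?thesis using card_nbr by simp
  qed
  then have "(\<Sum>x\<in>A. 48 * degr (graph us) x)
      \<le> (\<Sum>x\<in>A. \<theta> + 48 * card (nbr us x \<inter> ?W) + 48 * (if x \<in> set xs \<union> ?B then \<theta> else 0))"
    by (rule sum_mono)
  also have "\<dots> = \<theta> * card A + 48 * (\<Sum>x\<in>A. card (nbr us x \<inter> ?W)) + 48 * (\<Sum>x\<in>A. if x \<in> set xs \<union> ?B then \<theta> else 0)"
    by (simp add: sum.distrib sum_distrib_left)
  also have "(\<Sum>x\<in>A. if x \<in> set xs \<union> ?B then \<theta> else 0) = \<theta> * card (set xs \<union> ?B)"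
  proof -
    have "{x\<in>A. x \<in> set xs \<union> ?B} = set xs \<union> ?B" using g by blast
    moreover have "(\<Sum>x\<in>A. if x \<in> set xs \<union> ?B then \<theta> else 0) = (\<Sum>x\<in>{x\<in>A. x \<in> set xs \<union> ?B}. \<theta>)"
      by (rule sum.inter_filter[OF finA, symmetric])
    ultimately show ?thesis by (simp only: sum_constant) simp
  qed
  also have "card (set xs \<union> ?B) \<le> length xs + card ?B"
    by (meson add_mono card_Un_le card_length le_trans order_refl)
  finally have "48 * (\<Sum>x\<in>A. degr (graph us) x) \<le> \<theta> * card A + 48 * (\<theta> * card ?W) + 48 * (\<theta> * (length xs + card ?B))"
    using hit by (simp flip: sum_distrib_left)
  moreover have "\<theta> * card (saturated (graph us)) \<le> (\<Sum>x\<in>A. degr (graph us) x)"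
  proof -
    have "card (saturated (graph us)) * \<theta> \<le> (\<Sum>x\<in>saturated (graph us). degr (graph us) x)"
      using sum_bounded_below[of "saturated (graph us)" \<theta> "degr (graph us)"] by (simp add: saturated_def)
    also have "\<dots> \<le> (\<Sum>x\<in>A. degr (graph us) x)"
      using finA by (intro sum_mono2) (auto simp: saturated_def)
    finally show ?thesis by (simp add: mult.commute)
  qed
  moreover have "\<theta> * card A \<le> 24 * (\<theta> * card (saturated (graph us)))"
    using mult_le_mono2[OF sat, of \<theta>] by (simp only: mult.left_commute)
  ultimately have "2 * (\<theta> * card A) \<le> \<theta> * card A + 48 * (\<theta> * card ?W) + 48 * (\<theta> * (length xs + card ?B))"
    by linarith
  also have "\<dots> = \<theta> * (card A + 48 * card ?W + 48 * (length xs + card ?B))" by (simp add: algebra_simps)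
  finally have "\<theta> * (2 * card A) \<le> \<theta> * (card A + 48 * card ?W + 48 * (length xs + card ?B))"
    by (simp only: mult.left_commute)
  then have "2 * card A \<le> card A + 48 * card ?W + 48 * (length xs + card ?B)"
    using \<theta> by simp
  moreover have "a \<le> 64 * d" if "2 * a \<le> a + 48 * b + 48 * (c + d)" "384 * c \<le> a" "\<not> a \<le> 384 * b"
    for a b c d :: nat using that by simp
  ultimately have "card A \<le> 64 * card ?B" using len False by blast
  moreover have "card ?B = card A - card ?C"
    using g finA by (intro card_Diff_subset) auto
  moreover have "card ?C \<le> card A" using g finA by (intro card_mono) auto
  ultimately have "384 * card ?C \<le> 383 * card A" by linarith
  then show ?thesis using False by (simp add: cont2_def)
qed

text \<open>A pair of the graph comes from the link of some chosen \<open>u\<close>; were both its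
  ends in \<open>I\<close>, together with \<open>u\<close> they would be an edge of \<open>H\<close>
  inside \<open>I\<close>.\<close>

lemma nbrs_disjoint:
  assumes I: "\<And>e. e \<in> H \<Longrightarrow> \<not> e \<subseteq> I" and "set us \<subseteq> I" "set xs \<subseteq> I"
  shows "I \<inter> nbrs us xs = {}"
proof (rule ccontr)
  assume "\<not> ?thesis"
  then obtain z x where z: "z \<in> I" "x \<in> set xs" "{x, z} \<in> graph us" by (auto simp: nbrs_def nbr_def)
  then obtain u where "u \<in> set us" "{x, z} \<in> link u" using graph_link by blast
  then have "insert u {x, z} \<in> H" "insert u {x, z} \<subseteq> I" using assms(2,3) z by (auto simp: link_iff)
  then show False using I by blast
qed

theorem containers:
  assumes q: "12 * \<theta> * card A \<le> D * q" "48 * card A \<le> \<theta> * q"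
  shows "\<exists>\<C>. finite \<C> \<and> card \<C> \<le> (card A + 1) ^ (2 * q) \<and> (\<forall>C\<in>\<C>. C \<subseteq> A \<and> 384 * card C \<le> 383 * card A)
     \<and> (\<forall>I\<subseteq>A. (\<forall>e\<in>H. \<not> e \<subseteq> I) \<longrightarrow> (\<exists>C\<in>\<C>. I \<subseteq> C))"
proof -
  let ?S = "{us. set us \<subseteq> A \<and> length us \<le> q}"
  \<comment> \<open>The choice between the two containers depends on \<open>us\<close> alone, not on
    the independent set, so counting pairs of lists counts containers.\<close>
  define cont where "cont = (\<lambda>(us, xs). if 24 * card (saturated (graph us)) < card A then cont1 us else cont2 us xs)"
  \<comment> \<open>Arbitrary pairs of lists need not give small sets, so these are filtered out;
    pairs selected greedily from an independent set pass the filter.\<close>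
  let ?\<C> = "{C \<in> cont ` (?S \<times> ?S). C \<subseteq> A \<and> 384 * card C \<le> 383 * card A}"
  have finS: "finite ?S" using finite_lists_length_le[OF finA] .
  have "card ?\<C> \<le> card (cont ` (?S \<times> ?S))" using finS by (intro card_mono) auto
  also have "\<dots> \<le> card (?S \<times> ?S)" using finS by (intro card_image_le) auto
  also have "\<dots> \<le> (card A + 1) ^ q * (card A + 1) ^ q"
    unfolding card_cartesian_product using card_lists_le[OF finA] by (intro mult_mono) auto
  finally have "card ?\<C> \<le> (card A + 1) ^ (2 * q)" by (simp add: mult_2 power_add)
  moreover have "\<exists>C\<in>?\<C>. I \<subseteq> C" if I: "I \<subseteq> A" "\<forall>e\<in>H. \<not> e \<subseteq> I" for I
  proof -
    have finI: "finite I" using I finA finite_subset by blast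
    obtain us where us: "greedy rich1 us" "set us \<subseteq> I" "\<forall>u\<in>I - set us. \<not> rich1 us u"
      using greedy_maximal[OF finI, of rich1] by blast
    obtain xs where xs: "greedy (rich2 us) xs" "set xs \<subseteq> I" "\<forall>x\<in>I - set xs. \<not> rich2 us xs x"
      using greedy_maximal[OF finI, of "rich2 us"] by blast
    have "D * length us \<le> D * q" using greedy1_length[OF us(1)] q by linarith
    moreover have "\<theta> * length xs \<le> \<theta> * q" using greedy2_length[OF xs(1)] q by linarith
    ultimately have "length us \<le> q" "length xs \<le> q" using D \<theta> by auto
    then have S: "(us, xs) \<in> ?S \<times> ?S" using us xs I by auto
    have "I \<subseteq> cont (us, xs)"
      using us xs I nbrs_disjoint[of I us xs] by (auto simp: cont_def cont1_def cont2_def)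
    moreover have "cont (us, xs) \<subseteq> A"
      using us(2) xs(2) I(1) by (auto simp: cont_def cont1_def cont2_def)
    moreover have "384 * card (cont (us, xs)) \<le> 383 * card A"
      using cont1_small[OF us(1)] cont2_small[OF xs(1)] us(2) xs(2) I(1) by (auto simp: cont_def)
    ultimately show ?thesis using S by (intro bexI[of _ "cont (us, xs)"]) auto
  qed
  ultimately show ?thesis using finS by (intro exI[of _ ?\<C>]) auto
qed

end

section \<open>Collinearity in the integer lattice\<close>

type_synonym pt = "int \<times> int \<times> int"

text \<open>Vanishing of the cross product, so the zero vector is parallel to everything.\<close>

definition parallel :: "pt \<Rightarrow> pt \<Rightarrow> bool" where
  "parallel a b \<longleftrightarrow> (case (a, b) of ((a1, a2, a3), (b1, b2, b3)) \<Rightarrow>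
     a2 * b3 = a3 * b2 \<and> a3 * b1 = a1 * b3 \<and> a1 * b2 = a2 * b1)"

definition aligned :: "pt set \<Rightarrow> bool" where
  "aligned S \<longleftrightarrow> (\<forall>u\<in>S. \<forall>v\<in>S. \<forall>w\<in>S. parallel (v - u) (w - u))"

definition primitive :: "pt \<Rightarrow> bool" where
  "primitive v \<longleftrightarrow> (case v of (a, b, c) \<Rightarrow> gcd a (gcd b c) = 1)"

definition mul :: "int \<Rightarrow> pt \<Rightarrow> pt" where
  "mul k v = (case v of (a, b, c) \<Rightarrow> (k * a, k * b, k * c))"

definition grid :: "nat \<Rightarrow> pt set" where
  "grid m = {0..<int m} \<times> {0..<int m} \<times> {0..<int m}"

lemma finite_grid [simp]: "finite (grid m)" by (simp add: grid_def)

lemma card_grid: "card (grid m) = m ^ 3"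
  by (simp add: grid_def card_cartesian_product eval_nat_numeral)

lemma mul_simps [simp]: "mul 0 v = 0" "mul 1 v = v"
  by (auto simp: mul_def zero_prod_def split: prod.splits)

lemma mul_add: "mul (j + k) v = mul j v + mul k v"
  by (auto simp: mul_def algebra_simps split: prod.splits)

lemma mul_diff: "mul (j - k) v = mul j v - mul k v"
  by (auto simp: mul_def algebra_simps split: prod.splits)

lemma mul_eq_0: "mul k v = 0 \<longleftrightarrow> k = 0 \<or> v = 0"
  by (auto simp: mul_def zero_prod_def split: prod.splits)

lemma mul_inj: "v \<noteq> 0 \<Longrightarrow> mul j v = mul k v \<longleftrightarrow> j = k"
  using mul_eq_0[of "j - k" v] by (auto simp: mul_diff)

lemma parallel_mul: "parallel (mul j v) (mul k v)"
  by (auto simp: parallel_def mul_def split: prod.splits)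

lemma primitive_nonzero: "primitive v \<Longrightarrow> v \<noteq> 0"
  by (auto simp: primitive_def zero_prod_def)

text \<open>Bezout gives integers \<open>x, y, z\<close> whose scalar product with \<open>v\<close>
  is 1; the multiplier is their scalar product with \<open>a\<close>.\<close>

lemma parallel_primitive:
  assumes "primitive v" "parallel v a"
  shows "\<exists>k. a = mul k v"
proof -
  obtain v1 v2 v3 a1 a2 a3 where v: "v = (v1, v2, v3)" "a = (a1, a2, a3)" by (metis surj_pair)
  obtain p q where 1: "p * v1 + q * gcd v2 v3 = 1" using bezout_int[of v1 "gcd v2 v3"] assms by (auto simp: v primitive_def)
  obtain q' r' where 2: "q' * v2 + r' * v3 = gcd v2 v3" using bezout_int by blast
  define x y z where "x = p" and "y = q * q'" and "z = q * r'"
  have b: "x * v1 + y * v2 + z * v3 = 1"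
    using 1 unfolding 2[symmetric] x_def y_def z_def by (simp add: algebra_simps)
  have e: "v2 * a3 = v3 * a2" "v3 * a1 = v1 * a3" "v1 * a2 = v2 * a1"
    using assms by (auto simp: v parallel_def)
  let ?k = "x * a1 + y * a2 + z * a3"
  have "?k * v1 = (x * v1 + y * v2 + z * v3) * a1"
    "?k * v2 = (x * v1 + y * v2 + z * v3) * a2"
    "?k * v3 = (x * v1 + y * v2 + z * v3) * a3"
    using e by algebra+
  then have "a = mul ?k v" unfolding b by (simp add: v mul_def)
  then show ?thesis ..
qed

lemma primitive_direction:
  assumes "a \<noteq> 0" shows "\<exists>v k. primitive v \<and> a = mul k v"
proof -
  obtain a1 a2 a3 where a: "a = (a1, a2, a3)" by (metis surj_pair)
  define g where "g = gcd a1 (gcd a2 a3)"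
  have g: "g \<noteq> 0" using assms by (auto simp: a g_def zero_prod_def)
  have d: "g dvd a1" "g dvd a2" "g dvd a3" unfolding g_def by (auto intro: gcd_dvd2 dvd_trans)
  then obtain b1 b2 b3 where b: "a1 = g * b1" "a2 = g * b2" "a3 = g * b3" by (auto simp: dvd_def)
  have "g = g * gcd b1 (gcd b2 b3)"
  proof -
    have "0 \<le> g" by (simp add: g_def)
    then have "gcd (g * b1) (gcd (g * b2) (g * b3)) = g * gcd b1 (gcd b2 b3)"
      using gcd_mult_distrib_int[of g b2 b3] gcd_mult_distrib_int[of g b1 "gcd b2 b3"] by simp
    then show ?thesis unfolding b[symmetric] g_def[symmetric] .
  qed
  then have "gcd b1 (gcd b2 b3) = 1" using g by simp
  then show ?thesis using b a by (intro exI[of _ "(b1, b2, b3)"] exI[of _ g]) (simp add: primitive_def mul_def)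
qed

text \<open>A primitive direction makes the steps between points of \<open>S\<close> integral.
  Starting from the point of least index \<open>Min K\<close> makes all indices nonnegative.\<close>

lemma aligned_param:
  assumes al: "aligned S" and fin: "finite S" and two: "2 \<le> card S"
  shows "\<exists>u v J. u \<in> S \<and> primitive v \<and> finite J \<and> 0 \<in> J \<and> J \<subseteq> {0..} \<and> card J = card S \<and> S = (\<lambda>j. u + mul j v) ` J"
proof -
  obtain p q where pq: "p \<in> S" "q \<in> S" "p \<noteq> q"
  proof -
    obtain T where "T \<subseteq> S" "card T = 2" using two by (metis obtain_subset_with_card_n)
    then show ?thesis using that by (auto simp: card_2_iff)
  qed
  then have "q - p \<noteq> 0" by simp
  then obtain v k where v: "primitive v" "q - p = mul k v" using primitive_direction by blast
  have v0: "v \<noteq> 0" using v primitive_nonzero by blast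
  have "k \<noteq> 0" using v pq by auto
  have ex: "\<exists>j. x = p + mul j v" if "x \<in> S" for x
  proof -
    have "parallel (q - p) (x - p)" using al pq that unfolding aligned_def by blast
    then have "parallel (mul k v) (x - p)" by (simp only: v(2))
    then have "parallel v (x - p)"
      using \<open>k \<noteq> 0\<close> by (auto simp: parallel_def mul_def split: prod.splits)
    then obtain j where "x - p = mul j v" using parallel_primitive v by blast
    then have "x = p + mul j v" by (metis add.commute diff_add_cancel)
    then show ?thesis ..
  qed
  define K where "K = {j. p + mul j v \<in> S}"
  have inj: "inj (\<lambda>j. w + mul j v)" for w using mul_inj[OF v0] by (auto simp: inj_on_def)
  have SK: "S = (\<lambda>j. p + mul j v) ` K" using ex unfolding K_def by blast
  have finK: "finite K" using fin unfolding SK by (metis finite_imageD inj inj_on_subset subset_UNIV)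
  have "0 \<in> K" using pq by (simp add: K_def)
  let ?m = "Min K"
  have m: "?m \<in> K" using finK \<open>0 \<in> K\<close> by (metis Min_in empty_iff)
  let ?u = "p + mul ?m v" and ?J = "(\<lambda>j. j - ?m) ` K"
  have SJ: "S = (\<lambda>j. ?u + mul j v) ` ?J"
    unfolding image_image using SK by (simp add: mul_diff algebra_simps)
  show ?thesis
  proof (intro exI conjI)
    show "?u \<in> S" using m by (simp add: K_def)
    show "primitive v" by fact
    show "finite ?J" using finK by simp
    show "0 \<in> ?J" using m by force
    show "?J \<subseteq> {0..}" using finK by auto
    show "S = (\<lambda>j. ?u + mul j v) ` ?J" by fact
    then show "card ?J = card S" by (metis card_image inj inj_on_subset subset_UNIV)
  qed
qed

text \<open>A nonzero coordinate of the direction is injective on the line and takes at most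
  \<open>m\<close> values.\<close>

lemma aligned_grid_card_le:
  assumes al: "aligned S" and S: "S \<subseteq> grid m" shows "card S \<le> m \<or> card S \<le> 1"
proof (rule ccontr)
  assume c: "\<not> ?thesis"
  have fin: "finite S" using S finite_grid by (rule finite_subset)
  obtain u v J where J: "primitive v" "finite J" "J \<subseteq> {0..}" "card J = card S" "S = (\<lambda>j. u + mul j v) ` J"
  proof -
    have "2 \<le> card S" using c by simp
    from aligned_param[OF al fin this] show ?thesis using that by blast
  qed
  obtain u1 u2 u3 v1 v2 v3 where uv: "u = (u1, u2, u3)" "v = (v1, v2, v3)" by (metis surj_pair)
  have inj: "inj_on (\<lambda>j. a + j * b) J" if "b \<noteq> 0" for a b using that by (auto simp: inj_on_def)
  have sub: "(\<lambda>j. u1 + j * v1) ` J \<subseteq> {0..<int m}" "(\<lambda>j. u2 + j * v2) ` J \<subseteq> {0..<int m}"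
    "(\<lambda>j. u3 + j * v3) ` J \<subseteq> {0..<int m}"
    using S unfolding J(5) by (auto simp: uv mul_def grid_def)
  have "v1 \<noteq> 0 \<or> v2 \<noteq> 0 \<or> v3 \<noteq> 0" using primitive_nonzero[OF J(1)] by (auto simp: uv zero_prod_def)
  then have "card J \<le> card {0..<int m}"
    using sub inj by (meson card_inj_on_le finite_atLeastLessThan_int)
  then show False using c J by simp
qed

section \<open>Counting aligned sets of \<open>s + 1\<close> grid points\<close>

definition cube :: "nat \<Rightarrow> pt set" where
  "cube k = {-int k..int k} \<times> {-int k..int k} \<times> {-int k..int k}"

lemma card_cube: "card (cube k) = (2 * k + 1) ^ 3"
proof -
  have "nat (2 * int k + 1) = 2 * k + 1" by simp
  then show ?thesis by (simp add: cube_def card_cartesian_product power3_eq_cube)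
qed

text \<open>The code of \<open>S\<close> is its first point \<open>u\<close>, its direction
  \<open>v\<close>, the index \<open>g\<close> of its last point and the \<open>s - 1\<close>
  indices in between. As \<open>g\<close> steps stay inside the grid, the coordinates of
  \<open>v\<close> are at most \<open>m div g\<close>.\<close>

lemma aligned_subsets_cover:
  assumes "2 \<le> s"
  shows "{S. S \<subseteq> grid m \<and> card S = s + 1 \<and> aligned S} \<subseteq>
    (\<Union>g\<in>{1..m}. (\<lambda>(u, v, J). (\<lambda>j. u + mul j v) ` (J \<union> {0, int g})) `
      (grid m \<times> cube (m div g) \<times> {J. J \<subseteq> {1..<int g} \<and> card J = s - 1}))"
proof
  fix S assume "S \<in> {S. S \<subseteq> grid m \<and> card S = s + 1 \<and> aligned S}"
  then have S: "S \<subseteq> grid m" "card S = s + 1" "aligned S" by auto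
  have fin: "finite S" using S(1) finite_grid by (rule finite_subset)
  obtain u v J where J: "u \<in> S" "primitive v" "finite J" "0 \<in> J" "J \<subseteq> {0..}" "card J = card S"
     "S = (\<lambda>j. u + mul j v) ` J"
  proof -
    have "2 \<le> card S" using S assms by simp
    from aligned_param[OF S(3) fin this] show ?thesis using that by blast
  qed
  define G where "G = Max J"
  have G: "G \<in> J" using J unfolding G_def by (metis Max_in empty_iff)
  have Gmax: "j \<le> G" if "j \<in> J" for j using J that unfolding G_def by simp
  have "G \<noteq> 0"
  proof
    assume "G = 0"
    then have "J \<subseteq> {0}" using Gmax J by force
    then have "card J \<le> card {0::int}" by (rule card_mono[rotated]) simp
    then show False using J S assms by simp
  qed
  then have "1 \<le> G" using Gmax[OF J(4)] by simp
  then obtain g where g: "G = int g" "1 \<le> g" by (metis nat_0_le nat_le_eq_zle nat_one_as_int of_nat_1 of_nat_le_iff order_trans zero_le_one)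
  obtain u1 u2 u3 v1 v2 v3 where uv: "u = (u1, u2, u3)" "v = (v1, v2, v3)" by (metis surj_pair)
  have in1: "u \<in> grid m" "u + mul G v \<in> grid m" using S J G by auto
  have lt: "\<bar>int g * v1\<bar> < int m" "\<bar>int g * v2\<bar> < int m" "\<bar>int g * v3\<bar> < int m"
    using in1 unfolding g by (auto simp: grid_def mul_def uv)
  have bd: "\<bar>w\<bar> \<le> int (m div g)" if "\<bar>int g * w\<bar> < int m" for w
  proof -
    have "int g * \<bar>w\<bar> \<le> int m" using that by (simp add: abs_mult)
    then have "(int g * \<bar>w\<bar>) div int g \<le> int m div int g"
      using g by (intro zdiv_mono1) auto
    then have "\<bar>w\<bar> \<le> int m div int g" using g by simp
    then show ?thesis by (simp add: zdiv_int)
  qed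
  have vb: "v \<in> cube (m div g)"
    using bd[OF lt(1)] bd[OF lt(2)] bd[OF lt(3)] by (auto simp: uv cube_def)
  have "g \<le> m"
  proof -
    have "v1 \<noteq> 0 \<or> v2 \<noteq> 0 \<or> v3 \<noteq> 0" using primitive_nonzero[OF J(2)] by (auto simp: uv zero_prod_def)
    moreover have "int g \<le> \<bar>int g * w\<bar>" if "w \<noteq> 0" for w
    proof -
      have "1 \<le> \<bar>w\<bar>" using that by simp
      then show ?thesis by (simp add: abs_mult mult_le_cancel_left1)
    qed
    ultimately have "int g < int m" using lt by (meson le_less_trans)
    then show ?thesis by simp
  qed
  define K where "K = J - {0, int g}"
  have JK: "J = K \<union> {0, int g}" using J(4) G g by (auto simp: K_def)
  have "card K = card J - card {0, int g}"
    unfolding K_def using J(4) G g by (intro card_Diff_subset) auto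
  then have "card K = s - 1" using J S g by simp
  moreover have "K \<subseteq> {1..<int g}" using J(5) Gmax g unfolding K_def by force
  ultimately have "(u, v, K) \<in> grid m \<times> cube (m div g) \<times> {J. J \<subseteq> {1..<int g} \<and> card J = s - 1}"
    using vb in1(1) by simp
  moreover have "S = (\<lambda>(u, v, J). (\<lambda>j. u + mul j v) ` (J \<union> {0, int g})) (u, v, K)"
    using J(7) unfolding JK by simp
  ultimately show "S \<in> (\<Union>g\<in>{1..m}. (\<lambda>(u, v, J). (\<lambda>j. u + mul j v) ` (J \<union> {0, int g})) `
      (grid m \<times> cube (m div g) \<times> {J. J \<subseteq> {1..<int g} \<and> card J = s - 1}))"
    using g \<open>g \<le> m\<close> by (intro UN_I[of g] image_eqI[of _ _ "(u, v, K)"]) simp_all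
qed

lemma harmonic_le: "1 \<le> m \<Longrightarrow> (\<Sum>g=1..m. 1 / real g) \<le> 1 + ln m"
proof (induction m rule: dec_induct)
  case (step m)
  have "ln (real m / real (Suc m)) \<le> real m / real (Suc m) - 1"
    using step by (intro ln_le_minus_one) auto
  also have "\<dots> = - 1 / real (Suc m)" by (simp add: field_simps)
  finally have "1 / real (Suc m) \<le> ln (real (Suc m)) - ln (real m)" using step by (simp add: ln_div)
  then show ?case using step by simp
qed simp

text \<open>For fixed \<open>g\<close> there are \<open>m^3\<close> starting points, at most
  \<open>(3 * m / g)^3\<close> directions and at most \<open>g^(s-1) / fact (s-1)\<close> index
  sets. Since \<open>s \<ge> 3\<close>, the power \<open>g^(s-4)\<close> is at most
  \<open>m^(s-3) / g\<close>, and the sum over \<open>g\<close> costs only a logarithm.\<close>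

lemma card_aligned_subsets:
  assumes s: "3 \<le> s" and m: "1 \<le> m"
  shows "real (card {S. S \<subseteq> grid m \<and> card S = s + 1 \<and> aligned S})
    \<le> 27 * real m ^ (s + 3) * (1 + ln m) / fact (s - 1)"
proof -
  let ?N = "\<lambda>g. m ^ 3 * ((2 * (m div g) + 1) ^ 3 * (g choose (s - 1)))"
  have "card {S. S \<subseteq> grid m \<and> card S = s + 1 \<and> aligned S} \<le>
    card (\<Union>g\<in>{1..m}. (\<lambda>(u, v, J). (\<lambda>j. u + mul j v) ` (J \<union> {0, int g})) `
      (grid m \<times> cube (m div g) \<times> {J. J \<subseteq> {1..<int g} \<and> card J = s - 1}))"
    using s by (intro card_mono[OF _ aligned_subsets_cover]) (auto simp: cube_def)
  also have "\<dots> \<le> (\<Sum>g=1..m. card ((\<lambda>(u, v, J). (\<lambda>j. u + mul j v) ` (J \<union> {0, int g})) `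
      (grid m \<times> cube (m div g) \<times> {J. J \<subseteq> {1..<int g} \<and> card J = s - 1})))"
    by (rule card_UN_le) simp
  also have "\<dots> \<le> (\<Sum>g=1..m. ?N g)"
  proof (rule sum_mono)
    fix g assume g: "g \<in> {1..m}"
    have "card ((\<lambda>(u, v, J). (\<lambda>j. u + mul j v) ` (J \<union> {0, int g})) `
      (grid m \<times> cube (m div g) \<times> {J. J \<subseteq> {1..<int g} \<and> card J = s - 1}))
      \<le> card (grid m \<times> cube (m div g) \<times> {J. J \<subseteq> {1..<int g} \<and> card J = s - 1})"
      by (rule card_image_le) (auto simp: cube_def)
    also have "\<dots> = m ^ 3 * ((2 * (m div g) + 1) ^ 3 * ((g - 1) choose (s - 1)))"
      by (simp add: card_cartesian_product card_grid card_cube n_subsets nat_diff_distrib')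
    also have "\<dots> \<le> ?N g" by (intro mult_left_mono binomial_right_mono) auto
    finally show "card ((\<lambda>(u, v, J). (\<lambda>j. u + mul j v) ` (J \<union> {0, int g})) `
      (grid m \<times> cube (m div g) \<times> {J. J \<subseteq> {1..<int g} \<and> card J = s - 1})) \<le> ?N g" .
  qed
  finally have "real (card {S. S \<subseteq> grid m \<and> card S = s + 1 \<and> aligned S}) \<le> real (\<Sum>g=1..m. ?N g)"
    by (simp only: of_nat_le_iff)
  also have "\<dots> = (\<Sum>g=1..m. real (?N g))" by simp
  also have "\<dots> \<le> (\<Sum>g=1..m. 27 * real m ^ (s + 3) / fact (s - 1) * (1 / real g))"
  proof (rule sum_mono)
    fix g assume g: "g \<in> {1..m}"
    have "g * (2 * (m div g) + 1) \<le> 3 * m"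
    proof -
      have "g * (m div g) \<le> m" "g \<le> m" using g by auto
      moreover have "g * (2 * (m div g) + 1) = 2 * (g * (m div g)) + g" by (simp add: distrib_left)
      ultimately show ?thesis by linarith
    qed
    then have "real (g * (2 * (m div g) + 1)) \<le> real (3 * m)" by (simp only: of_nat_le_iff)
    then have "real g * real (2 * (m div g) + 1) \<le> 3 * real m" by (simp only: of_nat_mult of_nat_numeral)
    then have 1: "(real g * real (2 * (m div g) + 1)) ^ 3 \<le> (3 * real m) ^ 3"
      by (rule power_mono) simp
    have "(g choose (s - 1)) * fact (s - 1) \<le> g ^ (s - 1)" by (rule binomial_fact_pow)
    then have "real ((g choose (s - 1)) * fact (s - 1)) \<le> real (g ^ (s - 1))" by (simp only: of_nat_le_iff)
    then have 2: "real (g choose (s - 1)) * fact (s - 1) \<le> real g ^ (s - 1)" by simp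
    have "(real g) ^ (s - 3) \<le> real m ^ (s - 3)" using g by (intro power_mono) auto
    have "real (?N g) * (fact (s - 1) * real g * real g ^ 3)
        = real m ^ 3 * (real g * real (2 * (m div g) + 1)) ^ 3 * (real (g choose (s - 1)) * fact (s - 1)) * real g"
      by (simp add: power_mult_distrib)
    also have "\<dots> \<le> real m ^ 3 * (3 * real m) ^ 3 * real g ^ (s - 1) * real g"
      using 1 2 by (intro mult_mono) auto
    also have "\<dots> = 27 * real m ^ 6 * (real g ^ (s - 3) * real g ^ 3)"
    proof -
      have "real g ^ (s - 1) * real g = real g ^ (s - 3) * real g ^ 3"
        using s by (simp flip: power_add power_Suc2)
      then show ?thesis by (simp add: power_mult_distrib mult.assoc flip: power_add)
    qed
    also have "\<dots> \<le> 27 * real m ^ 6 * (real m ^ (s - 3) * real g ^ 3)"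
      using \<open>(real g) ^ (s - 3) \<le> _\<close> by (intro mult_left_mono mult_right_mono) auto
    also have "\<dots> = 27 * real m ^ (s + 3) * real g ^ 3"
      using s by (simp add: mult.assoc add.commute flip: power_add)
    finally have "real (?N g) * (fact (s - 1) * real g) * real g ^ 3 \<le> 27 * real m ^ (s + 3) * real g ^ 3"
      by (simp only: mult.assoc)
    then have "real (?N g) * (fact (s - 1) * real g) \<le> 27 * real m ^ (s + 3)"
      using g by (subst (asm) mult_le_cancel_right) auto
    then show "real (?N g) \<le> 27 * real m ^ (s + 3) / fact (s - 1) * (1 / real g)"
      using g by (simp add: pos_le_divide_eq)
  qed
  also have "\<dots> = 27 * real m ^ (s + 3) / fact (s - 1) * (\<Sum>g=1..m. 1 / real g)"
    by (simp only: sum_distrib_left)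
  also have "\<dots> \<le> 27 * real m ^ (s + 3) / fact (s - 1) * (1 + ln m)"
    using harmonic_le[OF m] by (intro mult_left_mono) auto
  finally show ?thesis by simp
qed

section \<open>Supersaturation and containers in the grid\<close>

text \<open>Positive coordinates exclude opposite vectors, so a line has at most one direction here,
  and stepping backwards decreases every coordinate.\<close>

definition directions :: "nat \<Rightarrow> pt set" where
  "directions t = {v \<in> {1..int t} \<times> {1..int t} \<times> {1..int t}. primitive v}"

lemma finite_directions [simp]: "finite (directions t)"
  by (simp add: directions_def)

text \<open>Telescoping, from \<open>1 / (t+1)^3 \<le> (1/t - 1/(t+1)) / 2\<close>.\<close>

lemma sum_inverse_cubes: "1 \<le> t \<Longrightarrow> (\<Sum>d=2..t. 1 / real d ^ 3) \<le> (1 - 1 / real t) / 2"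
proof (induction t rule: dec_induct)
  case (step t)
  have t: "1 \<le> real t" using step by simp
  have "1 / (real t + 1) ^ 3 \<le> 1 / (2 * (real t * (real t + 1)))"
  proof (rule divide_left_mono)
    have "2 * real t \<le> (real t + 1)^2" by (simp add: power2_eq_square algebra_simps)
    then have "2 * real t * (real t + 1) \<le> (real t + 1)^2 * (real t + 1)" by (rule mult_right_mono) simp
    then show "2 * (real t * (real t + 1)) \<le> (real t + 1) ^ 3" by (simp add: eval_nat_numeral algebra_simps)
  qed (use t in auto)
  also have "\<dots> = (1 / real t - 1 / (real t + 1)) / 2" using t by (simp add: field_simps)
  finally have "1 / real (Suc t) ^ 3 \<le> (1 / real t - 1 / real (Suc t)) / 2" by (simp add: add.commute)
  moreover have "(\<Sum>d=2..Suc t. 1 / real d ^ 3) = (\<Sum>d=2..t. 1 / real d ^ 3) + 1 / real (Suc t) ^ 3"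
    using step by simp
  ultimately show ?case using step.IH by (simp only: diff_divide_distrib)
qed simp

text \<open>Vectors with gcd \<open>d \<ge> 2\<close> are \<open>d\<close> times vectors of a box of
  side \<open>t div d\<close>; since the inverse cubes from 2 on sum to at most 1/2, they fill at
  most half of the box.\<close>

lemma card_directions_ge: "t ^ 3 \<le> 2 * card (directions t)"
proof (cases "t = 0")
  case False
  let ?C = "{1..int t} \<times> {1..int t} \<times> {1..int t}"
  let ?D = "\<lambda>d. {1..int (t div d)} \<times> {1..int (t div d)} \<times> {1..int (t div d)}"
  have card: "card ?C = t ^ 3" "card (?D d) = (t div d) ^ 3" for d
    by (simp_all add: card_cartesian_product power3_eq_cube)
  have "?C - directions t \<subseteq> (\<Union>d\<in>{2..t}. mul (int d) ` ?D d)"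
  proof
    fix v assume v: "v \<in> ?C - directions t"
    obtain a b c where abc: "v = (a, b, c)" by (metis surj_pair)
    define g where "g = gcd a (gcd b c)"
    have bd: "1 \<le> a" "a \<le> int t" "1 \<le> b" "b \<le> int t" "1 \<le> c" "c \<le> int t" and "g \<noteq> 1"
      using v by (auto simp: abc directions_def primitive_def g_def)
    have "0 \<le> g" "g \<noteq> 0" using bd by (auto simp: g_def)
    then have g2: "2 \<le> g" using \<open>g \<noteq> 1\<close> by linarith
    define d where "d = nat g"
    have d: "int d = g" "2 \<le> d" using g2 by (auto simp: d_def)
    have dv: "g dvd a" "g dvd b" "g dvd c" unfolding g_def by (auto intro: gcd_dvd2 dvd_trans)
    have "g \<le> a" using dv(1) bd by (simp add: zdvd_imp_le)
    then have "d \<le> t" using bd d by linarith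
    have q: "x div g \<in> {1..int (t div d)} \<and> g * (x div g) = x" if "g dvd x" "1 \<le> x" "x \<le> int t" for x
    proof -
      have "x div g \<le> int t div g" using that g2 by (intro zdiv_mono1) auto
      moreover have "g * (x div g) = x" using that by simp
      moreover have "0 < x div g" using calculation(2) that g2 zero_less_mult_iff[of g "x div g"] by simp
      ultimately show ?thesis using d by (simp add: zdiv_int)
    qed
    have "v = mul (int d) (a div g, b div g, c div g)"
      using q[OF dv(1)] q[OF dv(2)] q[OF dv(3)] bd d by (simp add: abc mul_def)
    moreover have "(a div g, b div g, c div g) \<in> ?D d"
      using q[OF dv(1)] q[OF dv(2)] q[OF dv(3)] bd by simp
    ultimately show "v \<in> (\<Union>d\<in>{2..t}. mul (int d) ` ?D d)"
      using d \<open>d \<le> t\<close> by (intro UN_I[of d] image_eqI) auto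
  qed
  then have "card (?C - directions t) \<le> card (\<Union>d\<in>{2..t}. mul (int d) ` ?D d)" by (intro card_mono) auto
  also have "\<dots> \<le> (\<Sum>d=2..t. card (mul (int d) ` ?D d))" by (rule card_UN_le) simp
  also have "\<dots> \<le> (\<Sum>d=2..t. (t div d) ^ 3)"
    by (intro sum_mono) (metis card(2) card_image_le finite_SigmaI finite_atLeastAtMost_int)
  finally have "real (card (?C - directions t)) \<le> real (\<Sum>d=2..t. (t div d) ^ 3)" by (simp only: of_nat_le_iff)
  also have "\<dots> = (\<Sum>d=2..t. real (t div d) ^ 3)" by simp
  also have "\<dots> \<le> (\<Sum>d=2..t. real t ^ 3 * (1 / real d ^ 3))"
  proof (rule sum_mono)
    fix d
    have "real (t div d) \<le> real t / real d" by (rule of_nat_div_le_of_nat)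
    then have "real (t div d) ^ 3 \<le> (real t / real d) ^ 3" by (rule power_mono) simp
    then show "real (t div d) ^ 3 \<le> real t ^ 3 * (1 / real d ^ 3)" by (simp add: power_divide)
  qed
  also have "\<dots> = real t ^ 3 * (\<Sum>d=2..t. 1 / real d ^ 3)" by (simp only: sum_distrib_left)
  also have "\<dots> \<le> real t ^ 3 * (1 / 2)"
  proof (rule mult_left_mono)
    have "(\<Sum>d=2..t. 1 / real d ^ 3) \<le> (1 - 1 / real t) / 2" using False by (intro sum_inverse_cubes) simp
    also have "\<dots> \<le> 1 / 2" by simp
    finally show "(\<Sum>d=2..t. 1 / real d ^ 3) \<le> 1 / 2" .
  qed simp
  finally have "2 * real (card (?C - directions t)) \<le> real (t ^ 3)" by simp
  then have "2 * card (?C - directions t) \<le> t ^ 3" by linarith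
  moreover have "card (?C - directions t) = card ?C - card (directions t)"
    by (rule card_Diff_subset) (auto simp: directions_def)
  ultimately show ?thesis unfolding card by linarith
qed simp

lemma disjoint_triples:
  assumes "finite l"
  shows "\<exists>T. (\<forall>e\<in>T. e \<subseteq> l \<and> card e = 3) \<and> (\<forall>e\<in>T. \<forall>g\<in>T. e \<noteq> g \<longrightarrow> e \<inter> g = {})
     \<and> card l \<le> 3 * card T + 2"
  using assms
proof (induction "card l" arbitrary: l rule: less_induct)
  case less
  show ?case
  proof (cases "card l \<le> 2")
    case True
    then show ?thesis by (intro exI[of _ "{}"]) auto
  next
    case False
    then have "3 \<le> card l" by simp
    then obtain e where e: "e \<subseteq> l" "card e = 3" by (metis obtain_subset_with_card_n)
    have fe: "finite e" using e(1) less.prems by (rule finite_subset)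
    have c: "card (l - e) = card l - 3" using e fe by (simp add: card_Diff_subset)
    then obtain T where T: "\<forall>g\<in>T. g \<subseteq> l - e \<and> card g = 3" "\<forall>g\<in>T. \<forall>h\<in>T. g \<noteq> h \<longrightarrow> g \<inter> h = {}"
      "card (l - e) \<le> 3 * card T + 2"
      using less.hyps[of "l - e"] less.prems False by auto
    have "finite T" by (rule finite_subset[of _ "Pow l"]) (use T less.prems in auto)
    moreover have "e \<notin> T" using T(1) e by (metis Diff_disjoint card.empty inf.absorb_iff2 le_iff_inf zero_neq_numeral)
    ultimately have "card (insert e T) = card T + 1" by simp
    then have "card l \<le> 3 * card (insert e T) + 2" using T(3) c False by simp
    moreover have "\<forall>g\<in>insert e T. g \<subseteq> l \<and> card g = 3" using T(1) e by auto
    moreover have "\<forall>g\<in>insert e T. \<forall>h\<in>insert e T. g \<noteq> h \<longrightarrow> g \<inter> h = {}" using T(1,2) by blast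
    ultimately show ?thesis by blast
  qed
qed

definition line :: "pt set \<Rightarrow> pt \<Rightarrow> pt \<Rightarrow> pt set" where
  "line A v x = {y\<in>A. \<exists>k. y = x + mul k v}"

lemma line_eq: "y = x + mul k v \<Longrightarrow> line A v x = line A v y"
proof -
  assume y: "y = x + mul k v"
  have "(\<exists>j. z = x + mul j v) \<longleftrightarrow> (\<exists>j. z = y + mul j v)" for z
  proof
    assume "\<exists>j. z = x + mul j v"
    then obtain j where "z = x + mul j v" ..
    then have "z = y + mul (j - k) v" by (simp add: y mul_diff)
    then show "\<exists>j. z = y + mul j v" ..
  next
    assume "\<exists>j. z = y + mul j v"
    then obtain j where "z = y + mul j v" ..
    then have "z = x + mul (k + j) v" by (simp add: y mul_add add.assoc)
    then show "\<exists>j. z = x + mul j v" ..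
  qed
  then show ?thesis by (simp add: line_def)
qed

text \<open>Walk backwards from a point until the next step would leave the grid. Some coordinate is
  then smaller than that of \<open>v\<close>, hence below \<open>t\<close>, so every line is
  represented in one of three slabs of size \<open>t * m^2\<close>.\<close>

lemma card_lines_le:
  assumes A: "A \<subseteq> grid m" and v: "v \<in> directions t"
  shows "card (line A v ` A) \<le> 3 * t * m\<^sup>2"
proof -
  obtain v1 v2 v3 where vv: "v = (v1, v2, v3)" by (metis surj_pair)
  have v1: "1 \<le> v1" "v1 \<le> int t" "1 \<le> v2" "v2 \<le> int t" "1 \<le> v3" "v3 \<le> int t"
    using v by (auto simp: directions_def vv)
  let ?M = "{0..<int m}" and ?T = "{0..<int t}"
  let ?B = "?T \<times> ?M \<times> ?M \<union> ?M \<times> ?T \<times> ?M \<union> ?M \<times> ?M \<times> ?T"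
  have start: "\<exists>b\<in>?B. line A v x = line A v b" if x: "x \<in> grid m" for x
  proof -
    obtain x1 x2 x3 where xx: "x = (x1, x2, x3)" by (metis surj_pair)
    let ?P = "\<lambda>k::nat. x - mul (int k) v \<in> grid m"
    have "?P 0" using x by simp
    moreover have "\<forall>k. ?P k \<longrightarrow> k \<le> nat x1"
    proof (intro allI impI)
      fix k assume "?P k"
      then have "int k * v1 \<le> x1" by (simp add: xx vv mul_def grid_def)
      moreover have "int k * 1 \<le> int k * v1" using v1 by (intro mult_left_mono) auto
      ultimately show "k \<le> nat x1" by linarith
    qed
    ultimately obtain k where k: "?P k" and kmax: "\<And>j. ?P j \<Longrightarrow> j \<le> k"
      using GreatestI_nat[of ?P 0 "nat x1"] Greatest_le_nat[of ?P _ "nat x1"] by blast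
    have "\<not> ?P (k + 1)" using kmax[of "k + 1"] by linarith
    moreover have "x - mul (int (k + 1)) v = (x - mul (int k) v) - v" by (simp add: mul_add algebra_simps)
    ultimately have "x - mul (int k) v \<in> ?B"
      using k v1 by (auto simp: grid_def xx vv mul_def)
    moreover have "line A v x = line A v (x - mul (int k) v)"
      by (rule line_eq[of _ _ "- int k"]) (use mul_diff[of 0 "int k" v] in simp)
    ultimately show ?thesis by (intro bexI[of _ "x - mul (int k) v"])
  qed
  have "line A v x \<in> line A v ` ?B" if "x \<in> A" for x
    using start[OF subsetD[OF A that]] by (simp only: image_iff)
  then have "line A v ` A \<subseteq> line A v ` ?B" by (rule image_subsetI)
  then have "card (line A v ` A) \<le> card (line A v ` ?B)" by (rule card_mono[rotated]) simp
  also have "\<dots> \<le> card ?B" by (rule card_image_le) simp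
  also have "\<dots> \<le> card (?T \<times> ?M \<times> ?M) + card (?M \<times> ?T \<times> ?M) + card (?M \<times> ?M \<times> ?T)"
    by (meson add_mono card_Un_le le_trans order_refl)
  also have "\<dots> = 3 * t * m\<^sup>2" by (simp add: card_cartesian_product power2_eq_square)
  finally show ?thesis .
qed

text \<open>Each line is cut into disjoint triples with at most two points left over. There are at
  most \<open>3 * t * m^2\<close> lines, so the hypothesis \<open>big\<close> keeps the leftovers
  within two thirds of \<open>A\<close>.\<close>

lemma direction_triples:
  assumes A: "A \<subseteq> grid m" and v: "v \<in> directions t" and big: "9 * t * m\<^sup>2 \<le> card A"
  shows "\<exists>T. (\<forall>e\<in>T. e \<subseteq> A \<and> card e = 3) \<and> (\<forall>e\<in>T. \<forall>g\<in>T. e \<noteq> g \<longrightarrow> e \<inter> g = {})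
     \<and> (\<forall>e\<in>T. \<forall>x\<in>e. \<forall>y\<in>e. \<exists>k. y = x + mul k v) \<and> card A \<le> 9 * card T"
proof -
  let ?L = "line A v ` A"
  have finA: "finite A" using A finite_grid by (rule finite_subset)
  have "\<exists>T. (\<forall>e\<in>T. e \<subseteq> l \<and> card e = 3) \<and> (\<forall>e\<in>T. \<forall>g\<in>T. e \<noteq> g \<longrightarrow> e \<inter> g = {})
     \<and> card l \<le> 3 * card T + 2" if "l \<in> ?L" for l
    by (rule disjoint_triples) (use that finA in \<open>auto simp: line_def\<close>)
  then obtain tr where tr: "\<And>l e. l \<in> ?L \<Longrightarrow> e \<in> tr l \<Longrightarrow> e \<subseteq> l \<and> card e = 3"
    "\<And>l e g. l \<in> ?L \<Longrightarrow> e \<in> tr l \<Longrightarrow> g \<in> tr l \<Longrightarrow> e \<noteq> g \<Longrightarrow> e \<inter> g = {}"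
    "\<And>l. l \<in> ?L \<Longrightarrow> card l \<le> 3 * card (tr l) + 2" by metis
  have disj: "l \<inter> l' = {}" if "l \<in> ?L" "l' \<in> ?L" "l \<noteq> l'" for l l'
  proof (rule ccontr)
    assume "l \<inter> l' \<noteq> {}"
    then obtain z where z: "z \<in> l" "z \<in> l'" by blast
    have "l = line A v z" if l: "l \<in> ?L" "z \<in> l" for l
    proof -
      obtain x where x: "l = line A v x" using l(1) by blast
      then obtain k where "z = x + mul k v" using l(2) by (auto simp: line_def)
      then show ?thesis unfolding x by (rule line_eq)
    qed
    then show False using z that by metis
  qed
  have self: "x \<in> line A v x" if "x \<in> A" for x
    using that by (simp add: line_def) (metis add.right_neutral mul_simps(1))
  let ?T = "\<Union>l\<in>?L. tr l"
  have finT: "finite (tr l)" if "l \<in> ?L" for l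
    by (rule finite_subset[of _ "Pow A"]) (use tr(1)[OF that] that finA in \<open>auto simp: line_def\<close>)
  have "card A = card (\<Union>l\<in>?L. l)"
    using self by (intro arg_cong[where f=card]) (auto simp: line_def)
  also have "\<dots> = (\<Sum>l\<in>?L. card l)"
    using finA disj by (intro card_UN_disjoint) (auto simp: line_def)
  also have "\<dots> \<le> (\<Sum>l\<in>?L. 3 * card (tr l) + 2)" by (intro sum_mono tr(3))
  also have "\<dots> = 3 * (\<Sum>l\<in>?L. card (tr l)) + 2 * card ?L"
    by (simp only: sum.distrib sum_distrib_left sum_constant) simp
  also have "(\<Sum>l\<in>?L. card (tr l)) = card ?T"
  proof (intro card_UN_disjoint[symmetric] ballI impI)
    fix l l' assume l: "l \<in> ?L" "l' \<in> ?L" "l \<noteq> l'"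
    show "tr l \<inter> tr l' = {}"
    proof (rule ccontr)
      assume "tr l \<inter> tr l' \<noteq> {}"
      then obtain e where "e \<subseteq> l" "e \<subseteq> l'" "card e = 3" using tr(1)[OF l(1)] tr(1)[OF l(2)] by blast
      then show False using disj[OF l] by (metis card.empty le_inf_iff subset_empty zero_neq_numeral)
    qed
  qed (use finA finT in auto)
  finally have "card A \<le> 3 * card ?T + 2 * card ?L" .
  moreover have "3 * card ?L \<le> 9 * t * m\<^sup>2" using card_lines_le[OF A v] by linarith
  ultimately have "card A \<le> 9 * card ?T" using big by linarith
  moreover have "\<forall>e\<in>?T. e \<subseteq> A \<and> card e = 3" 
  proof
    fix e assume "e \<in> ?T"
    then obtain x where x: "x \<in> A" "e \<in> tr (line A v x)" by blast
    then show "e \<subseteq> A \<and> card e = 3" using tr(1)[of "line A v x" e] by (auto simp: line_def)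
  qed
  moreover have "\<forall>e\<in>?T. \<forall>g\<in>?T. e \<noteq> g \<longrightarrow> e \<inter> g = {}"
  proof (intro ballI impI)
    fix e g assume "e \<in> ?T" "g \<in> ?T" and ne: "e \<noteq> g"
    then obtain l l' where l: "l \<in> ?L" "e \<in> tr l" "l' \<in> ?L" "g \<in> tr l'" by blast
    show "e \<inter> g = {}"
    proof (cases "l = l'")
      case True
      then show ?thesis using tr(2) l ne by blast
    next
      case False
      then show ?thesis using disj[of l l'] tr(1)[OF l(1,2)] tr(1)[OF l(3,4)] l by blast
    qed
  qed
  moreover have "\<forall>e\<in>?T. \<forall>x\<in>e. \<forall>y\<in>e. \<exists>k. y = x + mul k v"
  proof (intro ballI)
    fix e x y assume "e \<in> ?T" "x \<in> e" "y \<in> e"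
    then obtain l where "l \<in> ?L" "x \<in> l" "y \<in> l" using tr(1) by blast
    then obtain z i j where "x = z + mul i v" "y = z + mul j v" by (auto simp: line_def)
    then have "y = x + mul (j - i) v" by (simp add: mul_diff)
    then show "\<exists>k. y = x + mul k v" ..
  qed
  ultimately show ?thesis by blast
qed

text \<open>Parallel primitive vectors agree up to sign, and positivity fixes the sign.\<close>

lemma directions_unique:
  assumes "v \<in> directions t" "w \<in> directions t" "mul j v = mul k w" "j \<noteq> 0"
  shows "v = w"
proof -
  have pv: "primitive v" "primitive w" using assms by (auto simp: directions_def)
  obtain v1 v2 v3 w1 w2 w3 where vw: "v = (v1, v2, v3)" "w = (w1, w2, w3)" by (metis surj_pair)
  have e: "j * v1 = k * w1" "j * v2 = k * w2" "j * v3 = k * w3" using assms(3) by (auto simp: vw mul_def)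
  have cross: "a * d = c * b" if "j \<noteq> 0" "j * a = k * b" "j * c = k * d" for j k a b c d :: int
  proof -
    have "j * (a * d) = j * (c * b)" using that(2,3) by algebra
    then show ?thesis using that(1) by simp
  qed
  have "parallel v w"
    using cross[OF assms(4) e(2) e(3)] cross[OF assms(4) e(3) e(1)] cross[OF assms(4) e(1) e(2)]
    by (simp add: parallel_def vw)
  moreover have "parallel w v" using calculation by (auto simp: parallel_def mult.commute split: prod.splits)
  ultimately obtain a b where ab: "w = mul a v" "v = mul b w" using parallel_primitive pv by metis
  have "1 \<le> v1" "1 \<le> w1" using assms(1,2) by (auto simp: directions_def vw)
  moreover have e: "w1 = a * v1" "v1 = b * w1" using ab by (auto simp: vw mul_def)
  ultimately have "0 < a" "0 < b"
    using zero_less_mult_iff[of a v1] zero_less_mult_iff[of b w1] by linarith+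
  have "v1 = b * a * v1" using e by (metis mult.assoc)
  then have "b * a = 1" using \<open>1 \<le> v1\<close> by simp
  then have "a = 1" using \<open>a > 0\<close> \<open>b > 0\<close> by (simp add: pos_zmult_eq_1_iff)
  then show ?thesis using ab by simp
qed

definition alignment_free :: "pt set \<Rightarrow> bool" where
  "alignment_free I \<longleftrightarrow> (\<forall>S\<subseteq>I. card S = 3 \<longrightarrow> \<not> aligned S)"

text \<open>The 3-graph has, for each primitive direction of size at most \<open>\<tau>\<^sup>2\<close>, disjoint triples on the
  lines of that direction; it is linear because two points determine the direction.\<close>

lemma container_step:
  assumes A: "A \<subseteq> grid m" and lo: "9 * \<tau>\<^sup>2 * m\<^sup>2 \<le> card A" and hi: "card A \<le> 36 * \<tau>\<^sup>2 * m\<^sup>2"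
    and \<tau>: "27 \<le> \<tau>" and q: "1728 * m\<^sup>2 \<le> \<tau> * q"
  shows "\<exists>\<C>. finite \<C> \<and> card \<C> \<le> (m ^ 3 + 1) ^ (2 * q) \<and>
     (\<forall>C\<in>\<C>. C \<subseteq> A \<and> 384 * card C \<le> 383 * card A) \<and>
     (\<forall>I\<subseteq>A. alignment_free I \<longrightarrow> (\<exists>C\<in>\<C>. I \<subseteq> C))"
proof -
  let ?V = "directions (\<tau>\<^sup>2)"
  have finA: "finite A" using A finite_grid by (rule finite_subset)
  define Q where "Q v T \<longleftrightarrow> (\<forall>e\<in>T. e \<subseteq> A \<and> card e = 3) \<and> (\<forall>e\<in>T. \<forall>g\<in>T. e \<noteq> g \<longrightarrow> e \<inter> g = {})
     \<and> (\<forall>e\<in>T. \<forall>x\<in>e. \<forall>y\<in>e. \<exists>k. y = x + mul k v) \<and> card A \<le> 9 * card T" for v T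
  have "\<forall>v\<in>?V. \<exists>T. Q v T"
    unfolding Q_def using direction_triples[OF A _ lo] by (rule ballI)
  from bchoice[OF this] obtain T where TQ: "\<And>v. v \<in> ?V \<Longrightarrow> Q v (T v)" by blast
  have T1: "e \<subseteq> A \<and> card e = 3" if "v \<in> ?V" "e \<in> T v" for v e
    using TQ[OF that(1)] that(2) unfolding Q_def by simp
  have T2: "e \<inter> g = {}" if "v \<in> ?V" "e \<in> T v" "g \<in> T v" "e \<noteq> g" for v e g
    using TQ[OF that(1)] that(2-4) unfolding Q_def by simp
  have T3: "\<exists>k. y = x + mul k v" if "v \<in> ?V" "e \<in> T v" "x \<in> e" "y \<in> e" for v e x y
    using TQ[OF that(1)] that(2-4) unfolding Q_def by simp
  have T4: "card A \<le> 9 * card (T v)" if "v \<in> ?V" for v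
    using TQ[OF that] unfolding Q_def by simp
  define H where "H = (\<Union>v\<in>?V. T v)"
  have same: "v = w" if "v \<in> ?V" "w \<in> ?V" "e \<in> T v" "g \<in> T w" "a \<noteq> b" "{a, b} \<subseteq> e" "{a, b} \<subseteq> g" for v w e g a b
  proof -
    obtain j k where j: "b = a + mul j v" and k: "b = a + mul k w"
      using T3[of v e a b] T3[of w g a b] \<open>v \<in> ?V\<close> \<open>w \<in> ?V\<close> \<open>e \<in> T v\<close> \<open>g \<in> T w\<close> \<open>{a, b} \<subseteq> e\<close> \<open>{a, b} \<subseteq> g\<close> by blast
    have "mul j v = mul k w" using j k by (metis add_left_cancel)
    moreover have "j \<noteq> 0" using j \<open>a \<noteq> b\<close> by auto
    ultimately show ?thesis using directions_unique \<open>v \<in> ?V\<close> \<open>w \<in> ?V\<close> by blast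
  qed
  have finT: "finite (T v)" if "v \<in> ?V" for v
    by (rule finite_subset[of _ "Pow A"]) (use T1[OF that] finA in auto)
  have pair: "\<exists>a b. a \<noteq> b \<and> {a, b} \<subseteq> e" if "card e = 3" for e :: "pt set"
    using that unfolding card_3_iff by blast
  \<comment> \<open>\<open>card ?V\<close> is at least \<open>\<tau>^6 / 2\<close>. The cap
    \<open>\<tau>^3\<close>, of the order of its square root, balances the fingerprint lengths
    \<open>\<theta> * card A / D\<close> and \<open>card A / \<theta>\<close>.\<close>
  interpret linear_3graph A H "card ?V" "\<tau> ^ 3"
  proof
    show "finite A" by fact
    show "e \<subseteq> A \<and> card e = 3" if "e \<in> H" for e using that T1 unfolding H_def by blast
    show "e = g" if eg: "e \<in> H" "g \<in> H" and ab: "a \<noteq> b" "{a, b} \<subseteq> e" "{a, b} \<subseteq> g" for e g a b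
    proof -
      obtain v w where vw: "v \<in> ?V" "e \<in> T v" "w \<in> ?V" "g \<in> T w" using eg unfolding H_def by blast
      then have "v = w" using same[of v w e g a b] ab by blast
      then show ?thesis using T2[of v e g] vw ab by blast
    qed
    show "degr H u \<le> card ?V" if "u \<in> A" for u
    proof -
      have one: "card {e\<in>T v. u \<in> e} \<le> 1" if v: "v \<in> ?V" for v
      proof -
        have "e = g" if "e \<in> {e\<in>T v. u \<in> e}" "g \<in> {e\<in>T v. u \<in> e}" for e g
          using T2[OF v, of e g] that by blast
        then show ?thesis using card_le_Suc0_iff_eq[of "{e\<in>T v. u \<in> e}"] finT[OF v] by simp
      qed
      have "{e\<in>H. u \<in> e} = (\<Union>v\<in>?V. {e\<in>T v. u \<in> e})" unfolding H_def by blast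
      then have "degr H u \<le> (\<Sum>v\<in>?V. card {e\<in>T v. u \<in> e})"
        unfolding degr_def by (simp add: card_UN_le)
      also have "\<dots> \<le> (\<Sum>v\<in>?V. 1)" by (intro sum_mono one)
      finally show ?thesis by simp
    qed
    show "card ?V * card A \<le> 9 * card H"
    proof -
      have "card ?V * card A \<le> (\<Sum>v\<in>?V. 9 * card (T v))"
        using sum_mono[of ?V "\<lambda>_. card A" "\<lambda>v. 9 * card (T v)"] T4 by simp
      also have "\<dots> = 9 * (\<Sum>v\<in>?V. card (T v))" by (simp add: sum_distrib_left)
      also have "(\<Sum>v\<in>?V. card (T v)) = card H"
        unfolding H_def
      proof (intro card_UN_disjoint[symmetric] ballI impI)
        fix v w assume vw: "v \<in> ?V" "w \<in> ?V" "v \<noteq> w"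
        show "T v \<inter> T w = {}"
        proof (rule ccontr)
          assume "T v \<inter> T w \<noteq> {}"
          then obtain e where e: "e \<in> T v" "e \<in> T w" by blast
          then obtain a b where "a \<noteq> b" "{a, b} \<subseteq> e" using pair T1[OF vw(1)] by blast
          then show False using same[OF vw(1,2) e] vw(3) by blast
        qed
      qed (use finT in auto)
      finally show ?thesis .
    qed
    \<comment> \<open>The bound \<open>27 \<le> \<tau>\<close> is chosen for this:
      \<open>27^3 = 19683\<close> exceeds both 18432 and \<open>576 = 2 * 288\<close>.\<close>
    have \<tau>3: "19683 \<le> \<tau> ^ 3" using power_mono[OF \<tau>, of 3] by simp
    then show "18432 \<le> \<tau> ^ 3" by linarith
    have "576 * \<tau> ^ 3 \<le> \<tau> ^ 3 * \<tau> ^ 3" using \<tau>3 by (intro mult_right_mono) auto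
    also have "\<tau> ^ 3 * \<tau> ^ 3 = (\<tau>\<^sup>2) ^ 3" by (simp flip: power_add power_mult)
    also have "\<dots> \<le> 2 * card ?V" by (rule card_directions_ge)
    finally show "288 * \<tau> ^ 3 \<le> card ?V" by linarith
  qed
  have "48 * card A \<le> \<tau>\<^sup>2 * (1728 * m\<^sup>2)" using hi by linarith
  also have "\<dots> \<le> \<tau>\<^sup>2 * (\<tau> * q)" using q by (rule mult_left_mono) simp
  also have "\<dots> = \<tau> ^ 3 * q" by (simp add: eval_nat_numeral)
  finally have q2: "48 * card A \<le> \<tau> ^ 3 * q" .
  have "12 * \<tau> ^ 3 * card A * 2 \<le> \<tau> ^ 3 * (48 * card A)" by simp
  also have "\<dots> \<le> \<tau> ^ 3 * (\<tau> ^ 3 * q)" using q2 by (rule mult_left_mono) simp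
  also have "\<dots> = (\<tau>\<^sup>2) ^ 3 * q" by (simp flip: power_add power_mult mult.assoc)
  also have "\<dots> \<le> 2 * card ?V * q" using card_directions_ge by (rule mult_right_mono) simp
  finally have q1: "12 * \<tau> ^ 3 * card A \<le> card ?V * q" by linarith
  obtain \<C> where \<C>: "finite \<C>" "card \<C> \<le> (card A + 1) ^ (2 * q)"
     "\<forall>C\<in>\<C>. C \<subseteq> A \<and> 384 * card C \<le> 383 * card A"
     "\<forall>I\<subseteq>A. (\<forall>e\<in>H. \<not> e \<subseteq> I) \<longrightarrow> (\<exists>C\<in>\<C>. I \<subseteq> C)"
    using containers[OF q1 q2] by blast
  have "card A \<le> m ^ 3" using A card_mono[OF finite_grid] by (metis card_grid)
  then have "(card A + 1) ^ (2 * q) \<le> (m ^ 3 + 1) ^ (2 * q)" by (intro power_mono) auto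
  then have "card \<C> \<le> (m ^ 3 + 1) ^ (2 * q)" using \<C>(2) by linarith
  moreover have "\<forall>I\<subseteq>A. alignment_free I \<longrightarrow> (\<exists>C\<in>\<C>. I \<subseteq> C)"
  proof (intro allI impI)
    fix I assume I: "I \<subseteq> A" "alignment_free I"
    have "aligned e \<and> card e = 3" if eH: "e \<in> H" for e
    proof -
      obtain v where v: "v \<in> ?V" "e \<in> T v" using eH unfolding H_def by blast
      have "parallel (y - x) (z - x)" if "x \<in> e" "y \<in> e" "z \<in> e" for x y z
      proof -
        from T3[OF v \<open>x \<in> e\<close> \<open>y \<in> e\<close>] T3[OF v \<open>x \<in> e\<close> \<open>z \<in> e\<close>]
        obtain j k where "y = x + mul j v" "z = x + mul k v" by blast
        then show ?thesis by (simp add: parallel_mul)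
      qed
      then show ?thesis using T1[OF v] by (simp add: aligned_def)
    qed
    then have "\<forall>e\<in>H. \<not> e \<subseteq> I" using I(2) unfolding alignment_free_def by blast
    then show "\<exists>C\<in>\<C>. I \<subseteq> C" using \<C>(4) I(1) by blast
  qed
  ultimately show ?thesis using \<C>(1,3) by blast
qed

text \<open>\<open>container_step\<close> is iterated, each round shrinking containers by 383/384.
  Larger sets allow a larger \<open>\<tau>\<close>, so the fingerprint length \<open>q\<close>
  needed for the final size serves all rounds.\<close>

lemma grid_containers:
  assumes m: "1 \<le> m" and \<tau>: "27 \<le> \<tau>" and q: "1728 * m\<^sup>2 \<le> \<tau> * q"
  shows "A \<subseteq> grid m \<Longrightarrow> 383 ^ j * card A \<le> 384 ^ j * (9 * \<tau>\<^sup>2 * m\<^sup>2) \<Longrightarrow>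
    \<exists>\<C>. finite \<C> \<and> card \<C> \<le> (m ^ 3 + 1) ^ (2 * q * j) \<and>
     (\<forall>C\<in>\<C>. C \<subseteq> A \<and> card C \<le> 9 * \<tau>\<^sup>2 * m\<^sup>2) \<and>
     (\<forall>I\<subseteq>A. alignment_free I \<longrightarrow> (\<exists>C\<in>\<C>. I \<subseteq> C))"
proof (induction j arbitrary: A)
  case 0
  then show ?case by (intro exI[of _ "{A}"]) auto
next
  case (Suc j)
  have finA: "finite A" using Suc.prems(1) finite_grid by (rule finite_subset)
  show ?case
  proof (cases "card A \<le> 9 * \<tau>\<^sup>2 * m\<^sup>2")
    case True
    then show ?thesis by (intro exI[of _ "{A}"]) auto
  next
    case False
    \<comment> \<open>The greatest such \<open>\<sigma>\<close> is the scale of the current set: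
      maximality and \<open>\<sigma> + 1 \<le> 2 * \<sigma>\<close> give the upper bound
      \<open>36 * \<sigma>^2 * m^2\<close> that \<open>container_step\<close> expects.\<close>
    let ?P = "\<lambda>\<sigma>. 9 * \<sigma>\<^sup>2 * m\<^sup>2 \<le> card A"
    have "?P \<tau>" using False by simp
    moreover have bd: "\<forall>\<sigma>. ?P \<sigma> \<longrightarrow> \<sigma> \<le> card A"
    proof (intro allI impI)
      fix \<sigma> assume "?P \<sigma>"
      have "\<sigma> \<le> \<sigma>\<^sup>2" by (simp add: power2_eq_square)
      moreover have "\<sigma>\<^sup>2 * 1 \<le> \<sigma>\<^sup>2 * m\<^sup>2" using m by (intro mult_left_mono) auto
      moreover have "9 * \<sigma>\<^sup>2 * m\<^sup>2 = 9 * (\<sigma>\<^sup>2 * m\<^sup>2)" by simp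
      ultimately show "\<sigma> \<le> card A" using \<open>?P \<sigma>\<close> by linarith
    qed
    ultimately obtain \<sigma> where \<sigma>: "?P \<sigma>" and max: "\<And>r. ?P r \<Longrightarrow> r \<le> \<sigma>"
      using GreatestI_nat[of ?P \<tau> "card A"] Greatest_le_nat[of ?P _ "card A"] by blast
    have \<tau>\<sigma>: "\<tau> \<le> \<sigma>" using max \<open>?P \<tau>\<close> by blast
    have "\<not> ?P (\<sigma> + 1)" using max[of "\<sigma> + 1"] by linarith
    then have "card A \<le> 9 * (\<sigma> + 1)\<^sup>2 * m\<^sup>2" by simp
    also have "\<dots> \<le> 9 * (2 * \<sigma>)\<^sup>2 * m\<^sup>2"
      using \<tau> \<tau>\<sigma> by (intro mult_mono power_mono) auto
    also have "\<dots> = 36 * \<sigma>\<^sup>2 * m\<^sup>2" by (simp add: power_mult_distrib)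
    finally have hi: "card A \<le> 36 * \<sigma>\<^sup>2 * m\<^sup>2" .
    have "\<tau> * q \<le> \<sigma> * q" using \<tau>\<sigma> by simp
    then have q': "1728 * m\<^sup>2 \<le> \<sigma> * q" using q by linarith
    have "27 \<le> \<sigma>" using \<tau> \<tau>\<sigma> by linarith
    from container_step[OF Suc.prems(1) \<sigma> hi this q'] obtain \<D> where \<D>: "finite \<D>"
      "card \<D> \<le> (m ^ 3 + 1) ^ (2 * q)" "\<forall>C\<in>\<D>. C \<subseteq> A \<and> 384 * card C \<le> 383 * card A"
      "\<forall>I\<subseteq>A. alignment_free I \<longrightarrow> (\<exists>C\<in>\<D>. I \<subseteq> C)" by blast
    define R where "R B \<C> \<longleftrightarrow> finite \<C> \<and> card \<C> \<le> (m ^ 3 + 1) ^ (2 * q * j) \<and>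
       (\<forall>C\<in>\<C>. C \<subseteq> B \<and> card C \<le> 9 * \<tau>\<^sup>2 * m\<^sup>2) \<and>
       (\<forall>I\<subseteq>B. alignment_free I \<longrightarrow> (\<exists>C\<in>\<C>. I \<subseteq> C))" for B \<C>
    have "\<exists>\<C>. R B \<C>" if B: "B \<in> \<D>" for B
      unfolding R_def
    proof (rule Suc.IH)
      show "B \<subseteq> grid m" using \<D>(3) B Suc.prems(1) by blast
      have "384 * card B \<le> 383 * card A" using \<D>(3) B by blast
      then have "383 ^ j * (384 * card B) \<le> 383 ^ j * (383 * card A)" by (rule mult_left_mono) simp
      also have "\<dots> = 383 ^ Suc j * card A" by simp
      also have "\<dots> \<le> 384 ^ Suc j * (9 * \<tau>\<^sup>2 * m\<^sup>2)" by (rule Suc.prems(2))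
      finally have "384 * (383 ^ j * card B) \<le> 384 * (384 ^ j * (9 * \<tau>\<^sup>2 * m\<^sup>2))"
        by (simp only: power_Suc mult.assoc mult.left_commute)
      then show "383 ^ j * card B \<le> 384 ^ j * (9 * \<tau>\<^sup>2 * m\<^sup>2)" by (rule nat_mult_le_cancel1[THEN iffD1, rotated]) simp
    qed
    then have "\<forall>B\<in>\<D>. \<exists>\<C>. R B \<C>" by blast
    from bchoice[OF this] obtain F where FR: "\<forall>B\<in>\<D>. R B (F B)" by blast
    have F: "finite (F B) \<and> card (F B) \<le> (m ^ 3 + 1) ^ (2 * q * j) \<and>
       (\<forall>C\<in>F B. C \<subseteq> B \<and> card C \<le> 9 * \<tau>\<^sup>2 * m\<^sup>2) \<and>
       (\<forall>I\<subseteq>B. alignment_free I \<longrightarrow> (\<exists>C\<in>F B. I \<subseteq> C))" if "B \<in> \<D>" for B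
      using bspec[OF FR that] unfolding R_def .
    let ?\<C> = "\<Union>B\<in>\<D>. F B"
    have "card ?\<C> \<le> (\<Sum>B\<in>\<D>. card (F B))" using \<D>(1) by (rule card_UN_le)
    also have "\<dots> \<le> (\<Sum>B\<in>\<D>. (m ^ 3 + 1) ^ (2 * q * j))" using F by (intro sum_mono) blast
    also have "\<dots> = card \<D> * (m ^ 3 + 1) ^ (2 * q * j)" by simp
    also have "\<dots> \<le> (m ^ 3 + 1) ^ (2 * q) * (m ^ 3 + 1) ^ (2 * q * j)"
      using \<D>(2) by (rule mult_right_mono) simp
    also have "\<dots> = (m ^ 3 + 1) ^ (2 * q * Suc j)" by (simp add: power_add)
    finally have "card ?\<C> \<le> (m ^ 3 + 1) ^ (2 * q * Suc j)" .
    moreover have "finite ?\<C>" using \<D>(1) F by blast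
    moreover have "\<forall>C\<in>?\<C>. C \<subseteq> A \<and> card C \<le> 9 * \<tau>\<^sup>2 * m\<^sup>2" 
    proof
      fix C assume "C \<in> ?\<C>"
      then obtain B where "B \<in> \<D>" "C \<in> F B" by blast
      then have "C \<subseteq> B" "B \<subseteq> A" "card C \<le> 9 * \<tau>\<^sup>2 * m\<^sup>2" using F \<D>(3) by auto
      then show "C \<subseteq> A \<and> card C \<le> 9 * \<tau>\<^sup>2 * m\<^sup>2" by blast
    qed
    moreover have "\<forall>I\<subseteq>A. alignment_free I \<longrightarrow> (\<exists>C\<in>?\<C>. I \<subseteq> C)"
    proof (intro allI impI)
      fix I assume I: "I \<subseteq> A" "alignment_free I"
      then obtain B where B: "B \<in> \<D>" "I \<subseteq> B" using \<D>(4) by blast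
      then obtain C where "C \<in> F B" "I \<subseteq> C" using F[OF B(1)] I(2) by blast
      then show "\<exists>C\<in>?\<C>. I \<subseteq> C" using B(1) by blast
    qed
    ultimately show ?thesis by (intro exI[of _ ?\<C>] conjI)
  qed
qed

section \<open>Generic projection to the plane\<close>

definition proj :: "int \<Rightarrow> pt \<Rightarrow> real ^ 2" where
  "proj L p = (case p of (x, y, z) \<Rightarrow> vector [real_of_int (x + L * z), real_of_int (y + L\<^sup>2 * z)])"

lemma proj_nth [simp]:
  "proj L (x, y, z) $ 1 = real_of_int (x + L * z)" "proj L (x, y, z) $ 2 = real_of_int (y + L\<^sup>2 * z)"
  by (simp_all add: proj_def)

lemma small_multiple: "\<bar>a\<bar> < L \<Longrightarrow> a = L * k \<Longrightarrow> k = 0" for a L k :: int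
proof (rule ccontr)
  assume *: "\<bar>a\<bar> < L" "a = L * k" "k \<noteq> 0"
  then have "L * 1 \<le> L * \<bar>k\<bar>" by (intro mult_left_mono) auto
  moreover have "0 < L" using *(1) by linarith
  ultimately show False using * by (simp add: abs_mult)
qed

lemma grid_diff_bound: "u \<in> grid m \<Longrightarrow> v \<in> grid m \<Longrightarrow> v - u = (a, b, c) \<Longrightarrow>
    \<bar>a\<bar> \<le> int m \<and> \<bar>b\<bar> \<le> int m \<and> \<bar>c\<bar> \<le> int m"
  by (cases u; cases v) (auto simp: grid_def)

text \<open>The determinant of the projected vectors is \<open>c3 - L * (c1 + L * c2)\<close>, where
  the \<open>ci\<close> are the cross product components. All of them are smaller than
  \<open>L\<close> in absolute value, so it vanishes only if each does, as in an expansion to base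
  \<open>L\<close>.\<close>

lemma collinear_proj:
  assumes "u \<in> grid m" "v \<in> grid m" "w \<in> grid m" and L: "2 * (int m)\<^sup>2 < L"
  shows "collinear {proj L u, proj L v, proj L w} \<longleftrightarrow> parallel (v - u) (w - u)"
proof -
  obtain u1 u2 u3 v1 v2 v3 w1 w2 w3 where uvw: "u = (u1, u2, u3)" "v = (v1, v2, v3)" "w = (w1, w2, w3)"
    by (metis surj_pair)
  define a1 a2 a3 b1 b2 b3 where ab: "a1 = v1 - u1" "a2 = v2 - u2" "a3 = v3 - u3"
    "b1 = w1 - u1" "b2 = w2 - u2" "b3 = w3 - u3"
  have a: "v - u = (a1, a2, a3)" and b: "w - u = (b1, b2, b3)" by (simp_all add: uvw ab)
  have bd: "\<bar>a1\<bar> \<le> int m" "\<bar>a2\<bar> \<le> int m" "\<bar>a3\<bar> \<le> int m" "\<bar>b1\<bar> \<le> int m" "\<bar>b2\<bar> \<le> int m" "\<bar>b3\<bar> \<le> int m"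
    using grid_diff_bound[OF assms(1,2) a] grid_diff_bound[OF assms(1,3) b] by auto
  have sm: "\<bar>p * q - p' * q'\<bar> < L" if "\<bar>p\<bar> \<le> int m" "\<bar>q\<bar> \<le> int m" "\<bar>p'\<bar> \<le> int m" "\<bar>q'\<bar> \<le> int m" for p q p' q'
  proof -
    have "\<bar>p * q\<bar> \<le> int m * int m" "\<bar>p' * q'\<bar> \<le> int m * int m"
      unfolding abs_mult using that by (auto intro!: mult_mono)
    then show ?thesis using L by (simp add: power2_eq_square)
  qed
  define c1 c2 c3 where c: "c1 = a2 * b3 - a3 * b2" "c2 = a3 * b1 - a1 * b3" "c3 = a1 * b2 - a2 * b1"
  have small: "\<bar>c1\<bar> < L" "\<bar>c2\<bar> < L" "\<bar>c3\<bar> < L" unfolding c using bd by (auto intro!: sm)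
  have "collinear {proj L u, proj L v, proj L w} \<longleftrightarrow>
    real_of_int ((a1 + L * a3) * (b2 + L\<^sup>2 * b3)) = real_of_int ((b1 + L * b3) * (a2 + L\<^sup>2 * a3))"
    unfolding collinear_3_det by (simp add: uvw ab algebra_simps)
  also have "\<dots> \<longleftrightarrow> (a1 + L * a3) * (b2 + L\<^sup>2 * b3) = (b1 + L * b3) * (a2 + L\<^sup>2 * a3)" by (simp only: of_int_eq_iff)
  also have "\<dots> \<longleftrightarrow> c3 = L * (c1 + L * c2)"
    unfolding c by (simp add: algebra_simps power2_eq_square)
  also have "\<dots> \<longleftrightarrow> c1 = 0 \<and> c2 = 0 \<and> c3 = 0"
  proof
    assume e: "c3 = L * (c1 + L * c2)"
    then have 1: "c1 + L * c2 = 0" using small_multiple small by blast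
    then have "c1 = L * (- c2)" by simp
    then have "- c2 = 0" using small_multiple small by blast
    then show "c1 = 0 \<and> c2 = 0 \<and> c3 = 0" using 1 e by simp
  qed simp
  also have "\<dots> \<longleftrightarrow> parallel (v - u) (w - u)" unfolding a b c parallel_def by auto
  finally show ?thesis .
qed

lemma inj_proj:
  assumes L: "2 * (int m)\<^sup>2 < L"
  shows "inj_on (proj L) (grid m)"
proof (rule inj_onI)
  fix u v assume uv: "u \<in> grid m" "v \<in> grid m" "proj L u = proj L v"
  obtain u1 u2 u3 v1 v2 v3 where c: "u = (u1, u2, u3)" "v = (v1, v2, v3)" by (metis surj_pair)
  have "real_of_int (u1 + L * u3) = real_of_int (v1 + L * v3)"
    "real_of_int (u2 + L\<^sup>2 * u3) = real_of_int (v2 + L\<^sup>2 * v3)"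
    using uv(3) unfolding c by (metis proj_nth)+
  then have e: "u1 + L * u3 = v1 + L * v3" "u2 + L\<^sup>2 * u3 = v2 + L\<^sup>2 * v3" by (simp_all only: of_int_eq_iff)
  have m: "0 < m" using uv(1) by (auto simp: c grid_def)
  have "int m * 1 \<le> int m * int m" using m by (intro mult_left_mono) auto
  then have "int m < L" using L by (simp add: power2_eq_square)
  then have "\<bar>u1 - v1\<bar> < L" using uv(1,2) by (auto simp: c grid_def)
  moreover have "u1 - v1 = L * (v3 - u3)" using e(1) by (simp add: algebra_simps)
  ultimately have "v3 - u3 = 0" using small_multiple by blast
  then show "u = v" using e by (simp add: c)
qed

lemma f_le_of_grid:
  assumes s: "2 \<le> s" and A: "A \<subseteq> grid m" "card A = n"
    and lines: "\<And>S. S \<subseteq> A \<Longrightarrow> card S = s + 1 \<Longrightarrow> \<not> aligned S"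
    and small: "\<And>I. I \<subseteq> A \<Longrightarrow> alignment_free I \<Longrightarrow> card I \<le> k"
  shows "f n s \<le> k"
proof -
  define L where "L = 2 * (int m)\<^sup>2 + 1"
  have L: "2 * (int m)\<^sup>2 < L" by (simp add: L_def)
  have inj: "inj_on (proj L) A" using inj_proj[OF L] A(1) by (rule inj_on_subset)
  have finA: "finite A" using A(1) finite_grid by (rule finite_subset)
  have pull: "\<exists>S\<subseteq>A. proj L ` S = Q \<and> card S = card Q" if Q: "Q \<subseteq> proj L ` A" for Q
  proof -
    obtain S where S: "S \<subseteq> A" "Q = proj L ` S" using Q unfolding subset_image_iff by blast
    then show ?thesis using card_image[OF inj_on_subset[OF inj S(1)]] by metis
  qed
  have "no_collinear (s + 1) (proj L ` A)"
    unfolding no_collinear_def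
  proof (intro allI impI notI)
    fix Q assume Q: "Q \<subseteq> proj L ` A \<and> card Q = s + 1" and col: "collinear Q"
    from pull[OF conjunct1[OF Q]] obtain S where S: "S \<subseteq> A" "proj L ` S = Q" "card S = card Q"
      by (elim exE conjE)
    have "aligned S"
      unfolding aligned_def
    proof (intro ballI)
      fix u v w assume uvw: "u \<in> S" "v \<in> S" "w \<in> S"
      have "{proj L u, proj L v, proj L w} \<subseteq> Q" using uvw S(2) by blast
      then have "collinear {proj L u, proj L v, proj L w}" using col by (rule collinear_subset[rotated])
      then show "parallel (v - u) (w - u)" using collinear_proj[OF _ _ _ L] uvw S(1) A(1) by blast
    qed
    then show False using lines[OF S(1)] S(3) Q by simp
  qed
  moreover have "finite (proj L ` A)" "card (proj L ` A) = n" using finA A(2) card_image[OF inj] by auto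
  ultimately obtain Q where Q: "Q \<subseteq> proj L ` A" "card Q = f n s" "general_position Q"
    using f_is_greatest(1)[OF s, of n] unfolding forces_general_position_def by blast
  then obtain I where I: "I \<subseteq> A" "proj L ` I = Q" "card I = card Q" using pull by blast
  have "alignment_free I"
    unfolding alignment_free_def
  proof (intro allI impI notI)
    fix S assume S: "S \<subseteq> I" "card S = 3" and al: "aligned S"
    obtain u v w where uvw: "S = {u, v, w}" using S(2) unfolding card_3_iff by blast
    have "parallel (v - u) (w - u)" using al unfolding aligned_def uvw by blast
    then have "collinear {proj L u, proj L v, proj L w}"
      using collinear_proj[OF _ _ _ L, of u v w] S(1) I(1) A(1) unfolding uvw by blast
    moreover have "{proj L u, proj L v, proj L w} = proj L ` S" unfolding uvw by simp
    moreover have "card (proj L ` S) = 3"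
      using card_image[OF inj_on_subset[OF inj]] S I(1) by (metis subset_trans)
    moreover have "proj L ` S \<subseteq> Q" using S(1) I(2) by blast
    ultimately show False using Q(3) unfolding general_position_def no_collinear_def by metis
  qed
  then show ?thesis using small[OF I(1)] I(3) Q(2) by simp
qed

section \<open>Sets covered by few lines\<close>

lemma card_le_fibres:
  assumes "finite I" "\<And>b. card {x\<in>I. g x = b} \<le> c"
  shows "card I \<le> c * card (g ` I)"
proof -
  have "card I \<le> card (\<Union>b\<in>g ` I. {x\<in>I. g x = b})" by (rule card_mono) (use assms(1) in auto)
  also have "\<dots> \<le> (\<Sum>b\<in>g ` I. card {x\<in>I. g x = b})" by (rule card_UN_le) (use assms(1) in simp)
  also have "\<dots> \<le> (\<Sum>b\<in>g ` I. c)" by (intro sum_mono assms(2))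
  finally show ?thesis by (simp add: mult.commute)
qed

lemma parallel_axis: "parallel (a, 0, 0) (b, 0, 0)"
  by (simp add: parallel_def)

lemma f_le_rows:
  assumes s: "2 \<le> s" and n: "n \<le> s ^ 3"
  shows "f n s \<le> 2 * (n div s + 1)"
proof -
  \<comment> \<open>The digits of \<open>i\<close> to base \<open>s\<close> enumerate the cube row
    by row, so the first \<open>n\<close> points use at most \<open>n div s + 1\<close>
    rows.\<close>
  define row where "row j = (int (j mod s), int (j div s))" for j
  define p where "p i = (int (i mod s), row (i div s))" for i
  have inj: "inj_on p {..<n}"
  proof (rule inj_onI)
    fix i j assume "p i = p j"
    then have "i mod s = j mod s" "i div s mod s = j div s mod s" "i div s div s = j div s div s"
      by (simp_all add: p_def row_def)
    then show "i = j" by (metis div_mult_mod_eq)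
  qed
  have sub: "p ` {..<n} \<subseteq> grid s"
  proof
    fix x assume "x \<in> p ` {..<n}"
    then obtain i where i: "x = p i" "i < n" by auto
    have "i < s * s * s" using i n by (simp add: power3_eq_cube)
    then have "i div s div s < s"
      by (simp add: less_mult_imp_div_less)
    then show "x \<in> grid s" using s by (simp add: i p_def row_def grid_def)
  qed
  show ?thesis
  proof (rule f_le_of_grid[OF s sub])
    show "card (p ` {..<n}) = n" using card_image[OF inj] by simp
    show "\<not> aligned S" if "S \<subseteq> p ` {..<n}" "card S = s + 1" for S
      using aligned_grid_card_le[of S s] that sub s by auto
    fix I assume I: "I \<subseteq> p ` {..<n}" "alignment_free I"
    have finI: "finite I" using I(1) by (rule finite_subset) simp
    have "card {x\<in>I. snd x = b} \<le> 2" for b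
    proof (rule ccontr)
      assume "\<not> ?thesis"
      then have "3 \<le> card {x\<in>I. snd x = b}" by simp
      from obtain_subset_with_card_n[OF this]
      obtain S where S: "S \<subseteq> {x\<in>I. snd x = b}" "card S = 3" .
      have "aligned S"
        unfolding aligned_def
      proof (intro ballI)
        fix u v w assume "u \<in> S" "v \<in> S" "w \<in> S"
        then have "snd u = b" "snd v = b" "snd w = b" using S(1) by auto
        then have "v - u = (fst (v - u), 0, 0)" "w - u = (fst (w - u), 0, 0)"
          by (simp_all add: prod_eq_iff)
        then show "parallel (v - u) (w - u)" by (metis (no_types) parallel_axis)
      qed
      then show False using I(2) S unfolding alignment_free_def by blast
    qed
    then have "card I \<le> 2 * card (snd ` I)" by (rule card_le_fibres[OF finI])
    also have "snd ` I \<subseteq> row ` {..n div s}"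
      using I(1) by (auto simp: p_def div_le_mono)
    then have "card (snd ` I) \<le> card {..n div s}"
      by (meson card_image_le card_mono finite_atMost finite_imageI le_trans)
    finally show "card I \<le> 2 * (n div s + 1)" by simp
  qed
qed

section \<open>Random subsets of the grid\<close>

text \<open>\<open>colour_and_delete\<close> for two families: aligned sets of \<open>s + 1\<close>
  points, repaired by deletion, and all \<open>k\<close>-subsets of containers, avoided outright. An
  alignment-free set with more than \<open>k\<close> points would contain one of the latter.\<close>

lemma random_grid:
  assumes m: "1 \<le> m" and s: "3 \<le> s" and \<tau>: "27 \<le> \<tau>" and q: "1728 * m\<^sup>2 \<le> \<tau> * q"
    and j: "383 ^ j * m ^ 3 \<le> 384 ^ j" and r: "0 < r"
    and few: "4 * card {S. S \<subseteq> grid m \<and> card S = s + 1 \<and> aligned S} \<le> r ^ s * m ^ 3"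
    and k: "4 * r * ((m ^ 3 + 1) ^ (2 * q * j) * ((9 * \<tau>\<^sup>2 * m\<^sup>2) choose k)) \<le> r ^ k"
  shows "\<exists>A\<subseteq>grid m. m ^ 3 \<le> 2 * r * card A \<and> (\<forall>S\<subseteq>A. card S = s + 1 \<longrightarrow> \<not> aligned S)
    \<and> (\<forall>I\<subseteq>A. alignment_free I \<longrightarrow> card I \<le> k)"
proof -
  let ?T = "{S. S \<subseteq> grid m \<and> card S = s + 1 \<and> aligned S}"
  let ?M = "9 * \<tau>\<^sup>2 * m\<^sup>2"
  have "1 \<le> ?M" using \<tau> m by (simp add: Suc_le_eq)
  then have "384 ^ j * 1 \<le> 384 ^ j * ?M" by (rule mult_left_mono) simp
  then have "383 ^ j * card (grid m) \<le> 384 ^ j * ?M" using j unfolding card_grid by linarith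
  from grid_containers[OF m \<tau> q order_refl this] obtain \<C> where \<C>: "finite \<C>"
    "card \<C> \<le> (m ^ 3 + 1) ^ (2 * q * j)" "\<forall>C\<in>\<C>. C \<subseteq> grid m \<and> card C \<le> ?M"
    "\<forall>I\<subseteq>grid m. alignment_free I \<longrightarrow> (\<exists>C\<in>\<C>. I \<subseteq> C)" by blast
  define \<K> where "\<K> = (\<Union>C\<in>\<C>. {K. K \<subseteq> C \<and> card K = k})"
  have finC: "finite C" if "C \<in> \<C>" for C using \<C>(3) that finite_grid finite_subset by blast
  have "card \<K> \<le> (\<Sum>C\<in>\<C>. card {K. K \<subseteq> C \<and> card K = k})"
    unfolding \<K>_def using \<C>(1) by (rule card_UN_le)
  also have "\<dots> \<le> (\<Sum>C\<in>\<C>. ?M choose k)"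
  proof (rule sum_mono)
    fix C assume C: "C \<in> \<C>"
    have "card {K. K \<subseteq> C \<and> card K = k} = card C choose k" using finC[OF C] by (rule n_subsets)
    also have "\<dots> \<le> ?M choose k" using \<C>(3) C by (intro binomial_right_mono) blast
    finally show "card {K. K \<subseteq> C \<and> card K = k} \<le> ?M choose k" .
  qed
  also have "\<dots> = card \<C> * (?M choose k)" by simp
  also have "\<dots> \<le> (m ^ 3 + 1) ^ (2 * q * j) * (?M choose k)" using \<C>(2) by (rule mult_right_mono) simp
  finally have "4 * r * card \<K> \<le> 4 * r * ((m ^ 3 + 1) ^ (2 * q * j) * (?M choose k))"
    by (rule mult_left_mono) simp
  then have K4: "4 * r * card \<K> \<le> r ^ k" using k by linarith
  have "grid m \<noteq> {}" using m card_grid[of m] by (auto simp: card_eq_0_iff)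
  have finK: "finite \<K>" unfolding \<K>_def using \<C>(1) finC by auto
  have subK: "K \<subseteq> grid m \<and> card K = k" if "K \<in> \<K>" for K using that \<C>(3) unfolding \<K>_def by blast
  have "\<exists>A\<subseteq>grid m. card (grid m) \<le> 2 * r * card A \<and> (\<forall>t\<in>?T. \<not> t \<subseteq> A) \<and> (\<forall>K\<in>\<K>. \<not> K \<subseteq> A)"
    by (rule colour_and_delete[OF finite_grid _ finK \<open>grid m \<noteq> {}\<close> r _ subK _ K4, of _ s])
      (use few in \<open>simp_all add: card_grid\<close>)
  then obtain A where A: "A \<subseteq> grid m" "m ^ 3 \<le> 2 * r * card A" "\<forall>t\<in>?T. \<not> t \<subseteq> A" "\<forall>K\<in>\<K>. \<not> K \<subseteq> A"
    unfolding card_grid by blast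
  have "card I \<le> k" if I: "I \<subseteq> A" "alignment_free I" for I
  proof (rule ccontr)
    assume "\<not> card I \<le> k"
    then have "k \<le> card I" by simp
    then obtain K where K: "K \<subseteq> I" "card K = k" by (metis obtain_subset_with_card_n)
    obtain C where "C \<in> \<C>" "I \<subseteq> C" using \<C>(4) I A(1) by (meson subset_trans)
    then have "K \<in> \<K>" using K unfolding \<K>_def by blast
    then show False using A(4) K(1) I(1) by blast
  qed
  moreover have "\<not> aligned S" if "S \<subseteq> A" "card S = s + 1" for S using A(1,3) that by blast
  ultimately show ?thesis using A(1,2) by blast
qed

section \<open>Estimates for the choice of parameters\<close>

lemma self_power_le: "real k ^ k \<le> 3 ^ k * fact k"
proof (induction k)
  case (Suc k)
  show ?case
  proof (cases "k = 0")
    case False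
    have "(1 + 1 / real k) ^ k \<le> exp 1"
      using exp_ge_one_plus_x_over_n_power_n[of k 1] False by simp
    then have "(1 + 1 / real k) ^ k \<le> 3" using exp_le by linarith
    then have "real k ^ k * (1 + 1 / real k) ^ k \<le> real k ^ k * 3" by (rule mult_left_mono) simp
    moreover have "real k * (1 + 1 / real k) = real (Suc k)" using False by (simp add: field_simps)
    ultimately have "real (Suc k) ^ k \<le> 3 * real k ^ k" by (simp flip: power_mult_distrib)
    also have "\<dots> \<le> 3 * (3 ^ k * fact k)" using Suc by simp
    finally have "real (Suc k) * real (Suc k) ^ k \<le> real (Suc k) * (3 * (3 ^ k * fact k))"
      by (rule mult_left_mono) simp
    then show ?thesis by (simp add: algebra_simps)
  qed simp
qed simp

lemma exp_le_3_power: "exp (real k) \<le> 3 ^ k"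
proof -
  have "exp (real k) = exp 1 ^ k" by (simp flip: exp_of_nat_mult)
  also have "\<dots> \<le> 3 ^ k" using exp_le by (intro power_mono) auto
  finally show ?thesis .
qed

lemma ceiling_bounds:
  assumes "1 \<le> (x::real)" shows "x \<le> real (nat \<lceil>x\<rceil>)" "real (nat \<lceil>x\<rceil>) \<le> x + 1"
  using assms by linarith+

lemma ln_ge_1: "3 \<le> m \<Longrightarrow> 1 \<le> ln (real m)"
proof -
  assume "3 \<le> m"
  then have "exp 1 \<le> real m" using exp_le by linarith
  then show ?thesis using \<open>3 \<le> m\<close> by (simp add: ln_ge_iff)
qed

text \<open>From \<open>s^s \<le> 3^s * fact s\<close> and \<open>s \<le> 2^s\<close> follows
  \<open>s^s \<le> 6^s * fact (s - 1)\<close>. The factor \<open>108 * (1 + l)\<close>, with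
  \<open>108 = 4 * 27\<close>, is absorbed into \<open>(216 * l)^s\<close>, and
  \<open>1296 = 216 * 6\<close>.\<close>

lemma aligned_subsets_few:
  assumes s: "3 \<le> s" and m: "3 \<le> m" and r: "1296 * real m * ln m / s \<le> real r"
  shows "4 * card {S. S \<subseteq> grid m \<and> card S = s + 1 \<and> aligned S} \<le> r ^ s * m ^ 3"
proof -
  define l where "l = ln (real m)"
  have l: "1 \<le> l" unfolding l_def using m by (rule ln_ge_1)
  have fs: "fact s = real s * fact (s - 1)" using s by (simp add: fact_reduce)
  have "real s ^ s \<le> 3 ^ s * (real s * fact (s - 1))" using self_power_le[of s] fs by simp
  also have "\<dots> \<le> 3 ^ s * (2 ^ s * fact (s - 1))"
    by (intro mult_left_mono mult_right_mono) (auto intro: less_imp_le)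
  also have "\<dots> = 6 ^ s * fact (s - 1)" by (simp flip: power_mult_distrib mult.assoc)
  finally have "108 * (1 + l) * real s ^ s \<le> (216 * l) * (6 ^ s * fact (s - 1))"
    using l by (intro mult_mono[of "108 * (1 + l)" "216 * l"]) auto
  also have "\<dots> \<le> (216 * l) ^ s * (6 ^ s * fact (s - 1))"
  proof (rule mult_right_mono)
    show "216 * l \<le> (216 * l) ^ s" using l s by (intro self_le_power) auto
  qed simp
  also have "\<dots> = ((216 * l) * 6) ^ s * fact (s - 1)" unfolding power_mult_distrib[of "216 * l" 6] by simp
  also have "(216 * l) * 6 = 1296 * l" by simp
  finally have key: "108 * (1 + l) * real s ^ s \<le> (1296 * l) ^ s * fact (s - 1)" .
  have "real (4 * card {S. S \<subseteq> grid m \<and> card S = s + 1 \<and> aligned S}) \<le> 108 * real m ^ (s + 3) * (1 + l) / fact (s - 1)"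
    using card_aligned_subsets[of s m] s m by (simp add: l_def)
  also have "\<dots> \<le> (1296 * real m * l / s) ^ s * real m ^ 3"
  proof -
    have "(108 * (1 + l) * real s ^ s) * real m ^ (s + 3) \<le> ((1296 * l) ^ s * fact (s - 1)) * real m ^ (s + 3)"
      using key by (rule mult_right_mono) simp
    also have "\<dots> = (1296 * real m * l) ^ s * real m ^ 3 * fact (s - 1)"
      by (simp add: power_mult_distrib power_add)
    finally have "108 * real m ^ (s + 3) * (1 + l) * real s ^ s \<le> (1296 * real m * l) ^ s * real m ^ 3 * fact (s - 1)"
      by (simp add: algebra_simps)
    then show ?thesis using s by (simp add: power_divide field_simps)
  qed
  also have "\<dots> \<le> real r ^ s * real m ^ 3"
    using r l by (intro mult_right_mono power_mono) (auto simp: l_def)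
  finally have "real (4 * card {S. S \<subseteq> grid m \<and> card S = s + 1 \<and> aligned S}) \<le> real (r ^ s * m ^ 3)" by simp
  then show ?thesis by (simp only: of_nat_le_iff)
qed

text \<open>\<open>(383/384)^j \<le> exp (- j/384)\<close>, and \<open>1152 = 3 * 384\<close> rounds
  per unit of \<open>ln m\<close> beat \<open>m^3\<close>.\<close>

lemma shrink_steps:
  fixes m j :: nat
  assumes m: "1 \<le> m" and j: "1152 * ln m \<le> real j"
  shows "383 ^ j * m ^ 3 \<le> 384 ^ j"
proof -
  have "1 + (- 1 / 384) \<le> exp (- 1 / 384 :: real)" by (rule exp_ge_add_one_self)
  then have "383 / 384 \<le> exp (- 1 / 384 :: real)" by simp
  then have "(383 / 384) ^ j \<le> exp (- 1 / 384 :: real) ^ j" by (rule power_mono) simp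
  also have "\<dots> = exp (- real j / 384)" by (simp flip: exp_of_nat_mult)
  also have "\<dots> \<le> exp (- (3 * ln (real m)))" using j by simp
  also have "\<dots> = 1 / real m ^ 3"
  proof -
    have "exp (3 * ln (real m)) = exp (ln (real m)) ^ 3" by (simp flip: exp_of_nat_mult)
    then show ?thesis using m by (simp add: exp_minus inverse_eq_divide)
  qed
  finally have "383 ^ j * real m ^ 3 \<le> 384 ^ j" using m by (simp add: power_divide field_simps)
  then have "real (383 ^ j * m ^ 3) \<le> real (384 ^ j)" by simp
  then show ?thesis by (simp only: of_nat_le_iff)
qed

text \<open>\<open>M choose k\<close> is at most \<open>(3 * M / k)^k\<close>. The 9 in
  \<open>kr\<close> leaves a spare factor \<open>3^k \<ge> exp k\<close>, which by
  \<open>big\<close> pays for the number of containers and for \<open>4 * r\<close>.\<close>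

lemma union_bound:
  fixes m r M k e :: nat
  assumes r: "0 < r" and m: "2 \<le> m" and kr: "9 * real M \<le> real k * real r" and k: "0 < k"
    and big: "4 * real r + 4 * ln m * real e \<le> real k"
  shows "4 * r * ((m ^ 3 + 1) ^ e * (M choose k)) \<le> r ^ k"
proof -
  have "(M choose k) * fact k \<le> M ^ k" by (rule binomial_fact_pow)
  then have "real ((M choose k) * fact k) \<le> real (M ^ k)" by (simp only: of_nat_le_iff)
  then have 1: "real (M choose k) * fact k \<le> real M ^ k" by simp
  have "real (M choose k) * real k ^ k \<le> real (M choose k) * (3 ^ k * fact k)"
    using self_power_le by (rule mult_left_mono) simp
  also have "\<dots> = 3 ^ k * (real (M choose k) * fact k)" by simp
  also have "\<dots> \<le> 3 ^ k * real M ^ k" using 1 by (rule mult_left_mono) simp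
  finally have 2: "real (M choose k) * real k ^ k \<le> (3 * real M) ^ k" by (simp add: power_mult_distrib)
  have "m ^ 3 * 2 \<le> m ^ 3 * m" using m by (rule mult_left_mono) simp
  moreover have "1 \<le> m ^ 3" using m by simp
  moreover have "m ^ 3 * m = m ^ 4" by (simp add: eval_nat_numeral)
  ultimately have "m ^ 3 + 1 \<le> m ^ 4" by linarith
  then have "real (m ^ 3 + 1) \<le> real (m ^ 4)" by (simp only: of_nat_le_iff)
  then have "(real m ^ 3 + 1) ^ e \<le> (real m ^ 4) ^ e" by (intro power_mono) auto
  also have "real m ^ 4 = exp (4 * ln m)"
  proof -
    have "exp (4 * ln (real m)) = exp (ln (real m)) ^ 4" by (simp flip: exp_of_nat_mult)
    then show ?thesis using m by simp
  qed
  also have "exp (4 * ln (real m)) ^ e = exp (4 * ln m * real e)" by (simp add: mult.commute flip: exp_of_nat_mult)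
  finally have "(real m ^ 3 + 1) ^ e \<le> exp (4 * ln m * real e)" .
  moreover have "4 * real r \<le> exp (4 * real r)"
    using exp_ge_add_one_self[of "4 * real r"] by linarith
  ultimately have "4 * real r * (real m ^ 3 + 1) ^ e \<le> exp (4 * real r) * exp (4 * ln m * real e)"
    by (intro mult_mono[of "4 * real r"]) auto
  also have "\<dots> = exp (4 * real r + 4 * ln m * real e)" by (simp add: exp_add)
  also have "\<dots> \<le> exp (real k)" using big by simp
  also have "\<dots> \<le> 3 ^ k" by (rule exp_le_3_power)
  finally have 3: "4 * real r * (real m ^ 3 + 1) ^ e \<le> 3 ^ k" .
  have "(4 * real r * (real m ^ 3 + 1) ^ e) * (real (M choose k) * real k ^ k) \<le> 3 ^ k * (3 * real M) ^ k"
    using 2 3 by (intro mult_mono[of "4 * real r * (real m ^ 3 + 1) ^ e"]) auto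
  also have "\<dots> = (3 * (3 * real M)) ^ k" by (rule power_mult_distrib[symmetric])
  also have "3 * (3 * real M) = 9 * real M" by simp
  also have "(9 * real M) ^ k \<le> (real k * real r) ^ k" using kr by (intro power_mono) auto
  also have "\<dots> = real r ^ k * real k ^ k" by (simp add: power_mult_distrib)
  finally have "(4 * real r * ((real m ^ 3 + 1) ^ e * real (M choose k))) * real k ^ k \<le> real r ^ k * real k ^ k"
    by (simp add: mult.assoc)
  then have "4 * real r * ((real m ^ 3 + 1) ^ e * real (M choose k)) \<le> real r ^ k" using k by simp
  then have "real (4 * r * ((m ^ 3 + 1) ^ e * (M choose k))) \<le> real (r ^ k)" by (simp add: add.commute)
  then show ?thesis by (simp only: of_nat_le_iff)
qed

text \<open>The parameters balance the container size \<open>\<tau>\<^sup>2m\<^sup>2\<close>, thinned by the factor \<open>s/m\<close>, against the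
  fingerprint length \<open>m\<^sup>2/\<tau>\<close>: this gives \<open>\<tau>\<^sup>3 = m/s\<close> up to constants and logarithms.\<close>

lemma sparse_grid:
  assumes s: "3 \<le> s" and sm: "s \<le> m"
  shows "\<exists>A\<subseteq>grid m. real m ^ 2 * real s \<le> 2594 * ln m * real (card A)
     \<and> (\<forall>S\<subseteq>A. card S = s + 1 \<longrightarrow> \<not> aligned S)
     \<and> (\<forall>I\<subseteq>A. alignment_free I \<longrightarrow>
          real (card I) \<le> 1000001 * (real m ^ 2 / (real m / real s) powr (1/3)) * (ln m)\<^sup>2)"
proof -
  have m: "3 \<le> m" using s sm by linarith
  define l where "l = ln (real m)"
  have l: "1 \<le> l" unfolding l_def using m by (rule ln_ge_1)
  have l2: "l \<le> l\<^sup>2" using l by (simp add: power2_eq_square)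
  define x where "x = real m / real s"
  have x: "1 \<le> x" "x \<le> real m" using s sm by (auto simp: x_def field_simps)
  define y where "y = x powr (1/3)"
  have y1: "1 \<le> y" using x by (simp add: y_def ge_one_powr_ge_zero)
  have y3: "y ^ 3 = x" using x by (simp add: y_def powr_power)
  have "y ^ 1 \<le> y ^ 3" using y1 by (intro power_increasing) auto
  then have ym: "y \<le> real m" using y3 x by simp
  define W where "W = real m ^ 2 / y"
  have mW: "real m \<le> W"
  proof -
    \<comment> \<open>This makes \<open>W\<close> dominate \<open>x\<close>, so that the number of
      colours is negligible against \<open>k\<close>.\<close>
    have "real m * y \<le> real m * real m" using ym by (intro mult_left_mono) auto
    then show ?thesis using y1 by (simp add: W_def pos_le_divide_eq power2_eq_square)
  qed
  have W1: "1 \<le> W" using mW m by linarith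
  have Wl: "W * 1 \<le> W * l\<^sup>2" "W * l \<le> W * l\<^sup>2" using W1 l l2 by (auto intro!: mult_left_mono)
  have xl: "x \<le> x * l" using x l by simp
  define r where "r = nat \<lceil>1296 * x * l\<rceil>"
  have "1 \<le> 1296 * x * l" using x xl by linarith
  then have rlo: "1296 * x * l \<le> real r" and rhi: "real r \<le> 1297 * (x * l)"
    using ceiling_bounds[of "1296 * x * l"] x xl unfolding r_def by linarith+
  have "0 < real r" using rlo x xl by linarith
  then have r: "0 < r" by simp
  define \<tau> where "\<tau> = 27 * nat \<lceil>y\<rceil>"
  have \<tau>lo: "27 * y \<le> real \<tau>" and \<tau>hi: "real \<tau> \<le> 54 * y"
    using ceiling_bounds[OF y1] y1 unfolding \<tau>_def of_nat_mult of_nat_numeral by linarith+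
  have \<tau>27: "27 \<le> \<tau>" using \<tau>lo y1 by linarith
  \<comment> \<open>\<open>1728 = 27 * 64\<close> splits between \<open>\<tau>\<close> and
    \<open>q\<close>.\<close>
  define q where "q = nat \<lceil>64 * W\<rceil>"
  have qlo: "64 * W \<le> real q" and qhi: "real q \<le> 65 * W"
    using ceiling_bounds[of "64 * W"] W1 unfolding q_def by linarith+
  have q: "1728 * m\<^sup>2 \<le> \<tau> * q"
  proof -
    have "1728 * real m ^ 2 = (27 * y) * (64 * W)" using y1 by (simp add: W_def)
    also have "\<dots> \<le> real \<tau> * real q" using \<tau>lo qlo y1 W1 by (intro mult_mono) auto
    finally have "real (1728 * m\<^sup>2) \<le> real (\<tau> * q)" by simp
    then show ?thesis by (simp only: of_nat_le_iff)
  qed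
  define j where "j = nat \<lceil>1152 * l\<rceil>"
  have jlo: "1152 * l \<le> real j" and jhi: "real j \<le> 1153 * l"
    using ceiling_bounds[of "1152 * l"] l unfolding j_def by linarith+
  \<comment> \<open>The factor must exceed \<open>5188 + 599560\<close>, the costs of
    \<open>4 * r\<close> and of the fingerprints in \<open>big\<close>; \<open>kr\<close> then holds
    with ample room.\<close>
  define k where "k = nat \<lceil>1000000 * (W * l\<^sup>2)\<rceil>"
  have klo: "1000000 * (W * l\<^sup>2) \<le> real k" and khi: "real k \<le> 1000001 * (W * l\<^sup>2)"
    using ceiling_bounds[of "1000000 * (W * l\<^sup>2)"] W1 Wl unfolding k_def by linarith+
  have k0: "0 < k" using klo W1 Wl by (intro gr0I) auto
  define M where "M = 9 * \<tau>\<^sup>2 * m\<^sup>2"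
  have kr: "9 * real M \<le> real k * real r"
  proof -
    have "real \<tau> ^ 2 \<le> (54 * y)^2" using \<tau>hi by (intro power_mono) auto
    then have "81 * real m ^ 2 * real \<tau> ^ 2 \<le> 81 * real m ^ 2 * (54 * y)^2" by (rule mult_left_mono) simp
    then have "9 * real M \<le> 236196 * (real m ^ 2 * y ^ 2)" by (simp add: M_def power_mult_distrib algebra_simps)
    also have "\<dots> \<le> 1296000000 * (real m ^ 2 * y ^ 2)" by (rule mult_right_mono) auto
    also have "\<dots> = (1000000 * W) * (1296 * y ^ 3)" using y1 by (simp add: W_def field_simps eval_nat_numeral)
    also have "\<dots> = (1000000 * W) * (1296 * x)" by (simp add: y3)
    also have "\<dots> \<le> real k * real r"
    proof (rule mult_mono)
      show "1000000 * W \<le> real k" using klo Wl by linarith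
      show "1296 * x \<le> real r" using rlo xl by linarith
    qed (use x in auto)
    finally show ?thesis .
  qed
  have big: "4 * real r + 4 * ln m * real (2 * q * j) \<le> real k"
  proof -
    have "x * l \<le> W * l" using x mW l by (intro mult_right_mono) auto
    then have 1: "4 * real r \<le> 5188 * (W * l\<^sup>2)" using rhi Wl by linarith
    have "real q * real j \<le> (65 * W) * (1153 * l)" using qhi jhi W1 by (intro mult_mono) auto
    then have "8 * l * (real q * real j) \<le> 8 * l * ((65 * W) * (1153 * l))" using l by (intro mult_left_mono) auto
    also have "\<dots> = 599560 * (W * l\<^sup>2)" by (simp add: power2_eq_square)
    finally have "4 * ln m * real (2 * q * j) \<le> 599560 * (W * l\<^sup>2)" by (simp add: l_def mult.assoc)
    then show ?thesis using 1 klo W1 Wl by linarith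
  qed
  have "\<exists>A\<subseteq>grid m. m ^ 3 \<le> 2 * r * card A \<and> (\<forall>S\<subseteq>A. card S = s + 1 \<longrightarrow> \<not> aligned S)
    \<and> (\<forall>I\<subseteq>A. alignment_free I \<longrightarrow> card I \<le> k)"
  proof (rule random_grid[OF _ s \<tau>27 q _ r])
    show "1 \<le> m" using m by simp
    show "383 ^ j * m ^ 3 \<le> 384 ^ j" using m jlo by (intro shrink_steps) (auto simp: l_def)
    show "4 * card {S. S \<subseteq> grid m \<and> card S = s + 1 \<and> aligned S} \<le> r ^ s * m ^ 3"
      using s m rlo by (intro aligned_subsets_few) (auto simp: x_def l_def)
    show "4 * r * ((m ^ 3 + 1) ^ (2 * q * j) * ((9 * \<tau>\<^sup>2 * m\<^sup>2) choose k)) \<le> r ^ k"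
      using union_bound[OF r _ kr k0 big] m by (simp add: M_def)
  qed
  then obtain A where A: "A \<subseteq> grid m" "m ^ 3 \<le> 2 * r * card A" "\<forall>S\<subseteq>A. card S = s + 1 \<longrightarrow> \<not> aligned S"
    "\<forall>I\<subseteq>A. alignment_free I \<longrightarrow> card I \<le> k" by blast
  have "real (m ^ 3) \<le> real (2 * r * card A)" using A(2) by (simp only: of_nat_le_iff)
  also have "\<dots> = real r * (2 * real (card A))" by simp
  also have "\<dots> \<le> (1297 * (x * l)) * (2 * real (card A))" using rhi by (rule mult_right_mono) simp
  also have "\<dots> = real m * (2594 * l * real (card A)) / real s" by (simp add: x_def)
  finally have "real m * (real m ^ 2 * real s) \<le> real m * (2594 * l * real (card A))"
    using s by (simp add: field_simps eval_nat_numeral)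
  then have "real m ^ 2 * real s \<le> 2594 * l * real (card A)" using m by simp
  moreover have "real (card I) \<le> 1000001 * W * l\<^sup>2" if "I \<subseteq> A" "alignment_free I" for I
  proof -
    have "card I \<le> k" using A(4) that by blast
    then show ?thesis using khi by simp
  qed
  ultimately show ?thesis using A(1,3) unfolding W_def y_def x_def l_def by blast
qed

section \<open>Bounds for \<open>f\<close>\<close>

lemma f_le_small_s:
  "\<exists>C. \<forall>\<^sub>F n in at_top. \<forall>s. 3 \<le> s \<and> real s \<le> real n powr (1/3) \<longrightarrow>
     real (f n s) \<le> C * (real n powr (5/6) / sqrt (real s)) * ln (real n) ^ 4"
proof -
  have "\<forall>\<^sub>F n in at_top. 60 * sqrt (real n) * ln (real n) + 1 \<le> real n" by real_asymp
  moreover have "\<forall>\<^sub>F n in at_top. 3 \<le> (n::nat)" by (rule eventually_ge_at_top)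
  ultimately have "\<forall>\<^sub>F n in at_top. \<forall>s. 3 \<le> s \<and> real s \<le> real n powr (1/3) \<longrightarrow>
     real (f n s) \<le> (1000001 * 3721) * (real n powr (5/6) / sqrt (real s)) * ln (real n) ^ 4"
  proof eventually_elim
    case (elim n)
    show ?case
    proof (intro allI impI, elim conjE)
      fix s :: nat assume s: "3 \<le> s" and sn: "real s \<le> real n powr (1/3)"
      define l where "l = ln (real n)"
      have l: "1 \<le> l" unfolding l_def using elim(2) by (rule ln_ge_1)
      define w where "w = real n / real s"
      have "real s ^ 3 \<le> (real n powr (1/3)) ^ 3" using sn by (rule power_mono) simp
      also have "\<dots> = real n" using elim(2) by (simp add: powr_power)
      \<comment> \<open>From \<open>s^3 \<le> n\<close> comes \<open>s \<le> sqrt (n/s)\<close>,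
        hence the condition \<open>s \<le> m\<close> of \<open>sparse_grid\<close>.\<close>
      finally have "real s ^ 2 \<le> w" using s by (simp add: w_def field_simps eval_nat_numeral)
      then have sw: "real s \<le> sqrt w" by (rule real_le_rsqrt)
      have w0: "0 < w" using s elim(2) by (simp add: w_def)
      define z where "z = sqrt w * l"
      have "sqrt w * 1 \<le> sqrt w * l" using l w0 by (intro mult_left_mono) auto
      then have sz: "real s \<le> z" using sw by (simp add: z_def)
      then have z1: "1 \<le> z" using s by linarith
      \<comment> \<open>The constant 60 makes \<open>60^2 = 3600\<close> exceed the 2594 of
        \<open>sparse_grid\<close>, so at least \<open>n\<close> points survive; any
        \<open>n\<close> of them inherit both properties.\<close>
      define m where "m = nat \<lceil>60 * z\<rceil>"
      have mlo: "60 * z \<le> real m" and mhi: "real m \<le> 60 * z + 1"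
        using ceiling_bounds[of "60 * z"] z1 unfolding m_def by linarith+
      have sm: "s \<le> m" using sz mlo z1 by linarith
      have "w \<le> real n" using s by (simp add: w_def field_simps mult_le_cancel_left1)
      then have "z \<le> sqrt (real n) * l" unfolding z_def using l by (intro mult_right_mono) auto
      then have "60 * z + 1 \<le> 60 * sqrt (real n) * l + 1" by simp
      then have "real m \<le> real n" using elim(1) mhi unfolding l_def by linarith
      then have lm: "ln (real m) \<le> l" "0 \<le> ln (real m)" using s sm by (auto simp: l_def)
      let ?W = "real m ^ 2 / (real m / real s) powr (1/3)"
      obtain A where A: "A \<subseteq> grid m" "real m ^ 2 * real s \<le> 2594 * ln m * real (card A)"
        "\<forall>S\<subseteq>A. card S = s + 1 \<longrightarrow> \<not> aligned S"
        "\<forall>I\<subseteq>A. alignment_free I \<longrightarrow> real (card I) \<le> 1000001 * ?W * (ln m)\<^sup>2"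
        using sparse_grid[OF s sm] by blast
      have "n \<le> card A"
      proof -
        have "(60 * z)^2 * real s \<le> real m ^ 2 * real s"
          using mlo z1 by (intro mult_right_mono power_mono) auto
        moreover have "(60 * z)^2 * real s = 3600 * real n * l * l"
        proof -
          have "z\<^sup>2 = w * l\<^sup>2" using w0 by (simp add: z_def power_mult_distrib)
          then have "(60 * z)^2 * real s = 3600 * (w * real s) * l\<^sup>2" by (simp add: power_mult_distrib)
          also have "w * real s = real n" using s by (simp add: w_def)
          finally show ?thesis by (simp add: power2_eq_square)
        qed
        moreover have "2594 * ln m * real (card A) \<le> 2594 * l * real (card A)"
          using lm by (intro mult_right_mono) auto
        ultimately have "l * (3600 * (real n * l)) \<le> l * (2594 * real (card A))" using A(2) by (simp add: algebra_simps)
        then have "3600 * (real n * l) \<le> 2594 * real (card A)" using l by simp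
        moreover have "real n * 1 \<le> real n * l" using l by (intro mult_left_mono) auto
        ultimately have "real n \<le> real (card A)" by linarith
        then show ?thesis by simp
      qed
      then obtain B where B: "B \<subseteq> A" "card B = n" by (metis obtain_subset_with_card_n)
      have "f n s \<le> nat \<lfloor>1000001 * ?W * (ln m)\<^sup>2\<rfloor>"
      proof (rule f_le_of_grid[of s B m])
        show "2 \<le> s" using s by simp
        show "B \<subseteq> grid m" "card B = n" using A B by auto
        show "\<not> aligned S" if "S \<subseteq> B" "card S = s + 1" for S using A(3) B(1) that by blast
        fix I assume "I \<subseteq> B" "alignment_free I"
        then have "real (card I) \<le> 1000001 * ?W * (ln m)\<^sup>2" using A(4) B(1) by blast
        then show "card I \<le> nat \<lfloor>1000001 * ?W * (ln m)\<^sup>2\<rfloor>" by (simp add: le_nat_floor)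
      qed
      moreover have "0 \<le> 1000001 * ?W * (ln m)\<^sup>2" by simp
      ultimately have fB: "real (f n s) \<le> 1000001 * ?W * (ln m)\<^sup>2" by linarith
      have m0: "0 < real m" and s0: "0 < real s" and n0: "0 < real n" using s sm elim(2) by auto
      have "?W = real m powr 2 / (real m powr (1/3) / real s powr (1/3))"
        using m0 s0 by (simp add: powr_divide powr_numeral)
      also have "\<dots> = real m powr (2 - 1/3) * real s powr (1/3)" by (simp only: powr_diff) simp
      also have "\<dots> \<le> (61 * (sqrt w * l)) powr (5/3) * real s powr (1/3)"
        using mhi z1 m0 by (intro mult_right_mono) (auto simp: z_def intro!: powr_mono2)
      also have "(61 * (sqrt w * l)) powr (5/3) = 61 powr (5/3) * ((sqrt w) powr (5/3) * l powr (5/3))"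
        using w0 l by (simp add: powr_mult)
      also have "sqrt w powr (5/3) = w powr (5/6)" using w0 by (simp add: powr_half_sqrt[symmetric] powr_powr)
      also have "w powr (5/6) = real n powr (5/6) / real s powr (5/6)" using n0 s0 by (simp add: w_def powr_divide)
      finally have "?W \<le> (61 powr (5/3) * l powr (5/3)) * (real n powr (5/6) * (real s powr (1/3) / real s powr (5/6)))"
        by (simp add: mult_ac)
      also have "real s powr (1/3) / real s powr (5/6) = 1 / sqrt (real s)"
      proof -
        have "real s powr (1/3) / real s powr (5/6) = real s powr (1/3 - 5/6)" by (rule powr_diff[symmetric])
        also have "\<dots> = 1 / real s powr (1/2)" by (simp add: powr_minus_divide)
        finally show ?thesis by (simp add: powr_half_sqrt)
      qed
      \<comment> \<open>Rounding \<open>5/3\<close> up to 2 leaves \<open>l^2\<close>; with the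
        \<open>(ln m)^2\<close> of \<open>sparse_grid\<close> this makes the fourth power of the
        logarithm.\<close>
      also have "(61 powr (5/3) * l powr (5/3)) * (real n powr (5/6) * (1 / sqrt (real s)))
          \<le> (61 powr 2 * l powr 2) * (real n powr (5/6) * (1 / sqrt (real s)))"
        using l by (intro mult_right_mono mult_mono powr_mono) auto
      also have "\<dots> = 3721 * (real n powr (5/6) / sqrt (real s)) * l\<^sup>2" using l by (simp add: powr_numeral)
      finally have W: "?W \<le> 3721 * (real n powr (5/6) / sqrt (real s)) * l\<^sup>2" .
      have "1000001 * ?W * (ln m)\<^sup>2 \<le> 1000001 * (3721 * (real n powr (5/6) / sqrt (real s)) * l\<^sup>2) * l\<^sup>2"
        using W lm by (intro mult_mono power_mono) auto
      also have "\<dots> = (1000001 * 3721) * (real n powr (5/6) / sqrt (real s)) * l ^ 4"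
        by (simp add: eval_nat_numeral)
      finally show "real (f n s) \<le> (1000001 * 3721) * (real n powr (5/6) / sqrt (real s)) * ln (real n) ^ 4"
        using fB unfolding l_def by linarith
    qed
  qed
  then show ?thesis by blast
qed

lemma f_bigo_large_s:
  fixes s :: "nat \<Rightarrow> nat"
  assumes "\<forall>\<^sub>F n in at_top. real n powr (1/3) \<le> real (s n) \<and> s n \<le> n"
  shows "(\<lambda>n. real (f n (s n))) \<in> O(\<lambda>n. real n / real (s n))"
proof (rule landau_o.bigI[of 4])
  have "\<forall>\<^sub>F n in at_top. 8 \<le> (n::nat)" by (rule eventually_ge_at_top)
  with assms show "\<forall>\<^sub>F n in at_top. norm (real (f n (s n))) \<le> 4 * norm (real n / real (s n))"
  proof eventually_elim
    case (elim n)
    have "(8::real) powr (1/3) \<le> real n powr (1/3)" using elim(2) by (intro powr_mono2) auto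
    moreover have "(8::real) powr (1/3) = 2"
    proof -
      have "(8::real) = 2 powr 3" by (simp add: powr_numeral)
      then show ?thesis by (simp only: powr_powr) simp
    qed
    ultimately have s2: "2 \<le> s n" using elim(1) by linarith
    have "real n = (real n powr (1/3)) ^ 3" using elim(2) by (simp add: powr_power)
    also have "\<dots> \<le> real (s n) ^ 3" using elim(1) by (intro power_mono) auto
    finally have "real n \<le> real (s n ^ 3)" by simp
    then have "n \<le> s n ^ 3" by (simp only: of_nat_le_iff)
    from f_le_rows[OF s2 this] have "real (f n (s n)) \<le> real (2 * (n div s n + 1))" by (simp only: of_nat_le_iff)
    moreover have "real (n div s n) \<le> real n / real (s n)" by (rule of_nat_div_le_of_nat)
    \<comment> \<open>This absorbs the additive 1 of \<open>f_le_rows\<close> and yields the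
      constant 4.\<close>
    moreover have "1 \<le> real n / real (s n)" using elim(1) s2 by simp
    ultimately show ?case by simp
  qed
qed simp

text \<open>The hypothesis turns both terms of the triple bound into multiples of
  \<open>s^2\<close>, so \<open>K * s\<close> colours meet the condition of
  \<open>general_position_subset\<close>.\<close>

lemma f_ge_of_sqrt_bound:
  assumes n: "3 \<le> n" and s: "2 \<le> s" "s \<le> n" and c: "sqrt (real n * ln (real n)) \<le> c * real s" "0 < c"
    and K: "4 * (1728 * c\<^sup>2 + 18) \<le> real K"
  shows "real n \<le> 2 * real K * real s * real (f n s)"
proof -
  have l: "1 \<le> ln (real n)" using n by (rule ln_ge_1)
  have K1: "1 \<le> real K" using K by (smt (verit) zero_le_power2)
  have nl: "real n * ln n \<le> c\<^sup>2 * real s ^ 2"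
  proof -
    have "(sqrt (real n * ln n))^2 \<le> (c * real s)^2" using c l by (intro power_mono) auto
    then show ?thesis using l by (simp add: power_mult_distrib)
  qed
  have "1 + ln (real s) \<le> 2 * ln (real n)"
    using l s by (smt (verit) ln_le_cancel_iff of_nat_0_less_iff of_nat_le_iff zero_less_numeral less_le_trans)
  then have "864 * real n * (1 + ln (real s)) \<le> 864 * real n * (2 * ln (real n))" by (intro mult_left_mono) auto
  then have "4 * (864 * real n * (1 + ln s) + 18 * real s^2) \<le> 4 * (1728 * c\<^sup>2 + 18) * real s ^ 2"
    using nl by (simp add: algebra_simps)
  also have "\<dots> \<le> (real K * real K) * real s ^ 2"
  proof (rule mult_right_mono)
    have "real K * 1 \<le> real K * real K" using K1 by (intro mult_left_mono) auto
    then show "4 * (1728 * c\<^sup>2 + 18) \<le> real K * real K" using K by linarith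
  qed simp
  also have "\<dots> = real (K * s) ^ 2" by (simp add: power2_eq_square)
  finally have big: "4 * (864 * real n * (1 + ln s) + 18 * real s^2) \<le> real (K * s) ^ 2" .
  have r: "0 < K * s" using K1 s by (intro mult_pos_pos) auto
  define k where "k = nat \<lceil>real n / (2 * real K * real s)\<rceil>"
  have pos: "0 < 2 * real K * real s" using K1 s by simp
  have "forces_general_position n s k"
    unfolding forces_general_position_def
  proof (intro allI impI, elim conjE)
    fix P :: "(real ^ 2) set" assume P: "finite P" "card P = n" "no_collinear (s + 1) P"
    have "P \<noteq> {}" using P n by auto
    then obtain Q where Q: "Q \<subseteq> P" "card P \<le> 2 * (K * s) * card Q" "general_position Q"
      using general_position_subset[OF P(1,3) s(1) r] big P(2) by auto
    have "real n \<le> real (2 * (K * s) * card Q)" using Q(2) P(2) by (simp only: of_nat_le_iff)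
    then have "real n / (2 * real K * real s) \<le> real (card Q)"
      using pos by (simp add: pos_divide_le_eq algebra_simps)
    then have "k \<le> card Q" unfolding k_def by (simp add: ceiling_le_iff nat_le_iff)
    \<comment> \<open>\<open>forces_general_position\<close> asks for exactly \<open>k\<close>
      points, so the large subset is trimmed.\<close>
    then obtain R where R: "R \<subseteq> Q" "card R = k" by (metis obtain_subset_with_card_n)
    then have "general_position R" using Q(3) unfolding general_position_def no_collinear_def by blast
    then show "\<exists>Q\<subseteq>P. card Q = k \<and> general_position Q" using R Q(1) by blast
  qed
  then have "k \<le> f n s" using f_is_greatest(2)[OF s(1)] by blast
  then have "real k \<le> real (f n s)" by simp
  moreover have "real n / (2 * real K * real s) \<le> real k" unfolding k_def by linarith
  ultimately have "real n / (2 * real K * real s) \<le> real (f n s)" by linarith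
  then show ?thesis using pos by (simp add: pos_divide_le_eq algebra_simps)
qed

theorem theorem1p1:
  "(\<forall>s :: nat \<Rightarrow> nat.
      (\<forall>\<^sub>F n in at_top. real n powr (1/3) \<le> real (s n) \<and> s n \<le> n) \<longrightarrow>
      (\<lambda>n. real (f n (s n))) \<in> O(\<lambda>n. real n / real (s n)))
   \<and> (\<exists>\<epsilon> :: nat \<Rightarrow> real. \<epsilon> \<in> o(\<lambda>_. 1) \<and>
       (\<forall>s :: nat \<Rightarrow> nat.
          (\<forall>\<^sub>F n in at_top. 3 \<le> s n \<and> real (s n) \<le> real n powr (1/3)) \<longrightarrow>
          (\<lambda>n. real (f n (s n))) \<in> O(\<lambda>n. real n powr (5/6 + \<epsilon> n) / sqrt (real (s n)))))
   \<and> (\<forall>s :: nat \<Rightarrow> nat.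
        (\<forall>\<^sub>F n in at_top. s n \<le> n) \<and>
        (\<lambda>n. real (s n)) \<in> \<Omega>(\<lambda>n. sqrt (real n * ln (real n))) \<longrightarrow>
        (\<lambda>n. real (f n (s n))) \<in> \<Theta>(\<lambda>n. real n / real (s n)))"
proof (intro conjI)
  show "\<forall>s :: nat \<Rightarrow> nat.
      (\<forall>\<^sub>F n in at_top. real n powr (1/3) \<le> real (s n) \<and> s n \<le> n) \<longrightarrow>
      (\<lambda>n. real (f n (s n))) \<in> O(\<lambda>n. real n / real (s n))"
    using f_bigo_large_s by blast
  show "\<exists>\<epsilon> :: nat \<Rightarrow> real. \<epsilon> \<in> o(\<lambda>_. 1) \<and>
       (\<forall>s :: nat \<Rightarrow> nat.
          (\<forall>\<^sub>F n in at_top. 3 \<le> s n \<and> real (s n) \<le> real n powr (1/3)) \<longrightarrow>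
          (\<lambda>n. real (f n (s n))) \<in> O(\<lambda>n. real n powr (5/6 + \<epsilon> n) / sqrt (real (s n))))"
  proof (intro exI[of _ "\<lambda>n. 4 * ln (ln (real n)) / ln (real n)"] conjI allI impI)
    \<comment> \<open>With this exponent \<open>n powr \<epsilon> n\<close> equals
      \<open>ln n ^ 4\<close>. One \<open>\<epsilon>\<close> serves every \<open>s\<close> because
      the bound in \<open>f_le_small_s\<close> is uniform in \<open>s\<close>.\<close>
    show "(\<lambda>n. 4 * ln (ln (real n)) / ln (real n)) \<in> o(\<lambda>_. 1)" by real_asymp
    fix s :: "nat \<Rightarrow> nat"
    assume s: "\<forall>\<^sub>F n in at_top. 3 \<le> s n \<and> real (s n) \<le> real n powr (1/3)"
    obtain C where C: "\<forall>\<^sub>F n in at_top. \<forall>s. 3 \<le> s \<and> real s \<le> real n powr (1/3) \<longrightarrow>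
        real (f n s) \<le> C * (real n powr (5/6) / sqrt (real s)) * ln (real n) ^ 4"
      using f_le_small_s by blast
    have "\<forall>\<^sub>F n in at_top. 3 \<le> (n::nat)" by (rule eventually_ge_at_top)
    with s C have "\<forall>\<^sub>F n in at_top. norm (real (f n (s n)))
        \<le> C * norm (real n powr (5/6 + 4 * ln (ln (real n)) / ln (real n)) / sqrt (real (s n)))"
    proof eventually_elim
      case (elim n)
      have l: "1 \<le> ln (real n)" using elim(3) by (rule ln_ge_1)
      have "real n powr (4 * ln (ln (real n)) / ln (real n)) = exp (4 * ln (ln (real n)))"
        using l elim(3) by (simp add: powr_def)
      also have "\<dots> = exp (ln (ln (real n))) ^ 4" by (simp flip: exp_of_nat_mult)
      also have "\<dots> = ln (real n) ^ 4" using l by simp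
      finally have "real n powr (5/6 + 4 * ln (ln (real n)) / ln (real n)) = real n powr (5/6) * ln (real n) ^ 4"
        by (simp add: powr_add)
      then show ?case using elim(1,2) by (simp add: mult.assoc)
    qed
    then show "(\<lambda>n. real (f n (s n))) \<in> O(\<lambda>n. real n powr (5/6 + 4 * ln (ln (real n)) / ln (real n)) / sqrt (real (s n)))"
      by (rule bigoI)
  qed
  show "\<forall>s :: nat \<Rightarrow> nat.
        (\<forall>\<^sub>F n in at_top. s n \<le> n) \<and>
        (\<lambda>n. real (s n)) \<in> \<Omega>(\<lambda>n. sqrt (real n * ln (real n))) \<longrightarrow>
        (\<lambda>n. real (f n (s n))) \<in> \<Theta>(\<lambda>n. real n / real (s n))"
  proof (intro allI impI, elim conjE)
    fix s :: "nat \<Rightarrow> nat"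
    assume s: "\<forall>\<^sub>F n in at_top. s n \<le> n"
      and om: "(\<lambda>n. real (s n)) \<in> \<Omega>(\<lambda>n. sqrt (real n * ln (real n)))"
    then have "(\<lambda>n. sqrt (real n * ln (real n))) \<in> O(\<lambda>n. real (s n))" by (simp add: bigomega_iff_bigo)
    then obtain c where c: "0 < c"
      and cs: "\<forall>\<^sub>F n in at_top. norm (sqrt (real n * ln (real n))) \<le> c * norm (real (s n))"
      by (rule landau_o.bigE)
    \<comment> \<open>This places \<open>s\<close> in the first range, so its upper bound
      applies.\<close>
    have "(\<lambda>n::nat. real n powr (1/3)) \<in> o(\<lambda>n. sqrt (real n * ln (real n)))" by real_asymp
    then have "\<forall>\<^sub>F n::nat in at_top. norm (real n powr (1/3)) \<le> (1 / c) * norm (sqrt (real n * ln (real n)))"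
      using c by (intro landau_o.smallD) auto
    with s cs have lo: "\<forall>\<^sub>F n in at_top. real n powr (1/3) \<le> real (s n) \<and> s n \<le> n"
    proof eventually_elim
      case (elim n)
      have "real n powr (1/3) \<le> (1 / c) * \<bar>sqrt (real n * ln (real n))\<bar>" using elim(3) by simp
      also have "\<dots> \<le> (1 / c) * (c * real (s n))" using elim(2) c by (intro mult_left_mono) auto
      finally show ?case using c elim(1) by simp
    qed
    show "(\<lambda>n. real (f n (s n))) \<in> \<Theta>(\<lambda>n. real n / real (s n))"
    proof (rule bigthetaI)
      show "(\<lambda>n. real (f n (s n))) \<in> O(\<lambda>n. real n / real (s n))" using lo by (rule f_bigo_large_s)
      obtain K :: nat where K: "4 * (1728 * c\<^sup>2 + 18) \<le> real K" using real_arch_simple by blast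
      have "\<forall>\<^sub>F n in at_top. 8 \<le> (n::nat)" by (rule eventually_ge_at_top)
      with lo cs have "\<forall>\<^sub>F n in at_top. norm (real n / real (s n)) \<le> (2 * real K) * norm (real (f n (s n)))"
      proof eventually_elim
        case (elim n)
        have "1 powr (1/3) < real n powr (1/3)" using elim(3) by (intro powr_less_mono2) auto
        then have s2: "2 \<le> s n" using elim(1) by simp
        have "real n \<le> 2 * real K * real (s n) * real (f n (s n))"
          by (rule f_ge_of_sqrt_bound[OF _ s2 _ _ c K]) (use elim in auto)
        then show ?case using s2 by (simp add: divide_le_eq algebra_simps)
      qed
      then have "(\<lambda>n. real n / real (s n)) \<in> O(\<lambda>n. real (f n (s n)))" by (rule bigoI)
      then show "(\<lambda>n. real (f n (s n))) \<in> \<Omega>(\<lambda>n. real n / real (s n))" by (simp add: bigomega_iff_bigo)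
    qed
  qed
qed

end
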